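(* Let $L=L_{-1}\oplus L_0\oplus L_1$ be a semiprime 3-graded Lie algebra over a unital commutative ring $\Phi$. Then: (i) The maximal algebra of quotients $Q_m(L)$ is ($\mathbb Z$-)graded and is graded isomorphic to the maximal graded algebra of quotients $Q_{gr-m}(L)$. (ii) If $L$ is strongly nondegenerate and $\Phi$ is 2- and 3-torsion free, then $Q_m(L)$ is a 3-graded strongly nondegenerate Lie algebra.
   Context: A 3-graded Lie algebra is a $\mathbb Z$-graded Lie algebra $L=\bigoplus_{k\in\mathbb Z}L_k$, $[L_i,L_j]\subseteq L_{i+j}$, with $L_k=0$ for $k\notin\{-1,0,1\}$. A graded ideal is an ideal containing all homogeneous components of its elements. $L$ is semiprime if $[I,I]\ne0$ for every nonzero ideal $I$, and graded semiprime if this holds for every nonzero graded ideal $I$. A (graded) ideal is (graded) essential if it meets every nonzero (graded) ideal nontrivially. $L$ is strongly nondegenerate if $x\in L$ and $[x,[x,L]]=0$ imply $x=0$. For an ideal $I$ of $L$, $\mathrm{Der}(I,L)$ is the $\Phi$-module of linear maps $\delta:I\to L$ with $\delta([x,y])=[\delta x,y]+[x,\delta y]$ for $x,y\in I$. If $I$ is graded, $\mathrm{Der}_{gr}(I,L)_k$ is the set of those $\delta$ with $\delta(I_j)\subseteq L_{j+k}$ for all $j$, and $\mathrm{Der}_{gr}(I,L)=\bigoplus_k\mathrm{Der}_{gr}(I,L)_k$. For $L$ semiprime, $Q_m(L)=\varinjlim \mathrm{Der}(I,L)$, the direct limit (under restriction) over all essential ideals $I$ of $L$. Its elements are classes $\delta_I$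 of derivations $\delta\in\mathrm{Der}(I,L)$, with $\delta_I=\mu_J$ iff $\delta$ and $\mu$ agree on some essential ideal contained in $I\cap J$; the bracket is $[\delta_I,\mu_J]=(\delta\mu-\mu\delta)_{[I\cap J,\,I\cap J]}$. For $L$ graded semiprime, $Q_{gr-m}(L)=\varinjlim\mathrm{Der}_{gr}(I,L)$ is defined likewise over all graded essential ideals $I$, with the grading whose degree $k$ component consists of the classes of derivations of degree $k$. $L$ is embedded in both via $x\mapsto(\mathrm{ad}\,x)_L$, where $\mathrm{ad}\,x(y)=[x,y]$.
   Formalization: "Φ is 2- and 3-torsion free" is taken to mean that 2x = 0 or 3x = 0 implies x = 0 for x in L; torsion-freeness of the ring Φ alone makes (ii) false, e.g. Φ = Z and L over F_2 with basis e, h, f, [h,e] = e, [h,f] = f, [e,f] = h. *)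

theory Defs
  imports "HOL-Algebra.Module"
begin

section \<open>Lie algebras and ideals\<close>

(* The fields mult and one that module records inherit from ring records play no role. *)
record ('a, 'b) lie_alg = "('a, 'b) module" +
  bracket :: "'b \<Rightarrow> 'b \<Rightarrow> 'b" ("\<^bold>[_, _\<^bold>]\<index>")

locale lie_algebra = module R L for R (structure) and L (structure) +
  assumes bracket_closed:
      "\<lbrakk>x \<in> carrier L; y \<in> carrier L\<rbrakk> \<Longrightarrow> \<^bold>[x, y\<^bold>]\<^bsub>L\<^esub> \<in> carrier L"
    and bracket_add_left:
      "\<lbrakk>x \<in> carrier L; y \<in> carrier L; z \<in> carrier L\<rbrakk>
        \<Longrightarrow> \<^bold>[x \<oplus>\<^bsub>L\<^esub> y, z\<^bold>]\<^bsub>L\<^esub> = \<^bold>[x, z\<^bold>]\<^bsub>L\<^esub> \<oplus>\<^bsub>L\<^esub> \<^bold>[y, z\<^bold>]\<^bsub>L\<^esub>"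
    and bracket_add_right:
      "\<lbrakk>x \<in> carrier L; y \<in> carrier L; z \<in> carrier L\<rbrakk>
        \<Longrightarrow> \<^bold>[x, y \<oplus>\<^bsub>L\<^esub> z\<^bold>]\<^bsub>L\<^esub> = \<^bold>[x, y\<^bold>]\<^bsub>L\<^esub> \<oplus>\<^bsub>L\<^esub> \<^bold>[x, z\<^bold>]\<^bsub>L\<^esub>"
    and bracket_smult_left:
      "\<lbrakk>a \<in> carrier R; x \<in> carrier L; y \<in> carrier L\<rbrakk>
        \<Longrightarrow> \<^bold>[a \<odot>\<^bsub>L\<^esub> x, y\<^bold>]\<^bsub>L\<^esub> = a \<odot>\<^bsub>L\<^esub> \<^bold>[x, y\<^bold>]\<^bsub>L\<^esub>"
    and bracket_smult_right:
      "\<lbrakk>a \<in> carrier R; x \<in> carrier L; y \<in> carrier L\<rbrakk>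
        \<Longrightarrow> \<^bold>[x, a \<odot>\<^bsub>L\<^esub> y\<^bold>]\<^bsub>L\<^esub> = a \<odot>\<^bsub>L\<^esub> \<^bold>[x, y\<^bold>]\<^bsub>L\<^esub>"
    and bracket_self:
      "x \<in> carrier L \<Longrightarrow> \<^bold>[x, x\<^bold>]\<^bsub>L\<^esub> = \<zero>\<^bsub>L\<^esub>"
    and jacobi:
      "\<lbrakk>x \<in> carrier L; y \<in> carrier L; z \<in> carrier L\<rbrakk>
        \<Longrightarrow> \<^bold>[x, \<^bold>[y, z\<^bold>]\<^bsub>L\<^esub>\<^bold>]\<^bsub>L\<^esub> \<oplus>\<^bsub>L\<^esub> \<^bold>[y, \<^bold>[z, x\<^bold>]\<^bsub>L\<^esub>\<^bold>]\<^bsub>L\<^esub> \<oplus>\<^bsub>L\<^esub> \<^bold>[z, \<^bold>[x, y\<^bold>]\<^bsub>L\<^esub>\<^bold>]\<^bsub>L\<^esub> = \<zero>\<^bsub>L\<^esub>"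

definition lie_ideal ::
  "('a, 'r) ring_scheme \<Rightarrow> ('a, 'b, 'm) lie_alg_scheme \<Rightarrow> 'b set \<Rightarrow> bool" where
  "lie_ideal R L I \<longleftrightarrow>
     submodule I R L \<and> (\<forall>x\<in>carrier L. \<forall>y\<in>I. \<^bold>[x, y\<^bold>]\<^bsub>L\<^esub> \<in> I)"

definition bracket_span ::
  "('a, 'r) ring_scheme \<Rightarrow> ('a, 'b, 'm) lie_alg_scheme \<Rightarrow> 'b set \<Rightarrow> 'b set \<Rightarrow> 'b set" where
  "bracket_span R L I J =
     \<Inter> {N. submodule N R L \<and> (\<forall>x\<in>I. \<forall>y\<in>J. \<^bold>[x, y\<^bold>]\<^bsub>L\<^esub> \<in> N)}"

definition semiprime :: "('a, 'r) ring_scheme \<Rightarrow> ('a, 'b, 'm) lie_alg_scheme \<Rightarrow> bool" where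
  "semiprime R L \<longleftrightarrow>
     (\<forall>I. lie_ideal R L I \<and> I \<noteq> {\<zero>\<^bsub>L\<^esub>} \<longrightarrow> bracket_span R L I I \<noteq> {\<zero>\<^bsub>L\<^esub>})"

definition essential_ideal ::
  "('a, 'r) ring_scheme \<Rightarrow> ('a, 'b, 'm) lie_alg_scheme \<Rightarrow> 'b set \<Rightarrow> bool" where
  "essential_ideal R L I \<longleftrightarrow>
     lie_ideal R L I \<and>
     (\<forall>J. lie_ideal R L J \<and> J \<noteq> {\<zero>\<^bsub>L\<^esub>} \<longrightarrow> I \<inter> J \<noteq> {\<zero>\<^bsub>L\<^esub>})"

definition strongly_nondegenerate :: "('a, 'b, 'm) lie_alg_scheme \<Rightarrow> bool" where
  "strongly_nondegenerate L \<longleftrightarrow>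
     (\<forall>x\<in>carrier L. (\<forall>y\<in>carrier L. \<^bold>[x, \<^bold>[x, y\<^bold>]\<^bsub>L\<^esub>\<^bold>]\<^bsub>L\<^esub> = \<zero>\<^bsub>L\<^esub>) \<longrightarrow> x = \<zero>\<^bsub>L\<^esub>)"

(* "The scalars have no n-torsion" is a condition on how they act on L.  Torsion-freeness
   of the ring of scalars by itself would say nothing about L: every Lie algebra over a
   field of characteristic 2 is also a Lie algebra over the integers. *)
definition torsion_free :: "nat \<Rightarrow> ('a, 'b, 'm) lie_alg_scheme \<Rightarrow> bool" where
  "torsion_free n L \<longleftrightarrow> (\<forall>x\<in>carrier L. [n] \<cdot>\<^bsub>L\<^esub> x = \<zero>\<^bsub>L\<^esub> \<longrightarrow> x = \<zero>\<^bsub>L\<^esub>)"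


section \<open>Gradings\<close>

definition homogeneous_decomposition ::
  "('a, 'b, 'm) lie_alg_scheme \<Rightarrow> (int \<Rightarrow> 'b set) \<Rightarrow> 'b \<Rightarrow> (int \<Rightarrow> 'b) \<Rightarrow> bool" where
  "homogeneous_decomposition L G x c \<longleftrightarrow>
     (\<forall>k. c k \<in> G k) \<and> finite {k. c k \<noteq> \<zero>\<^bsub>L\<^esub>} \<and>
     x = (\<Oplus>\<^bsub>L\<^esub>k\<in>{k. c k \<noteq> \<zero>\<^bsub>L\<^esub>}. c k)"

locale graded_lie_algebra = lie_algebra R L
  for R (structure) and L (structure) and G :: "int \<Rightarrow> 'c set" +
  assumes component_submodule: "submodule (G k) R L"
    and direct_sum: "x \<in> carrier L \<Longrightarrow> \<exists>!c. homogeneous_decomposition L G x c"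
    and bracket_degree:
      "\<lbrakk>x \<in> G i; y \<in> G j\<rbrakk> \<Longrightarrow> \<^bold>[x, y\<^bold>]\<^bsub>L\<^esub> \<in> G (i + j)"

definition three_graded :: "('a, 'b, 'm) lie_alg_scheme \<Rightarrow> (int \<Rightarrow> 'b set) \<Rightarrow> bool" where
  "three_graded L G \<longleftrightarrow> (\<forall>k. k \<notin> {-1, 0, 1} \<longrightarrow> G k = {\<zero>\<^bsub>L\<^esub>})"

definition component ::
  "('a, 'b, 'm) lie_alg_scheme \<Rightarrow> (int \<Rightarrow> 'b set) \<Rightarrow> int \<Rightarrow> 'b \<Rightarrow> 'b" where
  "component L G k x = (THE c. homogeneous_decomposition L G x c) k"

definition graded_ideal ::
  "('a, 'r) ring_scheme \<Rightarrow> ('a, 'b, 'm) lie_alg_scheme \<Rightarrow> (int \<Rightarrow> 'b set) \<Rightarrow> 'b set \<Rightarrow> bool" where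
  "graded_ideal R L G I \<longleftrightarrow>
     lie_ideal R L I \<and> (\<forall>x\<in>I. \<forall>k. component L G k x \<in> I)"

definition graded_essential_ideal ::
  "('a, 'r) ring_scheme \<Rightarrow> ('a, 'b, 'm) lie_alg_scheme \<Rightarrow> (int \<Rightarrow> 'b set) \<Rightarrow> 'b set \<Rightarrow> bool" where
  "graded_essential_ideal R L G I \<longleftrightarrow>
     graded_ideal R L G I \<and>
     (\<forall>J. graded_ideal R L G J \<and> J \<noteq> {\<zero>\<^bsub>L\<^esub>} \<longrightarrow> I \<inter> J \<noteq> {\<zero>\<^bsub>L\<^esub>})"

definition lie_isos ::
  "('a, 'r) ring_scheme \<Rightarrow> ('a, 'b, 'm) lie_alg_scheme \<Rightarrow> ('a, 'c, 'n) lie_alg_scheme \<Rightarrow> ('b \<Rightarrow> 'c) set" where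
  "lie_isos R L M = {f. bij_betw f (carrier L) (carrier M) \<and>
     (\<forall>x\<in>carrier L. \<forall>y\<in>carrier L. f (x \<oplus>\<^bsub>L\<^esub> y) = f x \<oplus>\<^bsub>M\<^esub> f y) \<and>
     (\<forall>a\<in>carrier R. \<forall>x\<in>carrier L. f (a \<odot>\<^bsub>L\<^esub> x) = a \<odot>\<^bsub>M\<^esub> f x) \<and>
     (\<forall>x\<in>carrier L. \<forall>y\<in>carrier L. f \<^bold>[x, y\<^bold>]\<^bsub>L\<^esub> = \<^bold>[f x, f y\<^bold>]\<^bsub>M\<^esub>)}"

definition graded_lie_isos ::
  "('a, 'r) ring_scheme \<Rightarrow> ('a, 'b, 'm) lie_alg_scheme \<Rightarrow> (int \<Rightarrow> 'b set)
    \<Rightarrow> ('a, 'c, 'n) lie_alg_scheme \<Rightarrow> (int \<Rightarrow> 'c set) \<Rightarrow> ('b \<Rightarrow> 'c) set" where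
  "graded_lie_isos R L G M H = {f \<in> lie_isos R L M. \<forall>k. f ` G k = H k}"


section \<open>Partial derivations\<close>

(* Maps on I are represented extensionally, i.e. with value undefined outside I. *)
definition derivations ::
  "('a, 'r) ring_scheme \<Rightarrow> ('a, 'b, 'm) lie_alg_scheme \<Rightarrow> 'b set \<Rightarrow> ('b \<Rightarrow> 'b) set" where
  "derivations R L I = {d \<in> I \<rightarrow>\<^sub>E carrier L.
     (\<forall>x\<in>I. \<forall>y\<in>I. d (x \<oplus>\<^bsub>L\<^esub> y) = d x \<oplus>\<^bsub>L\<^esub> d y) \<and>
     (\<forall>a\<in>carrier R. \<forall>x\<in>I. d (a \<odot>\<^bsub>L\<^esub> x) = a \<odot>\<^bsub>L\<^esub> d x) \<and>
     (\<forall>x\<in>I. \<forall>y\<in>I. d \<^bold>[x, y\<^bold>]\<^bsub>L\<^esub> = \<^bold>[d x, y\<^bold>]\<^bsub>L\<^esub> \<oplus>\<^bsub>L\<^esub> \<^bold>[x, d y\<^bold>]\<^bsub>L\<^esub>)}"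

definition derivations_of_degree ::
  "('a, 'r) ring_scheme \<Rightarrow> ('a, 'b, 'm) lie_alg_scheme \<Rightarrow> (int \<Rightarrow> 'b set) \<Rightarrow> int \<Rightarrow> 'b set
    \<Rightarrow> ('b \<Rightarrow> 'b) set" where
  "derivations_of_degree R L G k I =
     {d \<in> derivations R L I. \<forall>j. \<forall>x \<in> I \<inter> G j. d x \<in> G (j + k)}"

definition graded_derivations ::
  "('a, 'r) ring_scheme \<Rightarrow> ('a, 'b, 'm) lie_alg_scheme \<Rightarrow> (int \<Rightarrow> 'b set) \<Rightarrow> 'b set
    \<Rightarrow> ('b \<Rightarrow> 'b) set" where
  "graded_derivations R L G I =
     {d \<in> derivations R L I. \<exists>K e. finite K \<and>
        (\<forall>k\<in>K. e k \<in> derivations_of_degree R L G k I) \<and>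
        (\<forall>x\<in>I. d x = (\<Oplus>\<^bsub>L\<^esub>k\<in>K. e k x))}"


section \<open>Direct limits of partial derivations\<close>

(* E is the family of ideals over which the limit is taken, D I the set of derivations
   admitted on the ideal I. *)
definition partial_derivations ::
  "'b set set \<Rightarrow> ('b set \<Rightarrow> ('b \<Rightarrow> 'b) set) \<Rightarrow> ('b set \<times> ('b \<Rightarrow> 'b)) set" where
  "partial_derivations E D = (SIGMA I:E. D I)"

definition limit_rel ::
  "'b set set \<Rightarrow> ('b set \<Rightarrow> ('b \<Rightarrow> 'b) set)
    \<Rightarrow> (('b set \<times> ('b \<Rightarrow> 'b)) \<times> ('b set \<times> ('b \<Rightarrow> 'b))) set" where
  "limit_rel E D = {((I, d), (J, m)).
     (I, d) \<in> partial_derivations E D \<and> (J, m) \<in> partial_derivations E D \<and>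
     (\<exists>K\<in>E. K \<subseteq> I \<inter> J \<and> (\<forall>x\<in>K. d x = m x))}"

definition limit_class ::
  "'b set set \<Rightarrow> ('b set \<Rightarrow> ('b \<Rightarrow> 'b) set) \<Rightarrow> 'b set \<Rightarrow> ('b \<Rightarrow> 'b)
    \<Rightarrow> ('b set \<times> ('b \<Rightarrow> 'b)) set" where
  "limit_class E D I d = limit_rel E D `` {(I, d)}"

(* Operations on classes are unions over all representatives; when the operation respects
   limit_rel, all members of the union are the same class. *)
definition limit_algebra ::
  "('a, 'r) ring_scheme \<Rightarrow> ('a, 'b, 'm) lie_alg_scheme
    \<Rightarrow> 'b set set \<Rightarrow> ('b set \<Rightarrow> ('b \<Rightarrow> 'b) set) \<Rightarrow> ('a, ('b set \<times> ('b \<Rightarrow> 'b)) set) lie_alg" where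
  "limit_algebra R L E D =
    \<lparr>carrier = partial_derivations E D // limit_rel E D,
     mult = undefined,
     one = undefined,
     zero = limit_class E D (carrier L) (\<lambda>x\<in>carrier L. \<zero>\<^bsub>L\<^esub>),
     add = (\<lambda>X Y. \<Union>(I, d)\<in>X. \<Union>(J, m)\<in>Y.
       limit_class E D (I \<inter> J) (\<lambda>x\<in>I \<inter> J. d x \<oplus>\<^bsub>L\<^esub> m x)),
     smult = (\<lambda>a X. \<Union>(I, d)\<in>X. limit_class E D I (\<lambda>x\<in>I. a \<odot>\<^bsub>L\<^esub> d x)),
     bracket = (\<lambda>X Y. \<Union>(I, d)\<in>X. \<Union>(J, m)\<in>Y.
       limit_class E D (bracket_span R L (I \<inter> J) (I \<inter> J))
         (\<lambda>x\<in>bracket_span R L (I \<inter> J) (I \<inter> J). d (m x) \<ominus>\<^bsub>L\<^esub> m (d x)))\<rparr>"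

definition limit_embedding ::
  "('a, 'b, 'm) lie_alg_scheme \<Rightarrow> 'b set set \<Rightarrow> ('b set \<Rightarrow> ('b \<Rightarrow> 'b) set)
    \<Rightarrow> 'b \<Rightarrow> ('b set \<times> ('b \<Rightarrow> 'b)) set" where
  "limit_embedding L E D x = limit_class E D (carrier L) (\<lambda>y\<in>carrier L. \<^bold>[x, y\<^bold>]\<^bsub>L\<^esub>)"


section \<open>Maximal algebras of quotients\<close>

definition Q_m ::
  "('a, 'r) ring_scheme \<Rightarrow> ('a, 'b, 'm) lie_alg_scheme
    \<Rightarrow> ('a, ('b set \<times> ('b \<Rightarrow> 'b)) set) lie_alg" where
  "Q_m R L = limit_algebra R L {I. essential_ideal R L I} (derivations R L)"

definition Q_m_embedding ::
  "('a, 'r) ring_scheme \<Rightarrow> ('a, 'b, 'm) lie_alg_scheme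
    \<Rightarrow> 'b \<Rightarrow> ('b set \<times> ('b \<Rightarrow> 'b)) set" where
  "Q_m_embedding R L = limit_embedding L {I. essential_ideal R L I} (derivations R L)"

definition Q_gr_m ::
  "('a, 'r) ring_scheme \<Rightarrow> ('a, 'b, 'm) lie_alg_scheme \<Rightarrow> (int \<Rightarrow> 'b set)
    \<Rightarrow> ('a, ('b set \<times> ('b \<Rightarrow> 'b)) set) lie_alg" where
  "Q_gr_m R L G =
     limit_algebra R L {I. graded_essential_ideal R L G I} (graded_derivations R L G)"

definition Q_gr_m_embedding ::
  "('a, 'r) ring_scheme \<Rightarrow> ('a, 'b, 'm) lie_alg_scheme \<Rightarrow> (int \<Rightarrow> 'b set)
    \<Rightarrow> 'b \<Rightarrow> ('b set \<times> ('b \<Rightarrow> 'b)) set" where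
  "Q_gr_m_embedding R L G =
     limit_embedding L {I. graded_essential_ideal R L G I} (graded_derivations R L G)"

definition Q_gr_m_grading ::
  "('a, 'r) ring_scheme \<Rightarrow> ('a, 'b, 'm) lie_alg_scheme \<Rightarrow> (int \<Rightarrow> 'b set)
    \<Rightarrow> int \<Rightarrow> ('b set \<times> ('b \<Rightarrow> 'b)) set set" where
  "Q_gr_m_grading R L G k =
     {limit_class {I. graded_essential_ideal R L G I} (graded_derivations R L G) I d | I d.
        graded_essential_ideal R L G I \<and> d \<in> derivations_of_degree R L G k I}"

end

(* Since L is semiprime and 3-graded, every nonzero ideal contains a nonzero homogeneous element:
   an ideal K without one satisfies [x_1, y] = [x_-1, y] = 0 for all x, y in K, so it is abelian.
   Hence the graded core of an essential ideal is a graded essential ideal, and graded essential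
   ideals are essential and cofinal among the essential ones. Every derivation d on a graded ideal
   is the sum of its parts of degrees -2, ..., 2, so both limits run over the same derivations, and
   the isomorphism restricts a class to its representatives on graded essential ideals.

   Both claims of part (ii) reduce to one fact: a derivation q on an essential ideal with q^2 = 0 on
   a smaller one vanishes on a still smaller one if L is strongly nondegenerate without 2- and 3-torsion. This
   applies to a class X with [X, [X, Q]] = 0 and, by degree reasons, to a derivation of degree k
   with |k| >= 2. To prove the fact, note that T(x, y, z) = [[q x, y], q z] = q [x, [y, q z]] is
   totally symmetric. With c = [x, [x, q x]], so that q c = T(x, x, x), the relation [E, E] = 0 for
   E = [q x, x] yields T(c, x, y) = 0, and from this T(c, c, y) = 0. So w = q c satisfies
   [w, [w, y]] = 0, whence w = 0; linearizing, T = 0, and the same argument gives q x = 0. *)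
theory Submission
  imports Defs
begin

section \<open>Lie algebras and their ideals\<close>

text \<open>The obstacle that shapes the development is that a derivation on I takes values in L,
  not in I, so composites are not defined on I. The remedy throughout is that d maps [K, K] into K
  for every ideal K inside its domain, and that [K, K] stays essential when K is, by semiprimeness.
  Brackets of classes, the Jacobi identity and the condition q^2 = 0 therefore all live on iterated
  squares of the domain.

  Partial domains also obstruct the use of nondegeneracy: [w, [w, y]] = 0 is known only for y in a
  smaller ideal, whereas the assumption on L speaks of all y. An ideal must first inherit strong
  nondegeneracy, and this is where absence of 3-torsion first enters; it enters again when T(x, x,
  x) = 0 is linearized. Absence of 2-torsion enters with [q x, q y] = 0, since q^2 [x, y] is twice
  this bracket.

  The condition on X in Q reaches its representative q through the copy of L in Q: bracketing the
  class of q with the image of x gives the image of q x.\<close>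

locale lie = lie_algebra R L for R and L (structure)
begin

declare bracket_closed [simp, intro]

lemma bracket_zero_right [simp]:
  assumes "x \<in> carrier L" shows "\<^bold>[x, \<zero>\<^bold>] = \<zero>"
  using bracket_add_right [of x \<zero> \<zero>] assms by (simp add: M.add.r_cancel_one')

lemma bracket_zero_left [simp]:
  assumes "x \<in> carrier L" shows "\<^bold>[\<zero>, x\<^bold>] = \<zero>"
  using bracket_add_left [of \<zero> \<zero> x] assms by (simp add: M.add.r_cancel_one')

lemma bracket_minus_right:
  assumes "x \<in> carrier L" "y \<in> carrier L" shows "\<^bold>[x, \<ominus> y\<^bold>] = \<ominus> \<^bold>[x, y\<^bold>]"
  using bracket_add_right [of x "\<ominus> y" y] assms
    M.minus_equality [of "\<^bold>[x, \<ominus> y\<^bold>]" "\<^bold>[x, y\<^bold>]"]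
  by (simp add: M.l_neg)

lemma bracket_minus_left:
  assumes "x \<in> carrier L" "y \<in> carrier L" shows "\<^bold>[\<ominus> x, y\<^bold>] = \<ominus> \<^bold>[x, y\<^bold>]"
  using bracket_add_left [of "\<ominus> x" x y] assms
    M.minus_equality [of "\<^bold>[\<ominus> x, y\<^bold>]" "\<^bold>[x, y\<^bold>]"]
  by (simp add: M.l_neg)

lemma bracket_antisym:
  assumes "x \<in> carrier L" "y \<in> carrier L" shows "\<^bold>[x, y\<^bold>] = \<ominus> \<^bold>[y, x\<^bold>]"
proof -
  have "\<^bold>[x \<oplus> y, x \<oplus> y\<^bold>] = \<^bold>[x, y\<^bold>] \<oplus> \<^bold>[y, x\<^bold>]"
    using assms bracket_self [OF assms(1)] bracket_self [OF assms(2)]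
    by (simp add: bracket_add_left bracket_add_right M.a_comm)
  then have "\<^bold>[x, y\<^bold>] \<oplus> \<^bold>[y, x\<^bold>] = \<zero>"
    using assms bracket_self [of "x \<oplus> y"] by simp
  then show ?thesis
    using assms M.minus_equality [of "\<^bold>[x, y\<^bold>]" "\<^bold>[y, x\<^bold>]"] by simp
qed

lemma bracket_eq_zero_commute:
  assumes "x \<in> carrier L" "y \<in> carrier L" shows "\<^bold>[x, y\<^bold>] = \<zero> \<longleftrightarrow> \<^bold>[y, x\<^bold>] = \<zero>"
  using assms by (subst bracket_antisym) (auto simp: M.add.inv_eq_1_iff)

lemma leibniz:
  assumes "x \<in> carrier L" "y \<in> carrier L" "z \<in> carrier L"
  shows "\<^bold>[x, \<^bold>[y, z\<^bold>]\<^bold>] = \<^bold>[\<^bold>[x, y\<^bold>], z\<^bold>] \<oplus> \<^bold>[y, \<^bold>[x, z\<^bold>]\<^bold>]"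
proof -
  let ?a = "\<^bold>[x, \<^bold>[y, z\<^bold>]\<^bold>]" and ?b = "\<^bold>[y, \<^bold>[x, z\<^bold>]\<^bold>]" and ?c = "\<^bold>[\<^bold>[x, y\<^bold>], z\<^bold>]"
  have "\<^bold>[y, \<^bold>[z, x\<^bold>]\<^bold>] = \<ominus> ?b" "\<^bold>[z, \<^bold>[x, y\<^bold>]\<^bold>] = \<ominus> ?c"
    using assms by (simp_all add: bracket_antisym [of z] bracket_minus_right)
  then have "?a \<oplus> \<ominus> ?b \<oplus> \<ominus> ?c = \<zero>"
    using jacobi [OF assms] by simp
  then have "?a = ?b \<oplus> ?c"
    using assms M.minus_equality [of ?a "\<ominus> ?b \<oplus> \<ominus> ?c"]
    by (simp add: M.a_assoc M.minus_add)
  then show ?thesis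
    using assms by (simp add: M.a_comm)
qed

lemma leibniz_left:
  assumes "x \<in> carrier L" "y \<in> carrier L" "z \<in> carrier L"
  shows "\<^bold>[\<^bold>[x, y\<^bold>], z\<^bold>] = \<^bold>[\<^bold>[x, z\<^bold>], y\<^bold>] \<oplus> \<^bold>[x, \<^bold>[y, z\<^bold>]\<^bold>]"
proof -
  have "\<^bold>[x, \<^bold>[y, z\<^bold>]\<^bold>] \<oplus> \<^bold>[\<^bold>[x, z\<^bold>], y\<^bold>] = \<^bold>[\<^bold>[x, y\<^bold>], z\<^bold>] \<oplus> (\<^bold>[y, \<^bold>[x, z\<^bold>]\<^bold>] \<oplus> \<^bold>[\<^bold>[x, z\<^bold>], y\<^bold>])"
    using assms by (simp add: leibniz [OF assms] M.a_assoc)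
  also have "\<dots> = \<^bold>[\<^bold>[x, y\<^bold>], z\<^bold>]"
    using assms bracket_antisym [of "\<^bold>[x, z\<^bold>]" y] by (simp add: M.r_neg)
  finally show ?thesis
    using assms by (simp add: M.a_comm)
qed

lemma torsion_free_two:
  assumes "torsion_free 2 L" "x \<in> carrier L" "x \<oplus> x = \<zero>" shows "x = \<zero>"
proof -
  have "[(2::nat)] \<cdot>\<^bsub>L\<^esub> x = x \<oplus> x"
    using assms(2) by (simp add: numeral_2_eq_2)
  then show ?thesis
    using assms unfolding torsion_free_def by metis
qed

lemma torsion_free_three:
  assumes "torsion_free 3 L" "x \<in> carrier L" "x \<oplus> x \<oplus> x = \<zero>" shows "x = \<zero>"
proof -
  have "[(3::nat)] \<cdot>\<^bsub>L\<^esub> x = x \<oplus> x \<oplus> x"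
    using assms(2) by (simp add: numeral_3_eq_3)
  then show ?thesis
    using assms unfolding torsion_free_def by metis
qed

text \<open>Negation is the action of the scalar -1, so closure under it comes for free.\<close>

lemma submoduleI_smult:
  assumes "H \<subseteq> carrier L" "\<zero> \<in> H" "\<And>x y. \<lbrakk>x \<in> H; y \<in> H\<rbrakk> \<Longrightarrow> x \<oplus> y \<in> H"
    "\<And>a x. \<lbrakk>a \<in> carrier R; x \<in> H\<rbrakk> \<Longrightarrow> a \<odot> x \<in> H"
  shows "submodule H R L"
proof (rule submoduleI)
  show "\<ominus> x \<in> H" if "x \<in> H" for x
  proof -
    have "\<ominus> x = (\<ominus>\<^bsub>R\<^esub> \<one>\<^bsub>R\<^esub>) \<odot> x"
      using that assms(1) smult_l_minus [of "\<one>\<^bsub>R\<^esub>" x] by auto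
    then show ?thesis
      using that assms(4) by simp
  qed
qed (use assms in auto)

lemma lie_idealD:
  assumes "lie_ideal R L I"
  shows "I \<subseteq> carrier L" "\<zero> \<in> I" "\<And>x. x \<in> I \<Longrightarrow> x \<in> carrier L"
    "\<And>x y. \<lbrakk>x \<in> I; y \<in> I\<rbrakk> \<Longrightarrow> x \<oplus> y \<in> I" "\<And>x. x \<in> I \<Longrightarrow> \<ominus> x \<in> I"
    "\<And>a x. \<lbrakk>a \<in> carrier R; x \<in> I\<rbrakk> \<Longrightarrow> a \<odot> x \<in> I"
    "\<And>x y. \<lbrakk>x \<in> carrier L; y \<in> I\<rbrakk> \<Longrightarrow> \<^bold>[x, y\<^bold>] \<in> I"
    "\<And>x y. \<lbrakk>x \<in> I; y \<in> carrier L\<rbrakk> \<Longrightarrow> \<^bold>[x, y\<^bold>] \<in> I"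
proof -
  have sub: "submodule I R L" using assms by (simp add: lie_ideal_def)
  note E = submoduleE [OF sub]
  show s: "I \<subseteq> carrier L" and "\<And>x. x \<in> I \<Longrightarrow> x \<in> carrier L" 
    and neg: "\<And>x. x \<in> I \<Longrightarrow> \<ominus> x \<in> I"
    and "\<And>x y. \<lbrakk>x \<in> I; y \<in> I\<rbrakk> \<Longrightarrow> x \<oplus> y \<in> I"
    and "\<And>a x. \<lbrakk>a \<in> carrier R; x \<in> I\<rbrakk> \<Longrightarrow> a \<odot> x \<in> I"
    using E by auto
  show "\<zero> \<in> I"
    using subgroup.one_closed [OF submodule.axioms(1) [OF sub]] by simp
  show l: "\<And>x y. \<lbrakk>x \<in> carrier L; y \<in> I\<rbrakk> \<Longrightarrow> \<^bold>[x, y\<^bold>] \<in> I"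
    using assms by (simp add: lie_ideal_def)
  show "\<^bold>[x, y\<^bold>] \<in> I" if "x \<in> I" "y \<in> carrier L" for x y
    using l [of y x] neg that s by (subst bracket_antisym) auto
qed

lemma lie_idealI:
  assumes "I \<subseteq> carrier L" "\<zero> \<in> I" "\<And>x y. \<lbrakk>x \<in> I; y \<in> I\<rbrakk> \<Longrightarrow> x \<oplus> y \<in> I"
    "\<And>a x. \<lbrakk>a \<in> carrier R; x \<in> I\<rbrakk> \<Longrightarrow> a \<odot> x \<in> I"
    "\<And>x y. \<lbrakk>x \<in> carrier L; y \<in> I\<rbrakk> \<Longrightarrow> \<^bold>[x, y\<^bold>] \<in> I"
  shows "lie_ideal R L I"
  unfolding lie_ideal_def using assms
  by (auto intro!: submoduleI_smult)


section \<open>Derivations of square zero\<close>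

lemma derivationD:
  assumes "d \<in> derivations R L I"
  shows "\<And>x. x \<in> I \<Longrightarrow> d x \<in> carrier L"
    "\<And>x y. \<lbrakk>x \<in> I; y \<in> I\<rbrakk> \<Longrightarrow> d (x \<oplus> y) = d x \<oplus> d y"
    "\<And>a x. \<lbrakk>a \<in> carrier R; x \<in> I\<rbrakk> \<Longrightarrow> d (a \<odot> x) = a \<odot> d x"
    "\<And>x y. \<lbrakk>x \<in> I; y \<in> I\<rbrakk> \<Longrightarrow> d \<^bold>[x, y\<^bold>] = \<^bold>[d x, y\<^bold>] \<oplus> \<^bold>[x, d y\<^bold>]"
  using assms by (auto simp: derivations_def)

lemma derivation_zero:
  assumes "d \<in> derivations R L I" "\<zero> \<in> I" shows "d \<zero> = \<zero>"
proof -
  have "d \<zero> \<oplus> d \<zero> = d \<zero>"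
    using derivationD(2) [OF assms(1,2,2)] by simp
  then show ?thesis
    using derivationD(1) [OF assms] by simp
qed

lemma derivation_minus:
  assumes "d \<in> derivations R L I" "\<zero> \<in> I" "x \<in> I" "\<ominus> x \<in> I" "x \<in> carrier L" 
  shows "d (\<ominus> x) = \<ominus> d x"
proof -
  have "d (\<ominus> x) \<oplus> d x = \<zero>"
    using derivationD(2) [OF assms(1,4,3)] derivation_zero [OF assms(1,2)] assms(5)
    by (simp add: M.l_neg)
  then show ?thesis
    using derivationD(1) [OF assms(1)] assms(3,4) M.minus_equality [of "d (\<ominus> x)" "d x"] by simp
qed

text \<open>With V = ad v, the square of V kills I and V maps L into I, so V^3 = 0 on L. Each w =
  V^2 x turns out to satisfy [w, [w, L]] = 0, hence V^2 = 0 on all of L, and then v itself falls to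
  the assumption on L. The lemma serves wherever a double bracket is only known to vanish on an
  ideal.\<close>

lemma ideal_absolute_zero_divisor:
  assumes nondeg: "strongly_nondegenerate L"
    and tf3: "torsion_free 3 L"
    and I: "lie_ideal R L I" and v: "v \<in> I"
    and sq: "\<And>y. y \<in> I \<Longrightarrow> \<^bold>[v, \<^bold>[v, y\<^bold>]\<^bold>] = \<zero>"
  shows "v = \<zero>"
proof -
  note ID = lie_idealD [OF I]
  have vc [simp]: "v \<in> carrier L" using v ID by blast
  define V where "V x = \<^bold>[v, x\<^bold>]" for x
  have Vc [simp]: "V x \<in> carrier L" if "x \<in> carrier L" for x
    using that by (simp add: V_def)
  have VI [simp]: "V x \<in> I" if "x \<in> carrier L" for x
    using that v ID(8) by (simp add: V_def)
  have V_br: "V \<^bold>[x, y\<^bold>] = \<^bold>[V x, y\<^bold>] \<oplus> \<^bold>[x, V y\<^bold>]"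
    if "x \<in> carrier L" "y \<in> carrier L" for x y
    using that leibniz [of v x y] by (simp add: V_def)
  have V_add: "V (x \<oplus> y) = V x \<oplus> V y" if "x \<in> carrier L" "y \<in> carrier L" for x y
    using that by (simp add: V_def bracket_add_right)
  have VV: "V (V x) = \<zero>" if "x \<in> I" for x
    using sq that by (simp add: V_def)
  have VVV: "V (V (V x)) = \<zero>" if "x \<in> carrier L" for x
    using VV VI that by blast
  have V0 [simp]: "V \<zero> = \<zero>" by (simp add: V_def)
  have VV_br: "V (V \<^bold>[x, y\<^bold>]) = \<^bold>[V (V x), y\<^bold>] \<oplus> \<^bold>[V x, V y\<^bold>] \<oplus> (\<^bold>[V x, V y\<^bold>] \<oplus> \<^bold>[x, V (V y)\<^bold>])"
    if "x \<in> carrier L" "y \<in> carrier L" for x y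
    using that by (simp add: V_br V_add)
  \<comment> \<open>Expand \<open>V\<^sup>2[Vx, y] = 0 = V\<^sup>2[x, Vy]\<close>; the two relations force \<open>3[V\<^sup>2x, Vy] = 0\<close>.\<close>
  have key: "\<^bold>[V (V x), V y\<^bold>] = \<zero>" if x: "x \<in> carrier L" and y: "y \<in> carrier L" for x y
  proof -
    let ?p = "\<^bold>[V (V x), V y\<^bold>]" and ?q = "\<^bold>[V x, V (V y)\<^bold>]"
    have "\<zero> = V (V \<^bold>[V x, y\<^bold>])" using VV ID(8) x y VI by simp
    also have "\<dots> = ?p \<oplus> (?p \<oplus> ?q)" using x y by (simp add: VV_br VVV)
    finally have 1: "?p \<oplus> (?p \<oplus> ?q) = \<zero>" by simp
    have "\<zero> = V (V \<^bold>[x, V y\<^bold>])" using VV ID(7) x y VI by simp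
    also have "\<dots> = ?p \<oplus> ?q \<oplus> ?q" using x y by (simp add: VV_br VVV)
    finally have 2: "?p \<oplus> ?q \<oplus> ?q = \<zero>" by simp
    have "\<ominus> ?p = ?p \<oplus> ?q"
      using M.minus_equality [of "?p \<oplus> ?q" ?p] 1 x y by (simp add: M.a_comm)
    then have "\<ominus> ?p \<oplus> ?q = \<zero>"
      using 2 by simp
    then have "?q = ?p"
      using M.minus_equality [of ?q "\<ominus> ?p"] x y by (simp add: M.a_comm)
    with 2 show ?thesis using torsion_free_three [OF tf3, of ?p] x y by simp
  qed
  have "V (V x) = \<zero>" if x: "x \<in> carrier L" for x
  proof -
    let ?w = "V (V x)"
    have w [simp]: "?w \<in> carrier L" using x by simp
    have wI: "?w \<in> I" using x by simp
    have "\<^bold>[?w, \<^bold>[?w, y\<^bold>]\<^bold>] = \<zero>" if y: "y \<in> carrier L" for y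
    proof -
      \<comment> \<open>The element s lies in I and V s = 0 by \<open>key\<close>, so V^2 [s, y] = 0
        shrinks to [s, V^2 y] = 0. Now expand V^2 [x, y] and bracket it with w: \<open>key\<close>
        kills the left side and the middle terms, the relation for s kills the last term, and [w,
        [w, y]] is all that is left.\<close>
      define s where "s = \<^bold>[?w, x\<^bold>]"
      have s: "s \<in> I" using wI x ID(8) by (simp add: s_def)
      have sc [simp]: "s \<in> carrier L" using s ID by blast
      have Vs: "V s = \<zero>" using x key VVV by (simp add: s_def V_br)
      have "\<zero> = V (V \<^bold>[s, y\<^bold>])" using VV ID(8) s y by simp
      also have "\<dots> = \<^bold>[s, V (V y)\<^bold>]" using y by (simp add: VV_br Vs)
      finally have s0: "\<^bold>[s, V (V y)\<^bold>] = \<zero>" by simp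
      have b1: "\<^bold>[?w, \<^bold>[x, V (V y)\<^bold>]\<^bold>] = \<zero>"
        using leibniz [of ?w x "V (V y)"] key [of x "V y"] x y s0 by (simp add: s_def [symmetric])
      have b2: "\<^bold>[?w, \<^bold>[V x, V y\<^bold>]\<^bold>] = \<zero>"
        using leibniz [of ?w "V x" "V y"] key x y by simp
      have "\<zero> = \<^bold>[?w, V (V \<^bold>[x, y\<^bold>])\<^bold>]" using key x y by simp
      also have "\<dots> = \<^bold>[?w, \<^bold>[?w, y\<^bold>]\<^bold>]"
        using x y by (simp add: VV_br bracket_add_right b1 b2)
      finally show ?thesis by simp
    qed
    then show ?thesis
      using nondeg w unfolding strongly_nondegenerate_def by blast
  qed
  then show ?thesis
    using nondeg vc unfolding strongly_nondegenerate_def V_def by blast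
qed

text \<open>Two ideals are carried along because q need not preserve its domain: q J inside I gives
  meaning to q (q x), and q x in J allows the absolute zero divisor test to be run inside J for q x
  itself.\<close>

lemma square_zero_derivation:
  assumes nondeg: "strongly_nondegenerate L"
    and tf2: "torsion_free 2 L" and tf3: "torsion_free 3 L"
    and I: "lie_ideal R L I" and J: "lie_ideal R L J" and JI: "J \<subseteq> I"
    and q: "q \<in> derivations R L I"
    and qJ: "\<And>x. x \<in> J \<Longrightarrow> q x \<in> I"
    and qq: "\<And>x. x \<in> J \<Longrightarrow> q (q x) = \<zero>"
    and x: "x \<in> J" and qx: "q x \<in> J"
  shows "q x = \<zero>"
proof -
  note ID = lie_idealD [OF I] and JD = lie_idealD [OF J]
  note q_add = derivationD(2) [OF q] and q_br = derivationD(4) [OF q]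
  have JI': "x \<in> I" if "x \<in> J" for x
    using that JI by auto
  have q_closed: "q x \<in> carrier L" if "x \<in> J" for x
    using derivationD(1) [OF q] that JI' by simp
  have q_J: "q \<^bold>[x, y\<^bold>] = \<^bold>[q x, y\<^bold>] \<oplus> \<^bold>[x, q y\<^bold>]" if "x \<in> J" "y \<in> J" for x y
    using q_br that JI' by simp
  have q_left: "q \<^bold>[q x, y\<^bold>] = \<^bold>[q x, q y\<^bold>]" and q_right: "q \<^bold>[y, q x\<^bold>] = \<^bold>[q y, q x\<^bold>]"
    if "x \<in> J" "y \<in> J" for x y
    using q_br [of "q x" y] q_br [of y "q x"] that JI' qJ qq q_closed JD(3) by simp_all
  have q_add_J: "q (x \<oplus> y) = q x \<oplus> q y" if "x \<in> J" "y \<in> J" for x y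
    using q_add that JI' by simp
  note [simp] = JD(3,4,5,7,8) q_closed
  note bracket_closed [simp]
  \<comment> \<open>As q^2 vanishes on x, y and [x, y], the second-order Leibniz rule leaves only 2
    [q x, q y] = 0.\<close>
  have comm: "\<^bold>[q x, q y\<^bold>] = \<zero>" if "x \<in> J" "y \<in> J" for x y
  proof -
    have "\<zero> = q (q \<^bold>[x, y\<^bold>])" using that qq by simp
    also have "\<dots> = q (\<^bold>[q x, y\<^bold>] \<oplus> \<^bold>[x, q y\<^bold>])" using that by (simp add: q_J)
    also have "\<dots> = q \<^bold>[q x, y\<^bold>] \<oplus> q \<^bold>[x, q y\<^bold>]" using that by (simp add: q_add_J)
    also have "\<dots> = \<^bold>[q x, q y\<^bold>] \<oplus> \<^bold>[q x, q y\<^bold>]" using that by (simp add: q_left q_right)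
    finally show ?thesis by (rule torsion_free_two [OF tf2 _ sym, rotated]) (use that in simp)
  qed
  \<comment> \<open>The image of \<open>q\<close> is an abelian inner ideal; the associated Jordan triple product \<open>T\<close>,
    pulled back along \<open>q\<close>, turns out to be totally symmetric.\<close>
  define T where "T x y z = \<^bold>[\<^bold>[q x, y\<^bold>], q z\<^bold>]" for x y z
  have Tc [simp]: "T x y z \<in> carrier L" "T x y z \<in> J" if "x \<in> J" "y \<in> J" "z \<in> J" for x y z
    using that by (simp_all add: T_def)
  have T_alt: "T x y z = \<^bold>[q x, \<^bold>[y, q z\<^bold>]\<^bold>]" if "x \<in> J" "y \<in> J" "z \<in> J" for x y z
    using that leibniz [of "q x" y "q z"] comm by (simp add: T_def)
  \<comment> \<open>Since q kills [y, q z], only one Leibniz term survives. Values of T thus lie in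
    the image of q, which makes the element c below a preimage of T x x x.\<close>
  have T_q: "T x y z = q \<^bold>[x, \<^bold>[y, q z\<^bold>]\<^bold>]" if "x \<in> J" "y \<in> J" "z \<in> J" for x y z
  proof -
    have "q \<^bold>[y, q z\<^bold>] = \<zero>" using that comm by (simp add: q_right)
    then show ?thesis using that by (simp add: q_J T_alt)
  qed
  \<comment> \<open>The exchange of the first two arguments expresses that q [x, y] commutes with q
    z; the exchange of the outer two, proved next, expresses that ad (q x) and ad (q z) commute. The
    two transpositions generate all permutations.\<close>
  have T_12: "T x y z = T y x z" if "x \<in> J" "y \<in> J" "z \<in> J" for x y z
  proof -
    let ?z = "q z"
    have "q \<^bold>[x, y\<^bold>] = \<^bold>[q x, y\<^bold>] \<oplus> \<^bold>[x, q y\<^bold>]" using that by (simp add: q_J)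
    then have "\<^bold>[\<^bold>[q x, y\<^bold>] \<oplus> \<^bold>[x, q y\<^bold>], ?z\<^bold>] = \<zero>"
      using that comm [of "\<^bold>[x, y\<^bold>]" z] by simp
    also have "\<^bold>[\<^bold>[q x, y\<^bold>] \<oplus> \<^bold>[x, q y\<^bold>], ?z\<^bold>] = T x y z \<oplus> \<^bold>[\<^bold>[x, q y\<^bold>], ?z\<^bold>]"
      using that by (simp add: bracket_add_left T_def)
    also have "\<^bold>[\<^bold>[x, q y\<^bold>], ?z\<^bold>] = \<ominus> T y x z"
      using that bracket_antisym [of x "q y"] by (simp add: T_def bracket_minus_left)
    finally have "T x y z \<oplus> \<ominus> T y x z = \<zero>" .
    then show ?thesis
      using that M.minus_equality [of "T x y z" "\<ominus> T y x z"] by simp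
  qed
  have T_13: "T x y z = T z y x" if "x \<in> J" "y \<in> J" "z \<in> J" for x y z
  proof -
    have "T x y z = \<ominus> \<^bold>[q z, \<^bold>[q x, y\<^bold>]\<^bold>]"
      using that bracket_antisym [of "\<^bold>[q x, y\<^bold>]" "q z"] by (simp add: T_def)
    also have "\<^bold>[q z, \<^bold>[q x, y\<^bold>]\<^bold>] = \<^bold>[q x, \<^bold>[q z, y\<^bold>]\<^bold>]"
      using that leibniz [of "q z" "q x" y] comm by simp
    also have "\<ominus> \<dots> = T z y x"
      using that bracket_antisym [of "\<^bold>[q z, y\<^bold>]" "q x"] by (simp add: T_def)
    finally show ?thesis .
  qed
  \<comment> \<open>Only q x matters in an outer slot, and by symmetry the same holds in the middle.
    Below, this trades the element e for c, as both have the image w under q.\<close>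
  have T_cong: "T x y z = T x' y z" if "q x = q x'" for x x' y z
    using that by (simp add: T_def)
  have cube: "T x x x = \<zero>" if x: "x \<in> J" for x
  proof -
    define E where "E = \<^bold>[q x, x\<^bold>]"
    define c where "c = \<^bold>[x, \<^bold>[x, q x\<^bold>]\<^bold>]"
    define w where "w = q c"
    have [simp]: "E \<in> J" "c \<in> J" "w \<in> J" using x T_q [OF x x x] by (simp_all add: E_def c_def w_def flip: T_q)
    have w: "w = T x x x" using x by (simp add: T_q w_def c_def)
    have Eqx: "\<^bold>[E, q x\<^bold>] = w" using x by (simp add: w E_def T_def)
    have cx: "T c x y = \<zero>" if y: "y \<in> J" for y
    proof -
      define e where "e = \<^bold>[E, x\<^bold>]"
      have [simp]: "e \<in> J" using x by (simp add: e_def)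
      have "q E = \<zero>" using x comm by (simp add: E_def q_left)
      then have qe: "q e = w" using x by (simp add: e_def q_J Eqx)
      \<comment> \<open>Expanding \<open>[E, E] = 0\<close> by Leibniz gives two terms that agree by symmetry of \<open>T\<close>.\<close>
      have "\<zero> = \<^bold>[E, E\<^bold>]" by (simp add: bracket_self)
      also have "\<dots> = \<^bold>[E, \<^bold>[q x, x\<^bold>]\<^bold>]" by (simp only: E_def)
      also have "\<dots> = \<^bold>[w, x\<^bold>] \<oplus> \<^bold>[q x, e\<^bold>]"
        using x leibniz [of E "q x" x] by (simp add: Eqx e_def)
      finally have "\<^bold>[w, x\<^bold>] \<oplus> \<^bold>[q x, e\<^bold>] = \<zero>" by (rule sym)
      then have "\<zero> = \<^bold>[\<^bold>[w, x\<^bold>] \<oplus> \<^bold>[q x, e\<^bold>], q y\<^bold>]" using y by simp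
      also have "\<dots> = T c x y \<oplus> T x e y"
        using x y by (simp add: bracket_add_left T_def w_def)
      also have "T x e y = T c x y"
        using T_12 [of x e y] T_cong [of e c x y] qe x y by (simp add: w_def)
      finally show ?thesis by (rule torsion_free_two [OF tf2 _ sym, rotated]) (use x y in simp)
    qed
    have "\<^bold>[w, \<^bold>[w, y\<^bold>]\<^bold>] = \<zero>" if y: "y \<in> J" for y
    proof -
      \<comment> \<open>The aim is to show that [w, c] is a value of q, for then it commutes with q
        y and T c c y = 0. By \<open>cx\<close>, g commutes with all values of q on J. Moving w
        through the two brackets of c therefore leaves only [[g, x], q x] = [h, q x], and q h = 0
        turns this into q [h, x].\<close>
      define g where "g = \<^bold>[w, x\<^bold>]"
      define h where "h = \<^bold>[g, x\<^bold>]"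
      have [simp]: "g \<in> J" "h \<in> J" using x by (simp_all add: g_def h_def)
      have gq: "\<^bold>[g, q z\<^bold>] = \<zero>" if "z \<in> J" for z
        using cx [OF that] by (simp add: T_def g_def w_def)
      have "q w = \<zero>" using qq by (simp add: w_def)
      then have "q g = \<zero>" using x comm by (simp add: g_def q_left w_def)
      then have qh: "q h = \<zero>" using x gq by (simp add: h_def q_J)
      have wc: "\<^bold>[w, c\<^bold>] = \<^bold>[h, q x\<^bold>]"
      proof -
        have "\<^bold>[w, q x\<^bold>] = \<zero>" using comm x by (simp add: w_def)
        then have "\<^bold>[w, \<^bold>[x, q x\<^bold>]\<^bold>] = \<zero>"
          using leibniz [of w x "q x"] x gq by (simp add: g_def)
        then have "\<^bold>[w, c\<^bold>] = \<^bold>[g, \<^bold>[x, q x\<^bold>]\<^bold>]"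
          using leibniz [of w x "\<^bold>[x, q x\<^bold>]"] x by (simp add: c_def g_def)
        also have "\<dots> = \<^bold>[h, q x\<^bold>]"
          using leibniz [of g x "q x"] x gq by (simp add: h_def)
        finally show ?thesis .
      qed
      have "\<^bold>[h, q x\<^bold>] = q \<^bold>[h, x\<^bold>]" using x qh by (simp add: q_J)
      then have "T c c y = \<zero>"
        using wc comm [of "\<^bold>[h, x\<^bold>]" y] x y by (simp add: T_def flip: w_def)
      \<comment> \<open>Symmetry moves the second c to the outer slot, where the product is the
        double bracket [[w, y], w].\<close>
      then have "T c y c = \<zero>"
        using T_13 [of c c y] T_12 [of y c c] y by simp
      then have "\<^bold>[\<^bold>[w, y\<^bold>], w\<^bold>] = \<zero>" by (simp add: T_def w_def)
      then show ?thesis using bracket_eq_zero_commute y by simp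
    qed
    then have "w = \<zero>"
      using ideal_absolute_zero_divisor [OF nondeg tf3 J, of w] by simp
    then show ?thesis using w by simp
  qed
  have T_eq_zero: "T x x y = \<zero>" if x: "x \<in> J" and y: "y \<in> J" for x y
  proof -
    \<comment> \<open>Expanding the cube of x + z by symmetry yields three copies of T x x z + T x z
      z. Comparing z = y with z = - y afterwards separates the two terms, which have different
      parity in z, at the cost of a factor 2.\<close>
    have polar: "T x x z \<oplus> T x z z = \<zero>" if z: "z \<in> J" for z
    proof -
      let ?A = "T x x z" and ?B = "T x z z" and ?s = "x \<oplus> z"
      have perm: "T x z x = ?A" "T z x x = ?A" "T z x z = ?B" "T z z x = ?B"
        using x z by (metis T_12 T_13)+
      have "\<zero> = T ?s ?s ?s" using cube x z by simp
      also have "\<dots> = T x x x \<oplus> ?A \<oplus> (?A \<oplus> ?B) \<oplus> (?A \<oplus> ?B \<oplus> (?B \<oplus> T z z z))"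
        using x z perm
        by (simp add: T_def q_add_J bracket_add_left bracket_add_right M.a_assoc)
      also have "\<dots> = (?A \<oplus> ?B) \<oplus> (?A \<oplus> ?B) \<oplus> (?A \<oplus> ?B)"
        using x z cube by (simp add: M.a_ac)
      finally show ?thesis by (rule torsion_free_three [OF tf3 _ sym, rotated]) (use x z in simp)
    qed
    have q_minus: "q (\<ominus> y) = \<ominus> q y"
      using derivation_minus [OF q ID(2), of y] y JI' by simp
    have "T x x (\<ominus> y) = \<ominus> T x x y" "T x (\<ominus> y) (\<ominus> y) = T x y y"
      using x y by (simp_all add: T_def q_minus bracket_minus_left bracket_minus_right)
    then have "\<ominus> T x x y \<oplus> T x y y = \<zero>"
      using polar [of "\<ominus> y"] y by simp
    moreover have "T x y y = \<ominus> T x x y"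
      using polar [OF y] x y M.minus_equality [of "T x y y" "T x x y"] by (simp add: M.a_comm)
    ultimately have "\<ominus> (T x x y \<oplus> T x x y) = \<zero>"
      using x y by (simp add: M.minus_add)
    then have "T x x y \<oplus> T x x y = \<zero>"
      using x y by (simp add: M.add.inv_eq_1_iff)
    then show ?thesis using torsion_free_two [OF tf2, of "T x x y"] x y by simp
  qed
  have "\<^bold>[q x, \<^bold>[q x, y\<^bold>]\<^bold>] = \<zero>" if y: "y \<in> J" for y
  proof -
    have "T x y x = \<zero>"
      using T_eq_zero [OF x y] T_13 [of x x y] T_12 [of y x x] x y by simp
    then show ?thesis
      using bracket_eq_zero_commute [of "q x" "\<^bold>[q x, y\<^bold>]"] x y by (simp add: T_def)
  qed
  then show ?thesis
    using ideal_absolute_zero_divisor [OF nondeg tf3 J qx] by blast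
qed

end


text \<open>The letters a to f stand for the composites of three maps in the orders d m n, d n m, m
  n d, n m d, m d n, n d m. Each occurs twice with opposite signs, which is the Jacobi identity for
  commutators.\<close>

lemma (in abelian_group) commutator_jacobi:
  assumes "a \<in> carrier G" "b \<in> carrier G" "c \<in> carrier G" "d \<in> carrier G" "e \<in> carrier G" "f \<in> carrier G"
  shows "((a \<ominus> b) \<ominus> (c \<ominus> d)) \<oplus> ((c \<ominus> e) \<ominus> (f \<ominus> b)) \<oplus> ((f \<ominus> d) \<ominus> (a \<ominus> e)) = \<zero>"
proof -
  let ?s = "a \<oplus> b \<oplus> c \<oplus> d \<oplus> e \<oplus> f"
  have "((a \<ominus> b) \<ominus> (c \<ominus> d)) \<oplus> ((c \<ominus> e) \<ominus> (f \<ominus> b)) \<oplus> ((f \<ominus> d) \<ominus> (a \<ominus> e)) = ?s \<oplus> \<ominus> ?s"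
    using assms by (simp add: minus_eq minus_add a_ac)
  then show ?thesis
    using assms by (simp add: r_neg)
qed

lemma (in abelian_group) add_diff_add:
  assumes "a \<in> carrier G" "b \<in> carrier G" "c \<in> carrier G" "d \<in> carrier G"
  shows "(a \<oplus> b) \<ominus> (c \<oplus> d) = (a \<ominus> c) \<oplus> (b \<ominus> d)"
  using assms by (simp add: minus_eq minus_add a_ac)

section \<open>Products of ideals and operations on partial derivations\<close>

context lie begin

lemma derivation_diff:
  assumes "d \<in> derivations R L I" "lie_ideal R L I" "x \<in> I" "y \<in> I"
  shows "d (x \<ominus> y) = d x \<ominus> d y"
  using assms derivationD(2) [OF assms(1), of x "\<ominus> y"] lie_idealD [OF assms(2)]
    derivation_minus [OF assms(1), of y]
  by (simp add: M.minus_eq)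

lemma lie_ideal_submodule: "lie_ideal R L I \<Longrightarrow> submodule I R L"
  by (simp add: lie_ideal_def)

lemma submodule_diff:
  assumes "submodule H R L" "x \<in> H" "y \<in> H" shows "x \<ominus> y \<in> H"
  using submoduleE [OF assms(1)] assms(2,3) by (simp add: a_minus_def)

lemma lie_ideal_carrier: "lie_ideal R L (carrier L)"
  by (simp add: lie_ideal_def carrier_is_submodule)

lemma lie_ideal_zero: "lie_ideal R L {\<zero>}"
  by (rule lie_idealI) auto

lemma lie_ideal_inter:
  assumes "lie_ideal R L I" "lie_ideal R L J" shows "lie_ideal R L (I \<inter> J)"
  by (rule lie_idealI) (use lie_idealD [OF assms(1)] lie_idealD [OF assms(2)] in auto)

lemma bracket_span_bracket: "x \<in> I \<Longrightarrow> y \<in> J \<Longrightarrow> \<^bold>[x, y\<^bold>] \<in> bracket_span R L I J"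
  by (auto simp: bracket_span_def)

lemma bracket_span_least:
  assumes "submodule N R L" "\<And>x y. x \<in> I \<Longrightarrow> y \<in> J \<Longrightarrow> \<^bold>[x, y\<^bold>] \<in> N"
  shows "bracket_span R L I J \<subseteq> N"
  using assms by (auto simp: bracket_span_def)

lemma submodule_bracket_span:
  assumes "I \<subseteq> carrier L" "J \<subseteq> carrier L"
  shows "submodule (bracket_span R L I J) R L"
proof (rule submoduleI_smult)
  show "bracket_span R L I J \<subseteq> carrier L"
    using assms by (intro bracket_span_least carrier_is_submodule) auto
  show "\<zero> \<in> bracket_span R L I J"
    using subgroup.one_closed [OF submodule.axioms(1)] by (fastforce simp: bracket_span_def)
  show "x \<oplus> y \<in> bracket_span R L I J"
    if "x \<in> bracket_span R L I J" "y \<in> bracket_span R L I J" for x y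
    using that submoduleE(5) unfolding bracket_span_def by blast
  show "a \<odot> x \<in> bracket_span R L I J"
    if "a \<in> carrier R" "x \<in> bracket_span R L I J" for a x
    using that submoduleE(4) unfolding bracket_span_def by blast
qed

lemma lie_ideal_bracket_span:
  assumes I: "lie_ideal R L I" and J: "lie_ideal R L J"
  shows "lie_ideal R L (bracket_span R L I J)"
  unfolding lie_ideal_def
proof (intro conjI ballI)
  let ?S = "bracket_span R L I J"
  note ID = lie_idealD [OF I] and JD = lie_idealD [OF J]
  show S: "submodule ?S R L"
    using ID JD by (intro submodule_bracket_span) auto
  note SE = submoduleE [OF S]
  fix x y assume x: "x \<in> carrier L" and y: "y \<in> ?S"
  \<comment> \<open>Induction over the span: the elements whose bracket with x stays in ?S form a
    submodule, so only the generators need to be tested. The same device recurs for other properties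
    of spans.\<close>
  have "?S \<subseteq> {y \<in> ?S. \<^bold>[x, y\<^bold>] \<in> ?S}"
  proof (rule bracket_span_least)
    show "submodule {y \<in> ?S. \<^bold>[x, y\<^bold>] \<in> ?S} R L"
    proof (rule submoduleI_smult)
      show "\<zero> \<in> {y \<in> ?S. \<^bold>[x, y\<^bold>] \<in> ?S}"
        using subgroup.one_closed [OF submodule.axioms(1) [OF S]] x by simp
    qed (use SE x subsetD [OF SE(1)] in \<open>auto simp: bracket_add_right bracket_smult_right\<close>)
    show "\<^bold>[a, b\<^bold>] \<in> {y \<in> ?S. \<^bold>[x, y\<^bold>] \<in> ?S}" if "a \<in> I" "b \<in> J" for a b
    proof -
      have "\<^bold>[x, \<^bold>[a, b\<^bold>]\<^bold>] = \<^bold>[\<^bold>[x, a\<^bold>], b\<^bold>] \<oplus> \<^bold>[a, \<^bold>[x, b\<^bold>]\<^bold>]"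
        using that ID JD x by (intro leibniz) auto
      then show ?thesis
        using that ID(7) JD(7) x SE(5) by (simp add: bracket_span_bracket)
    qed
  qed
  then show "\<^bold>[x, y\<^bold>] \<in> ?S" using y by blast
qed

lemma bracket_span_subset:
  assumes "lie_ideal R L I" shows "bracket_span R L I I \<subseteq> I"
  using assms lie_idealD [OF assms] by (intro bracket_span_least lie_ideal_submodule) auto

lemma bracket_span_mono:
  assumes "I \<subseteq> I'" "J \<subseteq> J'" shows "bracket_span R L I J \<subseteq> bracket_span R L I' J'"
  unfolding bracket_span_def by (intro Inter_anti_mono) (use assms in blast)

text \<open>Both Leibniz terms of d [x, y] have a factor in the ideal K, although d itself maps K
  only into L. This is what allows partial derivations to be composed.\<close>

lemma derivation_bracket_span:
  assumes d: "d \<in> derivations R L I" and K: "lie_ideal R L K" and KI: "K \<subseteq> I"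
    and x: "x \<in> bracket_span R L K K"
  shows "d x \<in> K"
proof -
  note KD = lie_idealD [OF K] and dD = derivationD [OF d]
  have [simp]: "x \<in> I" if "x \<in> K" for x using that KI by auto
  have "bracket_span R L K K \<subseteq> {x \<in> K. d x \<in> K}"
  proof (rule bracket_span_least)
    show "submodule {x \<in> K. d x \<in> K} R L"
      by (rule submoduleI_smult) (use KD derivation_zero [OF d] dD in auto)
    show "\<^bold>[x, y\<^bold>] \<in> {x \<in> K. d x \<in> K}" if "x \<in> K" "y \<in> K" for x y
      using that KD dD by simp
  qed
  then show ?thesis using x by blast
qed

lemma derivation_restrict:
  assumes d: "d \<in> derivations R L I" and J: "lie_ideal R L J" and JI: "J \<subseteq> I"
  shows "restrict d J \<in> derivations R L J"
proof -
  have "x \<in> I" if "x \<in> J" for x using that JI by auto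
  then show ?thesis
    using derivationD [OF d] lie_idealD [OF J] by (auto simp: derivations_def)
qed

lemma derivation_add:
  assumes d: "d \<in> derivations R L I" and m: "m \<in> derivations R L I" and I: "lie_ideal R L I"
  shows "(\<lambda>x\<in>I. d x \<oplus> m x) \<in> derivations R L I"
proof -
  note [simp] = derivationD [OF d] derivationD [OF m] lie_idealD(3-8) [OF I]
  show ?thesis
    by (auto simp: derivations_def M.a_ac smult_r_distr bracket_add_left bracket_add_right)
qed

lemma derivation_smult:
  assumes d: "d \<in> derivations R L I" and a: "a \<in> carrier R" and I: "lie_ideal R L I"
  shows "(\<lambda>x\<in>I. a \<odot> d x) \<in> derivations R L I"
proof -
  note [simp] = derivationD [OF d] lie_idealD(3-8) [OF I] a
  have "a \<odot> (b \<odot> d x) = b \<odot> (a \<odot> d x)" if "b \<in> carrier R" "x \<in> I" for b x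
    using that by (simp flip: smult_assoc1 add: R.m_comm)
  then show ?thesis
    by (auto simp: derivations_def smult_r_distr bracket_smult_left bracket_smult_right)
qed

text \<open>In the Leibniz expansions of the two composites the mixed terms [d x, m y] and
  [m x, d y] coincide and cancel. The ideal J is a place where both maps land in I, so that the
  composites are defined.\<close>

lemma derivation_commutator:
  assumes d: "d \<in> derivations R L I" and m: "m \<in> derivations R L I" and I: "lie_ideal R L I"
    and J: "lie_ideal R L J" and JI: "J \<subseteq> I" and dJ: "\<And>x. x \<in> J \<Longrightarrow> d x \<in> I" and mJ: "\<And>x. x \<in> J \<Longrightarrow> m x \<in> I"
  shows "(\<lambda>x\<in>J. d (m x) \<ominus> m (d x)) \<in> derivations R L J"
proof -
  note dD = derivationD [OF d] and mD = derivationD [OF m]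
  note ID = lie_idealD [OF I] and JD = lie_idealD [OF J]
  have JI' [simp]: "x \<in> I" if "x \<in> J" for x using that JI by auto
  have [simp]: "d x \<in> carrier L" "m x \<in> carrier L" if "x \<in> I" for x
    using that dD mD by auto
  have [simp]: "x \<in> carrier L" if "x \<in> I" for x using that ID by auto
  have add: "d (m (x \<oplus> y)) \<ominus> m (d (x \<oplus> y)) = (d (m x) \<ominus> m (d x)) \<oplus> (d (m y) \<ominus> m (d y))"
    if "x \<in> J" "y \<in> J" for x y
    using that dJ mJ by (simp add: dD(2) mD(2) M.add_diff_add)
  have smult: "d (m (a \<odot> x)) \<ominus> m (d (a \<odot> x)) = a \<odot> (d (m x) \<ominus> m (d x))"
    if "a \<in> carrier R" "x \<in> J" for a x
    using that dJ mJ by (simp add: dD(3) mD(3) M.minus_eq smult_r_distr smult_r_minus)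
  have br: "d (m \<^bold>[x, y\<^bold>]) \<ominus> m (d \<^bold>[x, y\<^bold>]) =
      \<^bold>[d (m x) \<ominus> m (d x), y\<^bold>] \<oplus> \<^bold>[x, d (m y) \<ominus> m (d y)\<^bold>]"
    if x: "x \<in> J" and y: "y \<in> J" for x y
  proof -
    have [simp]: "d x \<in> I" "d y \<in> I" "m x \<in> I" "m y \<in> I" "x \<in> I" "y \<in> I"
      using x y dJ mJ by auto
    have 1: "d (m \<^bold>[x, y\<^bold>]) = (\<^bold>[d (m x), y\<^bold>] \<oplus> \<^bold>[m x, d y\<^bold>]) \<oplus> (\<^bold>[d x, m y\<^bold>] \<oplus> \<^bold>[x, d (m y)\<^bold>])"
      using ID(7,8) by (simp add: dD(2,4) mD(4))
    have 2: "m (d \<^bold>[x, y\<^bold>]) = (\<^bold>[m (d x), y\<^bold>] \<oplus> \<^bold>[d x, m y\<^bold>]) \<oplus> (\<^bold>[m x, d y\<^bold>] \<oplus> \<^bold>[x, m (d y)\<^bold>])"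
      using ID(7,8) by (simp add: mD(2,4) dD(4))
    have alg: "((a \<oplus> b) \<oplus> (c \<oplus> e)) \<ominus> ((a' \<oplus> c) \<oplus> (b \<oplus> e')) = (a \<ominus> a') \<oplus> (e \<ominus> e')"
      if "a \<in> carrier L" "b \<in> carrier L" "c \<in> carrier L" "e \<in> carrier L" "a' \<in> carrier L" "e' \<in> carrier L"
      for a b c e a' e'
    proof -
      have "((a \<oplus> b) \<oplus> (c \<oplus> e)) \<ominus> ((a' \<oplus> c) \<oplus> (b \<oplus> e')) =
          (a \<ominus> a') \<oplus> (e \<ominus> e') \<oplus> ((b \<oplus> c) \<oplus> \<ominus> (b \<oplus> c))"
        using that by (simp add: M.minus_eq M.minus_add M.a_ac)
      then show ?thesis using that by (simp add: M.r_neg)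
    qed
    have "d (m \<^bold>[x, y\<^bold>]) \<ominus> m (d \<^bold>[x, y\<^bold>]) =
        (\<^bold>[d (m x), y\<^bold>] \<ominus> \<^bold>[m (d x), y\<^bold>]) \<oplus> (\<^bold>[x, d (m y)\<^bold>] \<ominus> \<^bold>[x, m (d y)\<^bold>])"
      unfolding 1 2 by (rule alg) auto
    then show ?thesis
      by (simp add: M.minus_eq bracket_add_left bracket_add_right bracket_minus_left bracket_minus_right)
  qed
  show ?thesis
    unfolding derivations_def using add smult br JD(4,6,7,8) dJ mJ by auto
qed

lemma derivation_ad:
  assumes x: "x \<in> carrier L"
  shows "(\<lambda>y\<in>carrier L. \<^bold>[x, y\<^bold>]) \<in> derivations R L (carrier L)"
  using x leibniz [OF x]
  by (auto simp: derivations_def bracket_add_right bracket_smult_right)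

lemma derivation_const_zero:
  assumes "lie_ideal R L I" shows "(\<lambda>y\<in>I. \<zero>) \<in> derivations R L I"
  using lie_idealD [OF assms] by (auto simp: derivations_def)

end


section \<open>The limit algebra of a filter of ideals\<close>

text \<open>Both limits are instances, over all essential ideals and over the graded essential ones,
  so the algebra structure is built only once. Intersections supply common domains for sums, spans
  supply domains for commutators.\<close>

locale lie_ideal_filter = lie +
  fixes E :: "'c set set"
  assumes ideal: "I \<in> E \<Longrightarrow> lie_ideal R L I"
    and carrier_mem: "carrier L \<in> E"
    and inter_mem: "\<lbrakk>I \<in> E; J \<in> E\<rbrakk> \<Longrightarrow> I \<inter> J \<in> E"
    and span_mem: "I \<in> E \<Longrightarrow> bracket_span R L I I \<in> E"
begin

abbreviation Der :: "'c set \<Rightarrow> ('c \<Rightarrow> 'c) set" where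
  "Der \<equiv> derivations R L"

abbreviation cls :: "'c set \<Rightarrow> ('c \<Rightarrow> 'c) \<Rightarrow> ('c set \<times> ('c \<Rightarrow> 'c)) set" where
  "cls \<equiv> limit_class E Der"

definition Q where "Q = limit_algebra R L E Der"

lemma limit_rel_iff:
  "((I, d), (J, m)) \<in> limit_rel E Der \<longleftrightarrow>
    I \<in> E \<and> J \<in> E \<and> d \<in> Der I \<and> m \<in> Der J \<and> (\<exists>K\<in>E. K \<subseteq> I \<inter> J \<and> (\<forall>x\<in>K. d x = m x))"
  by (auto simp: limit_rel_def partial_derivations_def)

lemma equiv_limit_rel: "equiv (partial_derivations E Der) (limit_rel E Der)"
proof (rule equivI)
  show "limit_rel E Der \<subseteq> partial_derivations E Der \<times> partial_derivations E Der"
    by (auto simp: limit_rel_def)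
  show "refl_on (partial_derivations E Der) (limit_rel E Der)"
    by (rule refl_onI) (auto simp: limit_rel_iff partial_derivations_def)
  show "sym (limit_rel E Der)"
    by (rule symI) (auto simp: limit_rel_iff, metis Int_commute)
  show "trans (limit_rel E Der)"
  proof (rule transI, clarify)
    fix I d J m K n
    assume "((I, d), (J, m)) \<in> limit_rel E Der" "((J, m), (K, n)) \<in> limit_rel E Der"
    then obtain A B where "A \<in> E" "A \<subseteq> I \<inter> J" "\<forall>x\<in>A. d x = m x"
      and "B \<in> E" "B \<subseteq> J \<inter> K" "\<forall>x\<in>B. m x = n x"
      and "I \<in> E" "K \<in> E" "d \<in> Der I" "n \<in> Der K"
      unfolding limit_rel_iff by blast
    then show "((I, d), (K, n)) \<in> limit_rel E Der"
      unfolding limit_rel_iff using inter_mem [of A B] by (intro conjI bexI [of _ "A \<inter> B"]) auto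
  qed
qed

lemma mem_cls_iff:
  assumes "I \<in> E" "d \<in> Der I"
  shows "(J, m) \<in> cls I d \<longleftrightarrow>
    J \<in> E \<and> m \<in> Der J \<and> (\<exists>K\<in>E. K \<subseteq> I \<inter> J \<and> (\<forall>x\<in>K. d x = m x))"
  using assms by (auto simp: limit_class_def limit_rel_iff)

lemma cls_self: "I \<in> E \<Longrightarrow> d \<in> Der I \<Longrightarrow> (I, d) \<in> cls I d"
  by (auto simp: mem_cls_iff)

lemma cls_eq_iff:
  assumes "I \<in> E" "d \<in> Der I" "J \<in> E" "m \<in> Der J"
  shows "cls I d = cls J m \<longleftrightarrow> (\<exists>K\<in>E. K \<subseteq> I \<inter> J \<and> (\<forall>x\<in>K. d x = m x))"
  using eq_equiv_class_iff [OF equiv_limit_rel, of "(I, d)" "(J, m)"] assms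
  by (simp add: limit_class_def partial_derivations_def limit_rel_iff)

lemma cls_restrict:
  assumes "I \<in> E" "d \<in> Der I" "J \<in> E" "J \<subseteq> I"
  shows "cls I d = cls J (restrict d J)"
  using assms derivation_restrict [OF assms(2) ideal [OF assms(3)]]
  by (subst cls_eq_iff) auto

lemma carrier_Q: "carrier Q = {cls I d | I d. I \<in> E \<and> d \<in> Der I}"
  by (auto simp: Q_def limit_algebra_def quotient_def limit_class_def partial_derivations_def)

lemma cls_closed: "I \<in> E \<Longrightarrow> d \<in> Der I \<Longrightarrow> cls I d \<in> carrier Q"
  by (auto simp: carrier_Q)

lemma carrier_QE:
  assumes "X \<in> carrier Q"
  obtains I d where "I \<in> E" "d \<in> Der I" "X = cls I d"
  using assms by (auto simp: carrier_Q)

text \<open>With representatives on one common ideal, the algebra laws of the limit become pointwise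
  identities between maps.\<close>

lemma carrier_Q2E:
  assumes "X \<in> carrier Q" "Y \<in> carrier Q"
  obtains I d m where "I \<in> E" "d \<in> Der I" "m \<in> Der I" "X = cls I d" "Y = cls I m"
proof -
  obtain I d J m where *: "I \<in> E" "d \<in> Der I" "X = cls I d" "J \<in> E" "m \<in> Der J" "Y = cls J m"
    using assms by (auto simp: carrier_Q)
  note K = inter_mem [OF *(1,4)]
  show ?thesis
  proof (rule that [OF K])
    show "restrict d (I \<inter> J) \<in> Der (I \<inter> J)" "restrict m (I \<inter> J) \<in> Der (I \<inter> J)"
      using * ideal [OF K] derivation_restrict by auto
    show "X = cls (I \<inter> J) (restrict d (I \<inter> J))" "Y = cls (I \<inter> J) (restrict m (I \<inter> J))"
      by (rule trans [OF *(3) cls_restrict [OF *(1,2) K Int_lower1]]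
        trans [OF *(6) cls_restrict [OF *(4,5) K Int_lower2]])+
  qed
qed

lemma carrier_Q3E:
  assumes "X \<in> carrier Q" "Y \<in> carrier Q" "Z \<in> carrier Q"
  obtains I d m n where "I \<in> E" "d \<in> Der I" "m \<in> Der I" "n \<in> Der I"
    "X = cls I d" "Y = cls I m" "Z = cls I n"
proof -
  obtain I d m where *: "I \<in> E" "d \<in> Der I" "m \<in> Der I" "X = cls I d" "Y = cls I m"
    using assms(1,2) by (rule carrier_Q2E)
  obtain J n where **: "J \<in> E" "n \<in> Der J" "Z = cls J n"
    using assms(3) by (rule carrier_QE)
  note K = inter_mem [OF *(1) **(1)]
  show ?thesis
  proof (rule that [OF K])
    show "restrict d (I \<inter> J) \<in> Der (I \<inter> J)" "restrict m (I \<inter> J) \<in> Der (I \<inter> J)"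
      "restrict n (I \<inter> J) \<in> Der (I \<inter> J)"
      using * ** ideal [OF K] derivation_restrict by auto
    show "X = cls (I \<inter> J) (restrict d (I \<inter> J))" "Y = cls (I \<inter> J) (restrict m (I \<inter> J))"
      "Z = cls (I \<inter> J) (restrict n (I \<inter> J))"
      by (rule trans [OF *(4) cls_restrict [OF *(1,2) K Int_lower1]]
        trans [OF *(5) cls_restrict [OF *(1,3) K Int_lower1]]
        trans [OF **(3) cls_restrict [OF **(1,2) K Int_lower2]])+
  qed
qed

text \<open>Operations on classes are unions over representatives, so computing one amounts to
  independence of the representatives together with a member that makes the union nonempty.\<close>

lemma UN_const_on: "\<lbrakk>p \<in> X; \<And>x. x \<in> X \<Longrightarrow> f x = c\<rbrakk> \<Longrightarrow> \<Union> (f ` X) = c"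
  by auto

lemma zero_Q: "\<zero>\<^bsub>Q\<^esub> = cls (carrier L) (\<lambda>x\<in>carrier L. \<zero>)"
  by (simp add: Q_def limit_algebra_def)

lemma zero_Q_on: 
  assumes "I \<in> E" shows "\<zero>\<^bsub>Q\<^esub> = cls I (\<lambda>x\<in>I. \<zero>)"
proof -
  have "I \<subseteq> carrier L" using lie_idealD(1) ideal assms by auto
  then show ?thesis
    unfolding zero_Q using assms carrier_mem ideal derivation_const_zero
    by (subst cls_eq_iff) auto
qed

lemma add_cls:
  assumes I: "I \<in> E" and d: "d \<in> Der I" and J: "J \<in> E" and m: "m \<in> Der J"
  shows "cls I d \<oplus>\<^bsub>Q\<^esub> cls J m = cls (I \<inter> J) (\<lambda>x\<in>I \<inter> J. d x \<oplus> m x)"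
proof -
  have der: "(\<lambda>x\<in>I \<inter> J. d x \<oplus> m x) \<in> Der (I \<inter> J)"
    if "I \<in> E" "d \<in> Der I" "J \<in> E" "m \<in> Der J" for I d J m
  proof -
    have "(\<lambda>x\<in>I \<inter> J. restrict d (I \<inter> J) x \<oplus> restrict m (I \<inter> J) x) \<in> Der (I \<inter> J)"
      using that inter_mem ideal by (intro derivation_add derivation_restrict) auto
    then show ?thesis by (simp cong: restrict_cong)
  qed
  have *: "cls (I' \<inter> J') (\<lambda>x\<in>I' \<inter> J'. d' x \<oplus> m' x) = cls (I \<inter> J) (\<lambda>x\<in>I \<inter> J. d x \<oplus> m x)"
    if mem: "(I', d') \<in> cls I d" "(J', m') \<in> cls J m" for I' d' J' m'
  proof -
    obtain A B where A: "A \<in> E" "A \<subseteq> I \<inter> I'" "\<forall>x\<in>A. d x = d' x"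
      and B: "B \<in> E" "B \<subseteq> J \<inter> J'" "\<forall>x\<in>B. m x = m' x"
      and *: "I' \<in> E" "J' \<in> E" "d' \<in> Der I'" "m' \<in> Der J'"
      using mem [unfolded mem_cls_iff [OF I d] mem_cls_iff [OF J m]] by blast
    then show ?thesis
      using assms inter_mem [of I' J'] inter_mem [of I J] der inter_mem [OF A(1) B(1)]
      by (subst cls_eq_iff) (auto intro!: bexI [of _ "A \<inter> B"])
  qed
  show ?thesis
  proof (rule trans)
    show "cls I d \<oplus>\<^bsub>Q\<^esub> cls J m = (\<Union>(I', d')\<in>cls I d. \<Union>(J', m')\<in>cls J m. cls (I' \<inter> J') (\<lambda>x\<in>I' \<inter> J'. d' x \<oplus> m' x))"
      by (simp add: Q_def limit_algebra_def)
    show "\<dots> = cls (I \<inter> J) (\<lambda>x\<in>I \<inter> J. d x \<oplus> m x)"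
    proof (rule UN_const_on [OF cls_self [OF I d]], clarify)
      fix I' d' assume "(I', d') \<in> cls I d"
      then show "(\<Union>(J', m')\<in>cls J m. cls (I' \<inter> J') (\<lambda>x\<in>I' \<inter> J'. d' x \<oplus> m' x)) = cls (I \<inter> J) (\<lambda>x\<in>I \<inter> J. d x \<oplus> m x)"
        by (intro UN_const_on [OF cls_self [OF J m]]) (use * in blast)
    qed
  qed
qed

lemma add_cls_same:
  assumes "I \<in> E" "d \<in> Der I" "m \<in> Der I"
  shows "cls I d \<oplus>\<^bsub>Q\<^esub> cls I m = cls I (\<lambda>x\<in>I. d x \<oplus> m x)"
  using add_cls [OF assms(1,2,1,3)] by simp

lemma smult_cls:
  assumes I: "I \<in> E" and d: "d \<in> Der I" and a: "a \<in> carrier R"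
  shows "a \<odot>\<^bsub>Q\<^esub> cls I d = cls I (\<lambda>x\<in>I. a \<odot> d x)"
proof -
  have *: "cls I' (\<lambda>x\<in>I'. a \<odot> d' x) = cls I (\<lambda>x\<in>I. a \<odot> d x)"
    if mem: "(I', d') \<in> cls I d" for I' d'
  proof -
    obtain A where A: "A \<in> E" "A \<subseteq> I \<inter> I'" "\<forall>x\<in>A. d x = d' x"
      and *: "I' \<in> E" "d' \<in> Der I'"
      using mem [unfolded mem_cls_iff [OF I d]] by blast
    then show ?thesis
      using assms derivation_smult ideal
      by (subst cls_eq_iff) (auto intro!: bexI [of _ A])
  qed
  show ?thesis
  proof (rule trans)
    show "a \<odot>\<^bsub>Q\<^esub> cls I d = (\<Union>(I', d')\<in>cls I d. cls I' (\<lambda>x\<in>I'. a \<odot> d' x))"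
      by (simp add: Q_def limit_algebra_def)
    show "\<dots> = cls I (\<lambda>x\<in>I. a \<odot> d x)"
      by (rule UN_const_on [OF cls_self [OF I d]]) (use * in blast)
  qed
qed

lemma bracket_cls:
  assumes I: "I \<in> E" and d: "d \<in> Der I" and J: "J \<in> E" and m: "m \<in> Der J"
  shows "\<^bold>[cls I d, cls J m\<^bold>]\<^bsub>Q\<^esub> = cls (bracket_span R L (I \<inter> J) (I \<inter> J))
    (\<lambda>x\<in>bracket_span R L (I \<inter> J) (I \<inter> J). d (m x) \<ominus> m (d x))"
    (is "_ = cls (?S (I \<inter> J)) _")
proof -
  have der: "(\<lambda>x\<in>?S (I \<inter> J). d (m x) \<ominus> m (d x)) \<in> Der (?S (I \<inter> J))"
    if "I \<in> E" "d \<in> Der I" "J \<in> E" "m \<in> Der J" for I d J m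
  proof -
    let ?K = "I \<inter> J"
    have K: "lie_ideal R L ?K" using that inter_mem ideal by blast
    note K = K bracket_span_subset [OF K]
    have dm: "d x \<in> ?K" "m x \<in> ?K" if "x \<in> ?S ?K" for x
      using derivation_bracket_span [OF _ K(1)] that \<open>d \<in> Der I\<close> \<open>m \<in> Der J\<close> by blast+
    then have "(\<lambda>x\<in>?S ?K. restrict d ?K (restrict m ?K x) \<ominus> restrict m ?K (restrict d ?K x)) \<in> Der (?S ?K)"
      using that K by (intro derivation_commutator [of _ ?K] derivation_restrict lie_ideal_bracket_span) auto
    moreover have "(\<lambda>x\<in>?S ?K. restrict d ?K (restrict m ?K x) \<ominus> restrict m ?K (restrict d ?K x)) =
        (\<lambda>x\<in>?S ?K. d (m x) \<ominus> m (d x))"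
      using dm K(2) by (intro restrict_ext) auto
    ultimately show ?thesis by simp
  qed
  have *: "cls (?S (I' \<inter> J')) (\<lambda>x\<in>?S (I' \<inter> J'). d' (m' x) \<ominus> m' (d' x)) =
      cls (?S (I \<inter> J)) (\<lambda>x\<in>?S (I \<inter> J). d (m x) \<ominus> m (d x))"
    if mem: "(I', d') \<in> cls I d" "(J', m') \<in> cls J m" for I' d' J' m'
  proof -
    obtain A B where A: "A \<in> E" "A \<subseteq> I \<inter> I'" "\<forall>x\<in>A. d x = d' x"
      and B: "B \<in> E" "B \<subseteq> J \<inter> J'" "\<forall>x\<in>B. m x = m' x"
      and I': "I' \<in> E" and J': "J' \<in> E" and d': "d' \<in> Der I'" and m': "m' \<in> Der J'"
      using mem [unfolded mem_cls_iff [OF I d] mem_cls_iff [OF J m]] by blast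
    \<comment> \<open>Agreement of the maps on K does not settle their composites, since the inner
      map may leave K. On the span of [K, K] the inner map has its values in K, where the outer maps
      agree.\<close>
    define K where "K = A \<inter> B"
    have K: "K \<in> E" "lie_ideal R L K" using A B inter_mem ideal by (auto simp: K_def)
    have KS: "?S K \<subseteq> K" using K bracket_span_subset by auto
    have S: "?S K \<in> E" using span_mem K by blast
    have "K \<subseteq> I" "K \<subseteq> J" using A B by (auto simp: K_def)
    then have dK: "d x \<in> K" "m x \<in> K" if "x \<in> ?S K" for x
      using derivation_bracket_span [OF d K(2) _ that] derivation_bracket_span [OF m K(2) _ that] by auto
    have sub: "?S K \<subseteq> ?S (I \<inter> J)" "?S K \<subseteq> ?S (I' \<inter> J')"
      unfolding K_def by (rule bracket_span_mono; use A B in blast)+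
    have "d' (m' x) \<ominus> m' (d' x) = d (m x) \<ominus> m (d x)" if x: "x \<in> ?S K" for x
    proof -
      have "d x = d' x" "m x = m' x" using x KS A B by (auto simp: K_def)
      moreover have "d (m x) = d' (m x)" "m (d x) = m' (d x)"
        using dK [OF x] A B by (auto simp: K_def)
      ultimately show ?thesis by simp
    qed
    then show ?thesis
      using assms I' J' d' m' inter_mem span_mem der S sub
      by (subst cls_eq_iff) (auto intro!: bexI [of _ "?S K"])
  qed
  show ?thesis
  proof (rule trans)
    show "\<^bold>[cls I d, cls J m\<^bold>]\<^bsub>Q\<^esub> = (\<Union>(I', d')\<in>cls I d. \<Union>(J', m')\<in>cls J m. cls (?S (I' \<inter> J')) (\<lambda>x\<in>?S (I' \<inter> J'). d' (m' x) \<ominus> m' (d' x)))"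
      by (simp add: Q_def limit_algebra_def)
    show "\<dots> = cls (?S (I \<inter> J)) (\<lambda>x\<in>?S (I \<inter> J). d (m x) \<ominus> m (d x))"
    proof (rule UN_const_on [OF cls_self [OF I d]], clarify)
      fix I' d' assume "(I', d') \<in> cls I d"
      then show "(\<Union>(J', m')\<in>cls J m. cls (?S (I' \<inter> J')) (\<lambda>x\<in>?S (I' \<inter> J'). d' (m' x) \<ominus> m' (d' x))) = cls (?S (I \<inter> J)) (\<lambda>x\<in>?S (I \<inter> J). d (m x) \<ominus> m (d x))"
        by (intro UN_const_on [OF cls_self [OF J m]]) (use * in blast)
    qed
  qed
qed

lemma bracket_cls_same:
  assumes I: "I \<in> E" and d: "d \<in> Der I" and m: "m \<in> Der I" 
  shows "\<^bold>[cls I d, cls I m\<^bold>]\<^bsub>Q\<^esub> = cls (bracket_span R L I I)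
    (\<lambda>x\<in>bracket_span R L I I. d (m x) \<ominus> m (d x))"
    and "(\<lambda>x\<in>bracket_span R L I I. d (m x) \<ominus> m (d x)) \<in> Der (bracket_span R L I I)"
proof -
  show "\<^bold>[cls I d, cls I m\<^bold>]\<^bsub>Q\<^esub> = cls (bracket_span R L I I)
      (\<lambda>x\<in>bracket_span R L I I. d (m x) \<ominus> m (d x))"
    using bracket_cls [OF I d I m] by simp
  note K = ideal [OF I]
  show "(\<lambda>x\<in>bracket_span R L I I. d (m x) \<ominus> m (d x)) \<in> Der (bracket_span R L I I)"
    using derivation_bracket_span [OF _ K order_refl] d m K
    by (intro derivation_commutator [of _ I] lie_ideal_bracket_span bracket_span_subset) auto
qed

lemma abelian_group_Q: "abelian_group Q"
proof (rule abelian_groupI)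
  fix X Y Z assume X: "X \<in> carrier Q" and Y: "Y \<in> carrier Q" 
  obtain I d m where I: "I \<in> E" and d: "d \<in> Der I" and m: "m \<in> Der I" and eq: "X = cls I d" "Y = cls I m"
    using X Y by (rule carrier_Q2E)
  show "X \<oplus>\<^bsub>Q\<^esub> Y \<in> carrier Q"
    using I d m ideal by (simp add: eq add_cls_same cls_closed derivation_add)
  have "(\<lambda>x\<in>I. d x \<oplus> m x) = (\<lambda>x\<in>I. m x \<oplus> d x)"
    using derivationD(1) [OF d] derivationD(1) [OF m] by (intro restrict_ext) (simp add: M.a_comm)
  then show "X \<oplus>\<^bsub>Q\<^esub> Y = Y \<oplus>\<^bsub>Q\<^esub> X"
    using I d m by (simp add: eq add_cls_same)
next
  fix X Y Z assume "X \<in> carrier Q" "Y \<in> carrier Q" "Z \<in> carrier Q"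
  then obtain I d m n where I: "I \<in> E" and d: "d \<in> Der I" and m: "m \<in> Der I" and n: "n \<in> Der I"
    and eq: "X = cls I d" "Y = cls I m" "Z = cls I n"
    by (rule carrier_Q3E)
  have "(\<lambda>x\<in>I. (\<lambda>x\<in>I. d x \<oplus> m x) x \<oplus> n x) = (\<lambda>x\<in>I. d x \<oplus> (\<lambda>x\<in>I. m x \<oplus> n x) x)"
    using derivationD(1) [OF d] derivationD(1) [OF m] derivationD(1) [OF n]
    by (intro restrict_ext) (simp add: M.a_assoc)
  then show "X \<oplus>\<^bsub>Q\<^esub> Y \<oplus>\<^bsub>Q\<^esub> Z = X \<oplus>\<^bsub>Q\<^esub> (Y \<oplus>\<^bsub>Q\<^esub> Z)"
    unfolding eq using I d m n derivation_add [OF _ _ ideal [OF I]] by (simp add: add_cls_same)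
next
  show "\<zero>\<^bsub>Q\<^esub> \<in> carrier Q"
    by (simp add: zero_Q cls_closed carrier_mem derivation_const_zero lie_ideal_carrier)
next
  fix X assume "X \<in> carrier Q"
  then obtain I d where I: "I \<in> E" and d: "d \<in> Der I" and X: "X = cls I d"
    by (rule carrier_QE)
  note dc = derivationD(1) [OF d] and z = derivation_const_zero [OF ideal [OF I]]
  have "(\<lambda>x\<in>I. (\<lambda>x\<in>I. \<zero>) x \<oplus> d x) = restrict d I"
    using dc by (intro restrict_ext) simp
  also have "restrict d I = d"
    using d by (auto simp: derivations_def extensional_restrict PiE_def)
  finally show "\<zero>\<^bsub>Q\<^esub> \<oplus>\<^bsub>Q\<^esub> X = X"
    using I d z by (simp add: X zero_Q_on [OF I] add_cls_same)
  let ?m = "\<lambda>x\<in>I. (\<ominus>\<^bsub>R\<^esub> \<one>\<^bsub>R\<^esub>) \<odot> d x"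
  have m: "?m \<in> Der I" using derivation_smult [OF d _ ideal [OF I]] by simp
  have "(\<lambda>x\<in>I. ?m x \<oplus> d x) = (\<lambda>x\<in>I. \<zero>)"
    using dc by (intro restrict_ext) (simp add: smult_l_minus M.l_neg)
  then have "cls I ?m \<oplus>\<^bsub>Q\<^esub> X = \<zero>\<^bsub>Q\<^esub>"
    using I d m by (simp add: X zero_Q_on [OF I] add_cls_same)
  then show "\<exists>Y\<in>carrier Q. Y \<oplus>\<^bsub>Q\<^esub> X = \<zero>\<^bsub>Q\<^esub>"
    using cls_closed [OF I m] by blast
qed

lemma module_Q: "module R Q"
proof (rule moduleI)
  show "cring R" by (rule R.is_cring)
  show "abelian_group Q" by (rule abelian_group_Q)
next
  fix X assume "X \<in> carrier Q"
  then obtain I d where I: "I \<in> E" and d: "d \<in> Der I" and X: "X = cls I d"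
    by (blast elim: carrier_QE)
  have "(\<lambda>x\<in>I. \<one>\<^bsub>R\<^esub> \<odot> d x) = restrict d I"
    using derivationD(1) [OF d] by (intro restrict_ext) simp
  also have "restrict d I = d"
    using d by (auto simp: derivations_def extensional_restrict PiE_def)
  finally show "\<one>\<^bsub>R\<^esub> \<odot>\<^bsub>Q\<^esub> X = X"
    using I d by (simp add: X smult_cls)
next
  fix a X assume a: "a \<in> carrier R" and "X \<in> carrier Q"
  then obtain I d where I: "I \<in> E" and d: "d \<in> Der I" and X: "X = cls I d"
    by (blast elim: carrier_QE)
  note dc = derivationD(1) [OF d] and sm = derivation_smult [OF d _ ideal [OF I]]
  show "a \<odot>\<^bsub>Q\<^esub> X \<in> carrier Q"
    using I d a sm by (simp add: X smult_cls cls_closed)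
  fix b assume b: "b \<in> carrier R"
  have "(\<lambda>x\<in>I. (a \<oplus>\<^bsub>R\<^esub> b) \<odot> d x) = (\<lambda>x\<in>I. (\<lambda>x\<in>I. a \<odot> d x) x \<oplus> (\<lambda>x\<in>I. b \<odot> d x) x)"
    using dc a b by (intro restrict_ext) (simp add: smult_l_distr)
  then show "(a \<oplus>\<^bsub>R\<^esub> b) \<odot>\<^bsub>Q\<^esub> X = a \<odot>\<^bsub>Q\<^esub> X \<oplus>\<^bsub>Q\<^esub> b \<odot>\<^bsub>Q\<^esub> X"
    using I d a b sm by (simp add: X smult_cls add_cls_same)
  have "(\<lambda>x\<in>I. (a \<otimes>\<^bsub>R\<^esub> b) \<odot> d x) = (\<lambda>x\<in>I. a \<odot> (\<lambda>x\<in>I. b \<odot> d x) x)"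
    using dc a b by (intro restrict_ext) (simp add: smult_assoc1)
  then show "(a \<otimes>\<^bsub>R\<^esub> b) \<odot>\<^bsub>Q\<^esub> X = a \<odot>\<^bsub>Q\<^esub> (b \<odot>\<^bsub>Q\<^esub> X)"
    using I d a b sm by (simp add: X smult_cls)
next
  fix a X Y assume a: "a \<in> carrier R" and "X \<in> carrier Q" "Y \<in> carrier Q"
  then obtain I d m where I: "I \<in> E" and d: "d \<in> Der I" and m: "m \<in> Der I" and eq: "X = cls I d" "Y = cls I m"
    by (blast elim: carrier_Q2E)
  have "(\<lambda>x\<in>I. a \<odot> (\<lambda>x\<in>I. d x \<oplus> m x) x) = (\<lambda>x\<in>I. (\<lambda>x\<in>I. a \<odot> d x) x \<oplus> (\<lambda>x\<in>I. a \<odot> m x) x)"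
    using derivationD(1) [OF d] derivationD(1) [OF m] a by (intro restrict_ext) (simp add: smult_r_distr)
  then show "a \<odot>\<^bsub>Q\<^esub> (X \<oplus>\<^bsub>Q\<^esub> Y) = a \<odot>\<^bsub>Q\<^esub> X \<oplus>\<^bsub>Q\<^esub> a \<odot>\<^bsub>Q\<^esub> Y"
    unfolding eq using I d m a derivation_add [OF _ _ ideal [OF I]] derivation_smult [OF _ _ ideal [OF I]]
    by (simp add: smult_cls add_cls_same)
qed

lemma lie_algebra_Q: "lie_algebra R Q"
proof (rule lie_algebra.intro [OF module_Q], unfold_locales)
  fix X Y assume "X \<in> carrier Q" "Y \<in> carrier Q"
  then obtain I d m where I: "I \<in> E" and d: "d \<in> Der I" and m: "m \<in> Der I" and eq: "X = cls I d" "Y = cls I m"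
    by (rule carrier_Q2E)
  show "\<^bold>[X, Y\<^bold>]\<^bsub>Q\<^esub> \<in> carrier Q"
    using bracket_cls_same [OF I d m] span_mem [OF I] by (simp add: eq cls_closed)
next
  fix X Y Z assume "X \<in> carrier Q" "Y \<in> carrier Q" "Z \<in> carrier Q"
  then obtain I d m n where I: "I \<in> E" and d: "d \<in> Der I" and m: "m \<in> Der I" and n: "n \<in> Der I"
    and eq: "X = cls I d" "Y = cls I m" "Z = cls I n"
    by (rule carrier_Q3E)
  let ?J = "bracket_span R L I I"
  note Ii = ideal [OF I] and J = span_mem [OF I] and add = derivation_add [OF _ _ ideal [OF I]]
  have into: "e x \<in> I" if "x \<in> ?J" "e \<in> Der I" for x e
    using derivation_bracket_span [OF that(2) Ii order_refl that(1)] .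
  have JI: "x \<in> I" if "x \<in> ?J" for x using bracket_span_subset [OF Ii] that by blast
  note dD = derivationD [OF d] and mD = derivationD [OF m] and nD = derivationD [OF n]
  have mem [simp]: "d x \<in> I" "m x \<in> I" "n x \<in> I" "x \<in> I" if "x \<in> ?J" for x
    using into JI that d m n by auto
  have "(\<lambda>x\<in>?J. (\<lambda>x\<in>I. d x \<oplus> m x) (n x) \<ominus> n ((\<lambda>x\<in>I. d x \<oplus> m x) x)) =
      (\<lambda>x\<in>?J. (\<lambda>x\<in>?J. d (n x) \<ominus> n (d x)) x \<oplus> (\<lambda>x\<in>?J. m (n x) \<ominus> n (m x)) x)"
    using dD(1) mD(1) nD(1,2) by (intro restrict_ext) (simp add: M.add_diff_add)
  then show "\<^bold>[X \<oplus>\<^bsub>Q\<^esub> Y, Z\<^bold>]\<^bsub>Q\<^esub> = \<^bold>[X, Z\<^bold>]\<^bsub>Q\<^esub> \<oplus>\<^bsub>Q\<^esub> \<^bold>[Y, Z\<^bold>]\<^bsub>Q\<^esub>"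
    unfolding eq using I J d m n add bracket_cls_same(2)
    by (simp add: add_cls_same bracket_cls_same(1))
  have "(\<lambda>x\<in>?J. d ((\<lambda>x\<in>I. m x \<oplus> n x) x) \<ominus> (\<lambda>x\<in>I. m x \<oplus> n x) (d x)) =
      (\<lambda>x\<in>?J. (\<lambda>x\<in>?J. d (m x) \<ominus> m (d x)) x \<oplus> (\<lambda>x\<in>?J. d (n x) \<ominus> n (d x)) x)"
    using dD(1,2) mD(1) nD(1) by (intro restrict_ext) (simp add: M.add_diff_add)
  then show "\<^bold>[X, Y \<oplus>\<^bsub>Q\<^esub> Z\<^bold>]\<^bsub>Q\<^esub> = \<^bold>[X, Y\<^bold>]\<^bsub>Q\<^esub> \<oplus>\<^bsub>Q\<^esub> \<^bold>[X, Z\<^bold>]\<^bsub>Q\<^esub>"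
    unfolding eq using I J d m n add bracket_cls_same(2)
    by (simp add: add_cls_same bracket_cls_same(1))
  \<comment> \<open>A double bracket composes three maps, so the ideal is squared once more: on ?K
    the innermost map lands in ?J, the next one in I, and the outermost is defined there.\<close>
  let ?K = "bracket_span R L ?J ?J"
  have K: "?K \<in> E" using span_mem J by blast
  note Ji = ideal [OF J]
  have KJ: "x \<in> ?J" if "x \<in> ?K" for x using bracket_span_subset [OF Ji] that by blast
  have JsI: "?J \<subseteq> I" using JI by auto
  have intoJ: "e x \<in> ?J" if "x \<in> ?K" "e \<in> Der I" for x e
    using derivation_bracket_span [OF that(2) Ji JsI that(1)] .
  define c where "c d m = (\<lambda>x\<in>?J. d (m x) \<ominus> m (d x))" for d m :: "'c \<Rightarrow> 'c"
  have c_Der: "c d m \<in> Der ?J" if "d \<in> Der I" "m \<in> Der I" for d m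
    using bracket_cls_same(2) [OF I that] by (simp add: c_def)
  define t where "t d m n x = (d (m (n x)) \<ominus> d (n (m x))) \<ominus> (m (n (d x)) \<ominus> n (m (d x)))"
    for d m n and x :: 'c
  have nested: "\<^bold>[cls I d, \<^bold>[cls I m, cls I n\<^bold>]\<^bsub>Q\<^esub>\<^bold>]\<^bsub>Q\<^esub> = cls ?K (\<lambda>x\<in>?K. t d m n x)"
    and nested_Der: "(\<lambda>x\<in>?K. t d m n x) \<in> Der ?K"
    if d: "d \<in> Der I" and m: "m \<in> Der I" and n: "n \<in> Der I" for d m n
  proof -
    have r: "restrict d ?J \<in> Der ?J" using derivation_restrict [OF d Ji JsI] .
    have 1: "\<^bold>[cls I d, \<^bold>[cls I m, cls I n\<^bold>]\<^bsub>Q\<^esub>\<^bold>]\<^bsub>Q\<^esub> = \<^bold>[cls ?J (restrict d ?J), cls ?J (c m n)\<^bold>]\<^bsub>Q\<^esub>"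
      using bracket_cls_same(1) [OF I m n] cls_restrict [OF I d J JsI] by (simp add: c_def)
    have 2: "(\<lambda>x\<in>?K. restrict d ?J (c m n x) \<ominus> c m n (restrict d ?J x)) = (\<lambda>x\<in>?K. t d m n x)"
    proof (rule restrict_ext)
      fix x assume x: "x \<in> ?K"
      have "m (n x) \<in> I" "n (m x) \<in> I"
        using intoJ [OF x] m n into by blast+
      moreover have "c m n x \<in> ?J" using derivation_bracket_span [OF c_Der [OF m n] Ji order_refl x] .
      ultimately show "restrict d ?J (c m n x) \<ominus> c m n (restrict d ?J x) = t d m n x"
        using KJ [OF x] intoJ [OF x d] derivation_diff [OF d Ii] by (simp add: c_def t_def)
    qed
    show "\<^bold>[cls I d, \<^bold>[cls I m, cls I n\<^bold>]\<^bsub>Q\<^esub>\<^bold>]\<^bsub>Q\<^esub> = cls ?K (\<lambda>x\<in>?K. t d m n x)"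
      unfolding 1 bracket_cls_same(1) [OF J r c_Der [OF m n]] 2 ..
    show "(\<lambda>x\<in>?K. t d m n x) \<in> Der ?K"
      using bracket_cls_same(2) [OF J r c_Der [OF m n]] unfolding 2 .
  qed
  have closed3: "e (f (g x)) \<in> carrier L"
    if x: "x \<in> ?K" and e: "e \<in> Der I" and f: "f \<in> Der I" and g: "g \<in> Der I" for e f g x
    using derivationD(1) [OF e into [OF intoJ [OF x g] f]] .
  define f where "f d m n = (\<lambda>x\<in>?K. t d m n x)" for d m n
  have f: "f d m n \<in> Der ?K" "f m n d \<in> Der ?K" "f n d m \<in> Der ?K"
    using nested_Der d m n by (simp_all add: f_def)
  have sum: "(\<lambda>x\<in>?K. (\<lambda>x\<in>?K. f d m n x \<oplus> f m n d x) x \<oplus> f n d m x) = (\<lambda>x\<in>?K. \<zero>)"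
    using M.commutator_jacobi closed3 d m n by (intro restrict_ext) (simp add: t_def f_def)
  show "\<^bold>[X, \<^bold>[Y, Z\<^bold>]\<^bsub>Q\<^esub>\<^bold>]\<^bsub>Q\<^esub> \<oplus>\<^bsub>Q\<^esub> \<^bold>[Y, \<^bold>[Z, X\<^bold>]\<^bsub>Q\<^esub>\<^bold>]\<^bsub>Q\<^esub> \<oplus>\<^bsub>Q\<^esub> \<^bold>[Z, \<^bold>[X, Y\<^bold>]\<^bsub>Q\<^esub>\<^bold>]\<^bsub>Q\<^esub> = \<zero>\<^bsub>Q\<^esub>"
    unfolding eq nested [OF d m n] nested [OF m n d] nested [OF n d m] zero_Q_on [OF K]
      f_def [symmetric] add_cls_same [OF K f(1,2)]
      add_cls_same [OF K derivation_add [OF f(1,2) ideal [OF K]] f(3)] sum ..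
next
  fix a X Y assume a: "a \<in> carrier R" and "X \<in> carrier Q" "Y \<in> carrier Q"
  then obtain I d m where I: "I \<in> E" and d: "d \<in> Der I" and m: "m \<in> Der I" and eq: "X = cls I d" "Y = cls I m"
    by (blast elim: carrier_Q2E)
  let ?J = "bracket_span R L I I"
  note Ii = ideal [OF I] and J = span_mem [OF I] and sm = derivation_smult [OF _ a ideal [OF I]]
  note dD = derivationD [OF d] and mD = derivationD [OF m]
  have mem [simp]: "d x \<in> I" "m x \<in> I" "x \<in> I" if "x \<in> ?J" for x
    using derivation_bracket_span [OF _ Ii order_refl that] bracket_span_subset [OF Ii] that d m by auto
  have "(\<lambda>x\<in>?J. (\<lambda>x\<in>I. a \<odot> d x) (m x) \<ominus> m ((\<lambda>x\<in>I. a \<odot> d x) x)) =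
      (\<lambda>x\<in>?J. a \<odot> (\<lambda>x\<in>?J. d (m x) \<ominus> m (d x)) x)"
    using dD(1) mD(1,3) a by (intro restrict_ext) (simp add: M.minus_eq smult_r_distr smult_r_minus)
  then show "\<^bold>[a \<odot>\<^bsub>Q\<^esub> X, Y\<^bold>]\<^bsub>Q\<^esub> = a \<odot>\<^bsub>Q\<^esub> \<^bold>[X, Y\<^bold>]\<^bsub>Q\<^esub>"
    unfolding eq using I J d m sm a bracket_cls_same(2)
    by (simp add: smult_cls bracket_cls_same(1))
  have "(\<lambda>x\<in>?J. d ((\<lambda>x\<in>I. a \<odot> m x) x) \<ominus> (\<lambda>x\<in>I. a \<odot> m x) (d x)) =
      (\<lambda>x\<in>?J. a \<odot> (\<lambda>x\<in>?J. d (m x) \<ominus> m (d x)) x)"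
    using dD(1,3) mD(1) a by (intro restrict_ext) (simp add: M.minus_eq smult_r_distr smult_r_minus)
  then show "\<^bold>[X, a \<odot>\<^bsub>Q\<^esub> Y\<^bold>]\<^bsub>Q\<^esub> = a \<odot>\<^bsub>Q\<^esub> \<^bold>[X, Y\<^bold>]\<^bsub>Q\<^esub>"
    unfolding eq using I J d m sm a bracket_cls_same(2)
    by (simp add: smult_cls bracket_cls_same(1))
next
  fix X assume "X \<in> carrier Q"
  then obtain I d where I: "I \<in> E" and d: "d \<in> Der I" and X: "X = cls I d"
    by (rule carrier_QE)
  let ?J = "bracket_span R L I I"
  have "(\<lambda>x\<in>?J. d (d x) \<ominus> d (d x)) = (\<lambda>x\<in>?J. \<zero>)"
    using derivationD(1) [OF d] derivation_bracket_span [OF d ideal [OF I] order_refl]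
    by (intro restrict_ext) (simp add: M.minus_eq M.r_neg)
  then show "\<^bold>[X, X\<^bold>]\<^bsub>Q\<^esub> = \<zero>\<^bsub>Q\<^esub>"
    using bracket_cls_same(1) [OF I d d] zero_Q_on [OF span_mem [OF I]] by (simp add: X)
qed

end


lemma (in lie) semiprime_abelian_ideal:
  assumes "semiprime R L" "lie_ideal R L I" "\<And>x y. \<lbrakk>x \<in> I; y \<in> I\<rbrakk> \<Longrightarrow> \<^bold>[x, y\<^bold>] = \<zero>"
  shows "I = {\<zero>}"
proof -
  have "bracket_span R L I I \<subseteq> {\<zero>}"
    using assms(3) lie_ideal_submodule [OF lie_ideal_zero] by (intro bracket_span_least) auto
  moreover have "\<zero> \<in> bracket_span R L I I"
    using lie_idealD(2) [OF lie_ideal_bracket_span] assms(2) by blast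
  ultimately show ?thesis
    using assms(1,2) unfolding semiprime_def by blast
qed

section \<open>Gradings\<close>

locale graded_lie = graded_lie_algebra R L G for R and L (structure) and G

sublocale graded_lie \<subseteq> lie R L
  by unfold_locales

context graded_lie begin

abbreviation comp :: "int \<Rightarrow> 'c \<Rightarrow> 'c" where
  "comp \<equiv> component L G"

lemma G_mem_carrier: "x \<in> G k \<Longrightarrow> x \<in> carrier L"
  using submoduleE(1) [OF component_submodule] by blast

lemma G_zero [simp]: "\<zero> \<in> G k"
  using subgroup.one_closed [OF submodule.axioms(1) [OF component_submodule]] by simp

text \<open>The definition sums over the exact support of c. Any finite set containing the support
  gives the same sum and is easier to supply, for instance the union of two supports.\<close>

lemma homogeneous_decompositionI:
  assumes "\<And>k. c k \<in> G k" "finite S" "\<And>k. k \<notin> S \<Longrightarrow> c k = \<zero>" "x = (\<Oplus>k\<in>S. c k)"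
  shows "homogeneous_decomposition L G x c"
proof -
  let ?T = "{k. c k \<noteq> \<zero>}"
  have T: "?T \<subseteq> S" using assms(3) by blast
  have "(\<Oplus>k\<in>?T. c k) = (\<Oplus>k\<in>S. c k)"
    using assms T G_mem_carrier [OF assms(1)] by (intro M.add.finprod_mono_neutral_cong_left) auto
  then show ?thesis
    using assms finite_subset [OF T] by (simp add: homogeneous_decomposition_def)
qed

lemma component_decomposition:
  assumes "x \<in> carrier L" shows "homogeneous_decomposition L G x (\<lambda>k. comp k x)"
  using theI' [OF direct_sum [OF assms]] by (simp add: component_def)

lemma component_eqI:
  assumes "homogeneous_decomposition L G x c" shows "comp k x = c k"
proof -
  have "x \<in> carrier L"
    using assms G_mem_carrier unfolding homogeneous_decomposition_def
    by (metis M.finsum_closed Pi_I)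
  then have "(THE c. homogeneous_decomposition L G x c) = c"
    using direct_sum assms by blast
  then show ?thesis by (simp add: component_def)
qed

lemma component_mem: "x \<in> carrier L \<Longrightarrow> comp k x \<in> G k"
  using component_decomposition by (simp add: homogeneous_decomposition_def)

lemma component_closed [simp]: "x \<in> carrier L \<Longrightarrow> comp k x \<in> carrier L"
  using component_mem G_mem_carrier by blast

lemma component_sum:
  assumes "x \<in> carrier L" "finite S" "\<And>k. k \<notin> S \<Longrightarrow> comp k x = \<zero>"
  shows "(\<Oplus>k\<in>S. comp k x) = x"
proof -
  have "x = (\<Oplus>k\<in>{k. comp k x \<noteq> \<zero>}. comp k x)"
    using component_decomposition [OF assms(1)] by (simp add: homogeneous_decomposition_def)
  also have "\<dots> = (\<Oplus>k\<in>S. comp k x)"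
    using assms by (intro M.add.finprod_mono_neutral_cong_left) auto
  finally show ?thesis by simp
qed

lemma component_homogeneous:
  assumes "x \<in> G k" shows "comp j x = (if j = k then x else \<zero>)"
  using assms G_mem_carrier [OF assms]
  by (intro component_eqI homogeneous_decompositionI [of _ "{k}"]) (auto simp: M.finsum_insert)

lemma finite_component_support: "x \<in> carrier L \<Longrightarrow> finite {k. comp k x \<noteq> \<zero>}"
  using component_decomposition by (simp add: homogeneous_decomposition_def)

lemma component_add:
  assumes x: "x \<in> carrier L" and y: "y \<in> carrier L"
  shows "comp k (x \<oplus> y) = comp k x \<oplus> comp k y"
proof (rule component_eqI, rule homogeneous_decompositionI)
  let ?S = "{k. comp k x \<noteq> \<zero>} \<union> {k. comp k y \<noteq> \<zero>}"
  show S: "finite ?S" using assms finite_component_support by simp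
  show "comp k x \<oplus> comp k y \<in> G k" for k
    using assms component_mem submoduleE(5) [OF component_submodule] by simp
  show "x \<oplus> y = (\<Oplus>k\<in>?S. comp k x \<oplus> comp k y)"
    using component_sum [OF x S] component_sum [OF y S] x y by (simp add: M.finsum_addf)
qed auto

lemma component_smult:
  assumes x: "x \<in> carrier L" and a: "a \<in> carrier R"
  shows "comp k (a \<odot> x) = a \<odot> comp k x"
proof (rule component_eqI, rule homogeneous_decompositionI)
  let ?S = "{k. comp k x \<noteq> \<zero>}"
  show S: "finite ?S" using assms finite_component_support by simp
  show "a \<odot> comp k x \<in> G k" for k
    using assms component_mem submoduleE(4) [OF component_submodule] by simp
  show "a \<odot> x = (\<Oplus>k\<in>?S. a \<odot> comp k x)"
    using component_sum [OF x S] finsum_smult_ldistr [OF S a, of "\<lambda>k. comp k x"] x by simp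
qed (use a in auto)

lemma component_zero [simp]: "comp k \<zero> = \<zero>"
  using component_homogeneous [of \<zero> k k] by simp

end

locale three_graded_lie = graded_lie +
  assumes three: "three_graded L G"
begin

lemma G_outside: "k \<notin> {-1, 0, 1} \<Longrightarrow> x \<in> G k \<Longrightarrow> x = \<zero>"
  using three by (auto simp: three_graded_def)

lemma component_outside: "k \<notin> {-1, 0, 1} \<Longrightarrow> x \<in> carrier L \<Longrightarrow> comp k x = \<zero>"
  using G_outside component_mem by blast

text \<open>The sign s allows the two outer degrees to be treated by one argument later on.\<close>

lemma component_sum_three:
  assumes "x \<in> carrier L" and s: "s = 1 \<or> s = -1"
  shows "x = comp (- s) x \<oplus> comp 0 x \<oplus> comp s x"
proof -
  have "x = (\<Oplus>k\<in>{-1, 0, 1}. comp k x)"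
    using component_sum [of x "{-1, 0, 1}"] component_outside assms by simp
  also have "\<dots> = comp (- s) x \<oplus> comp 0 x \<oplus> comp s x"
    using assms by (auto simp: M.finsum_insert M.a_ac)
  finally show ?thesis .
qed

lemma component_bracket:
  assumes x: "x \<in> carrier L" and y: "y \<in> carrier L"
  shows "comp k \<^bold>[x, y\<^bold>] =
    \<^bold>[comp (k + 1) x, comp (-1) y\<^bold>] \<oplus> \<^bold>[comp k x, comp 0 y\<^bold>] \<oplus> \<^bold>[comp (k - 1) x, comp 1 y\<^bold>]"
proof -
  have hom: "comp k \<^bold>[x, y\<^bold>] = \<^bold>[comp (k - j) x, y\<^bold>]" if y: "y \<in> G j" for y j
  proof -
    have yc: "y \<in> carrier L" using y G_mem_carrier by blast
    have c: "comp k \<^bold>[comp i x, y\<^bold>] = (if k = i + j then \<^bold>[comp i x, y\<^bold>] else \<zero>)" for i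
      using component_homogeneous bracket_degree [OF component_mem [OF x] y] by blast
    have "comp k \<^bold>[x, y\<^bold>] = comp k \<^bold>[comp (-1) x \<oplus> comp 0 x \<oplus> comp 1 x, y\<^bold>]"
      using component_sum_three [OF x, of 1] by simp
    also have "\<dots> = comp k \<^bold>[comp (-1) x, y\<^bold>] \<oplus> comp k \<^bold>[comp 0 x, y\<^bold>] \<oplus> comp k \<^bold>[comp 1 x, y\<^bold>]"
      using x yc by (simp add: bracket_add_left component_add)
    also have "\<dots> = \<^bold>[comp (k - j) x, y\<^bold>]"
    proof (cases "k - j \<in> {-1, 0, 1}")
      case True
      then have "k = j - 1 \<or> k = j \<or> k = j + 1" by auto
      then show ?thesis using x yc unfolding c by auto
    next
      case False
      then show ?thesis using x yc component_outside [OF False x] unfolding c by auto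
    qed
    finally show ?thesis .
  qed
  have "comp k \<^bold>[x, y\<^bold>] = comp k \<^bold>[x, comp (-1) y \<oplus> comp 0 y \<oplus> comp 1 y\<^bold>]"
    using component_sum_three [OF y, of 1] by simp
  also have "\<dots> = comp k \<^bold>[x, comp (-1) y\<^bold>] \<oplus> comp k \<^bold>[x, comp 0 y\<^bold>] \<oplus> comp k \<^bold>[x, comp 1 y\<^bold>]"
    using x y by (simp add: bracket_add_right component_add)
  finally show ?thesis
    using hom [OF component_mem [OF y]] by simp
qed

lemma component_bracket_left:
  assumes "x \<in> carrier L" "y \<in> G j" shows "comp (k + j) \<^bold>[x, y\<^bold>] = \<^bold>[comp k x, y\<^bold>]"
proof -
  have y: "y \<in> carrier L" using assms(2) G_mem_carrier by blast
  show ?thesis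
  proof (cases "j \<in> {-1, 0, 1}")
    case True
    then have "j = -1 \<or> j = 0 \<or> j = 1" by auto
    then show ?thesis
      using assms y by (elim disjE; simp add: component_bracket component_homogeneous)
  next
    case False
    then have "y = \<zero>" using G_outside assms(2) by blast
    then show ?thesis using assms(1) by simp
  qed
qed

lemma component_bracket_right:
  assumes "x \<in> G j" "y \<in> carrier L" shows "comp (k + j) \<^bold>[x, y\<^bold>] = \<^bold>[x, comp k y\<^bold>]"
proof -
  have x: "x \<in> carrier L" using assms(1) G_mem_carrier by blast
  \<comment> \<open>Antisymmetry is expressed through the scalar -1, with which taking components is
    already known to commute.\<close>
  have "comp (k + j) \<^bold>[x, y\<^bold>] = comp (k + j) ((\<ominus>\<^bsub>R\<^esub> \<one>\<^bsub>R\<^esub>) \<odot> \<^bold>[y, x\<^bold>])"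
    using x assms(2) bracket_antisym [of x y] smult_l_minus [of "\<one>\<^bsub>R\<^esub>" "\<^bold>[y, x\<^bold>]"] by simp
  also have "\<dots> = (\<ominus>\<^bsub>R\<^esub> \<one>\<^bsub>R\<^esub>) \<odot> \<^bold>[comp k y, x\<^bold>]"
    using x assms component_bracket_left [OF assms(2,1)] by (simp add: component_smult)
  also have "\<dots> = \<^bold>[x, comp k y\<^bold>]"
    using x assms(2) bracket_antisym [of x "comp k y"] smult_l_minus [of "\<one>\<^bsub>R\<^esub>" "\<^bold>[comp k y, x\<^bold>]"] by simp
  finally show ?thesis .
qed

text \<open>The components of an element of a graded ideal stay in the ideal and add up to the
  element. Additive identities for derivations can therefore be checked on homogeneous
  elements.\<close>

lemma graded_ideal_induct [consumes 2, case_names homogeneous add]: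
  assumes I: "graded_ideal R L G I" and x: "x \<in> I"
    and hom: "\<And>x j. \<lbrakk>x \<in> I; x \<in> G j\<rbrakk> \<Longrightarrow> P x"
    and add: "\<And>x y. \<lbrakk>x \<in> I; y \<in> I; P x; P y\<rbrakk> \<Longrightarrow> P (x \<oplus> y)"
  shows "P x"
proof -
  have I': "lie_ideal R L I" and c: "comp k x \<in> I" for k
    using I x by (auto simp: graded_ideal_def)
  note ID = lie_idealD [OF I']
  have xc: "x \<in> carrier L" using x ID by blast
  have "P (comp k x)" for k using c component_mem [OF xc] hom by blast
  then have "P (comp (-1) x \<oplus> comp 0 x \<oplus> comp 1 x)"
    using c ID by (intro add) auto
  then show ?thesis using component_sum_three [OF xc, of 1] by simp
qed

text \<open>For an ideal I this is the largest graded ideal contained in I.\<close>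

definition graded_core :: "'c set \<Rightarrow> 'c set" where
  "graded_core I = {x \<in> carrier L. \<forall>k. comp k x \<in> I}"

lemma graded_core_subset:
  assumes "lie_ideal R L I" shows "graded_core I \<subseteq> I"
proof
  fix x assume "x \<in> graded_core I"
  then have "x \<in> carrier L" "comp (-1) x \<oplus> comp 0 x \<oplus> comp 1 x \<in> I"
    using lie_idealD(4) [OF assms] by (auto simp: graded_core_def)
  then show "x \<in> I" using component_sum_three [of x 1] by simp
qed

lemma homogeneous_in_graded_core:
  assumes "lie_ideal R L I" "x \<in> I" "x \<in> G k" shows "x \<in> graded_core I"
  using assms lie_idealD [OF assms(1)] by (auto simp: graded_core_def component_homogeneous)

lemma graded_ideal_graded_core:
  assumes I: "lie_ideal R L I" shows "graded_ideal R L G (graded_core I)"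
proof -
  note ID = lie_idealD [OF I]
  have "lie_ideal R L (graded_core I)"
  proof (rule lie_idealI)
    show "\<^bold>[x, y\<^bold>] \<in> graded_core I" if "x \<in> carrier L" "y \<in> graded_core I" for x y
      using that ID(4,7) by (simp add: graded_core_def component_bracket)
  qed (use ID in \<open>auto simp: graded_core_def component_add component_smult\<close>)
  moreover have "comp k x \<in> graded_core I" if "x \<in> graded_core I" for k x
    using that ID(2) component_homogeneous [OF component_mem, of x] by (auto simp: graded_core_def)
  ultimately show ?thesis by (simp add: graded_ideal_def)
qed

text \<open>Each component of [x, y] is a sum of brackets of components, so the generators already
  lie in the graded core of the span.\<close>

lemma graded_ideal_bracket_span:
  assumes "graded_ideal R L G I" shows "graded_ideal R L G (bracket_span R L I I)"
proof -
  let ?S = "bracket_span R L I I"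
  have I: "lie_ideal R L I" and c: "\<And>k x. x \<in> I \<Longrightarrow> comp k x \<in> I"
    using assms by (auto simp: graded_ideal_def)
  have S: "lie_ideal R L ?S" using lie_ideal_bracket_span I by blast
  have "?S \<subseteq> graded_core ?S"
  proof (rule bracket_span_least)
    show "submodule (graded_core ?S) R L"
      using graded_ideal_graded_core [OF S] by (simp add: graded_ideal_def lie_ideal_def)
    show "\<^bold>[x, y\<^bold>] \<in> graded_core ?S" if "x \<in> I" "y \<in> I" for x y
      using that c lie_idealD(3) [OF I] lie_idealD(4) [OF S]
      by (simp add: graded_core_def component_bracket bracket_span_bracket)
  qed
  then show ?thesis using S by (auto simp: graded_ideal_def graded_core_def)
qed

end

section \<open>Homogeneous elements in ideals of a semiprime algebra\<close>

locale semiprime_three_graded_lie = three_graded_lie +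
  assumes semiprime: "semiprime R L"
begin

text \<open>The elements of degree \<open>s\<close> killed by degree \<open>- s\<close> form an abelian ideal.\<close>

lemma homogeneous_killed_zero:
  assumes s: "s = 1 \<or> s = -1" and u: "u \<in> G s" and z: "\<And>c. c \<in> G (- s) \<Longrightarrow> \<^bold>[c, u\<^bold>] = \<zero>"
  shows "u = \<zero>"
proof -
  let ?A = "{u \<in> G s. \<forall>c\<in>G (- s). \<^bold>[c, u\<^bold>] = \<zero>}"
  note S = submoduleE [OF component_submodule [of s]]
  have out: "\<^bold>[x, y\<^bold>] = \<zero>" if "x \<in> G s" "y \<in> G s" for x y
    using bracket_degree [OF that] G_outside [of "s + s"] s by auto
  have "lie_ideal R L ?A"
  proof (rule lie_idealI)
    show "\<^bold>[x, v\<^bold>] \<in> ?A" if x: "x \<in> carrier L" and v: "v \<in> ?A" for x v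
    proof -
      note xs = component_mem [OF x]
      have vc: "v \<in> carrier L" using v S by auto
      have g: "\<^bold>[comp 0 x, v\<^bold>] \<in> G s" using bracket_degree [OF xs [of 0], of v s] v by simp
      have "\<^bold>[x, v\<^bold>] = \<^bold>[comp (- s) x \<oplus> comp 0 x \<oplus> comp s x, v\<^bold>]"
        using component_sum_three [OF x s] by simp
      also have "\<dots> = \<^bold>[comp 0 x, v\<^bold>]"
        using x v vc xs [of s] xs [of "-s"] out by (simp add: bracket_add_left)
      finally have eq: "\<^bold>[x, v\<^bold>] = \<^bold>[comp 0 x, v\<^bold>]" .
      have "\<^bold>[c, \<^bold>[comp 0 x, v\<^bold>]\<^bold>] = \<zero>" if c: "c \<in> G (- s)" for c
      proof -
        have "\<^bold>[c, comp 0 x\<^bold>] \<in> G (- s)" using bracket_degree [OF c xs [of 0]] by simp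
        then show ?thesis
          using leibniz [of c "comp 0 x" v] v vc x c G_mem_carrier by simp
      qed
      then show ?thesis using g by (simp add: eq)
    qed
  qed (use S G_mem_carrier in \<open>auto simp: bracket_add_right bracket_smult_right\<close>)
  then have "?A = {\<zero>}"
    using out by (intro semiprime_abelian_ideal [OF semiprime]) auto
  then show ?thesis using u z by auto
qed

text \<open>If K had no nonzero homogeneous element, every homogeneous expression that lies in K
  would vanish. Brackets with homogeneous elements of L are used to strip an element of K down to
  one component: first the degree opposite to s, then degree 0, until only [x_0, y_0] remains of
  [x, y] and is itself homogeneous.\<close>

lemma nonzero_ideal_homogeneous:
  assumes K: "lie_ideal R L K" and nz: "K \<noteq> {\<zero>}"
  obtains k x where "x \<in> K" "x \<in> G k" "x \<noteq> \<zero>"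
proof (rule ccontr)
  assume "\<not> thesis"
  then have hom: "x = \<zero>" if "x \<in> K" "x \<in> G k" for x k
    using that \<open>\<And>x k. \<lbrakk>x \<in> K; x \<in> G k; x \<noteq> \<zero>\<rbrakk> \<Longrightarrow> thesis\<close> by blast
  note KD = lie_idealD [OF K]
  have out: "\<^bold>[x, y\<^bold>] = \<zero>" if "x \<in> G s" "y \<in> G s" "s = 1 \<or> s = -1" for s x y
    using bracket_degree [OF that(1,2)] G_outside [of "s + s"] that(3) by auto
  have split: "\<^bold>[a, y\<^bold>] = \<^bold>[a, comp (- s) y\<^bold>] \<oplus> \<^bold>[a, comp 0 y\<^bold>]"
    if s: "s = 1 \<or> s = -1" and a: "a \<in> G s" and y: "y \<in> K" for s a y
  proof -
    have yc: "y \<in> carrier L" and ac: "a \<in> carrier L" using KD y G_mem_carrier a by auto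
    have "\<^bold>[a, y\<^bold>] = \<^bold>[a, comp (- s) y \<oplus> comp 0 y \<oplus> comp s y\<^bold>]"
      using component_sum_three [OF yc s] by simp
    then show ?thesis
      using ac yc out [OF a component_mem [OF yc] s] by (simp add: bracket_add_right)
  qed
  \<comment> \<open>Two brackets with elements of degree s push every component of y except the one
    of degree - s out of the grading, so the result is homogeneous and lies in K.\<close>
  have minor: "\<^bold>[d, \<^bold>[a, comp (- s) y\<^bold>]\<^bold>] = \<zero>"
    if s: "s = 1 \<or> s = -1" and a: "a \<in> G s" and y: "y \<in> K" and d: "d \<in> G s" for s a y d
  proof -
    have yc: "y \<in> carrier L" and ac: "a \<in> carrier L" and dc: "d \<in> carrier L"
      using KD y G_mem_carrier a d by auto
    have 0: "\<^bold>[a, comp 0 y\<^bold>] \<in> G s" using bracket_degree [OF a component_mem [OF yc, of 0]] by simp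
    have 1: "\<^bold>[a, comp (- s) y\<^bold>] \<in> G 0" using bracket_degree [OF a component_mem [OF yc, of "- s"]] by simp
    have "\<^bold>[d, \<^bold>[a, y\<^bold>]\<^bold>] = \<^bold>[d, \<^bold>[a, comp (- s) y\<^bold>]\<^bold>]"
      using split [OF s a y] ac yc dc out [OF d 0 s] by (simp add: bracket_add_right)
    moreover have "\<^bold>[d, \<^bold>[a, y\<^bold>]\<^bold>] \<in> K" by (intro KD(7) dc ac y)
    moreover have "\<^bold>[d, \<^bold>[a, comp (- s) y\<^bold>]\<^bold>] \<in> G s" using bracket_degree [OF d 1] by simp
    ultimately show ?thesis using hom by simp
  qed
  \<comment> \<open>Apply \<open>minor\<close> with the opposite sign and with x and y exchanged: e
    of degree - s kills ?b, so [e, [?a, y]] reduces to [e, ?c], which has degree 0, lies in K and is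
    therefore zero. Hence ?c is killed by all of degree - s and vanishes. What is left of [?a, y] is
    ?b, of degree 0 and in K.\<close>
  have outer: "\<^bold>[comp s x, comp 0 y\<^bold>] = \<zero>" "\<^bold>[comp s x, y\<^bold>] = \<zero>"
    if s: "s = 1 \<or> s = -1" and x: "x \<in> K" and y: "y \<in> K" for s x y
  proof -
    have yc: "y \<in> carrier L" and xc: "x \<in> carrier L" using KD y x by auto
    have s': "- s = 1 \<or> - s = -1" using s by auto
    let ?a = "comp s x" and ?b = "\<^bold>[comp s x, comp (- s) y\<^bold>]" and ?c = "\<^bold>[comp s x, comp 0 y\<^bold>]"
    have a: "?a \<in> G s" using component_mem xc by blast
    have b: "?b \<in> G 0" using bracket_degree [OF a component_mem [OF yc, of "- s"]] by simp
    have c: "?c \<in> G s" using bracket_degree [OF a component_mem [OF yc, of 0]] by simp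
    have in_K: "\<^bold>[?a, y\<^bold>] \<in> K" using KD(7) xc y by simp
    have "\<^bold>[e, ?c\<^bold>] = \<zero>" if e: "e \<in> G (- s)" for e
    proof -
      have ec: "e \<in> carrier L" using e G_mem_carrier by blast
      have "\<^bold>[e, \<^bold>[comp (- s) y, comp s x\<^bold>]\<^bold>] = \<zero>"
        using minor [OF s' component_mem [OF yc] x e] by simp
      then have "\<^bold>[e, ?b\<^bold>] = \<zero>"
        using ec xc yc bracket_antisym [of "comp s x" "comp (- s) y"]
        by (simp add: bracket_minus_right)
      then have "\<^bold>[e, \<^bold>[?a, y\<^bold>]\<^bold>] = \<^bold>[e, ?c\<^bold>]"
        using split [OF s a y] xc yc ec by (simp add: bracket_add_right)
      moreover have "\<^bold>[e, \<^bold>[?a, y\<^bold>]\<^bold>] \<in> K" by (intro KD(7) ec in_K)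
      moreover have "\<^bold>[e, ?c\<^bold>] \<in> G 0" using bracket_degree [OF e c] by simp
      ultimately show ?thesis using hom by simp
    qed
    then show c0: "?c = \<zero>" using homogeneous_killed_zero [OF s c] by blast
    have "\<^bold>[?a, y\<^bold>] = ?b" using split [OF s a y] c0 xc yc by simp
    then show "\<^bold>[?a, y\<^bold>] = \<zero>" using hom in_K b by simp
  qed
  have "\<^bold>[x, y\<^bold>] = \<zero>" if x: "x \<in> K" and y: "y \<in> K" for x y
  proof -
    have yc: "y \<in> carrier L" and xc: "x \<in> carrier L" using KD y x by auto
    have e: "\<^bold>[comp 0 x, comp s y\<^bold>] = \<zero>" if "s = 1 \<or> s = -1" for s
      using outer(1) [OF that y x] bracket_eq_zero_commute xc yc by simp
    have "\<^bold>[x, y\<^bold>] = \<^bold>[comp (-1) x \<oplus> comp 0 x \<oplus> comp 1 x, y\<^bold>]"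
      using component_sum_three [OF xc, of 1] by simp
    also have "\<dots> = \<^bold>[comp 0 x, y\<^bold>]"
      using outer(2) [OF _ x y, of 1] outer(2) [OF _ x y, of "-1"] xc yc by (simp add: bracket_add_left)
    also have "\<dots> = \<^bold>[comp 0 x, comp (-1) y \<oplus> comp 0 y \<oplus> comp 1 y\<^bold>]"
      using component_sum_three [OF yc, of 1] by simp
    also have "\<dots> = \<^bold>[comp 0 x, comp 0 y\<^bold>]"
      using e [of 1] e [of "-1"] xc yc by (simp add: bracket_add_right)
    also have "\<dots> \<in> G 0"
      using bracket_degree [OF component_mem [OF xc, of 0] component_mem [OF yc, of 0]] by simp
    finally show ?thesis using hom [OF KD(8) [OF x yc]] by blast
  qed
  then show False using semiprime_abelian_ideal [OF semiprime K] nz by blast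
qed

end


text \<open>Applying P k to any decomposition extracts its term at k, which forces uniqueness; the
  projections themselves give existence. The conclusion has the shape of
  \<open>homogeneous_decomposition\<close>, so a grading can be obtained from projections
  alone.\<close>

lemma (in abelian_group) direct_sum_of_projections:
  assumes fin: "finite S"
    and sub: "\<And>k. C k \<subseteq> carrier G" 
    and mem: "\<And>k x. x \<in> carrier G \<Longrightarrow> P k x \<in> C k"
    and add: "\<And>k x y. \<lbrakk>x \<in> carrier G; y \<in> carrier G\<rbrakk> \<Longrightarrow> P k (x \<oplus> y) = P k x \<oplus> P k y"
    and hom: "\<And>j k x. x \<in> C k \<Longrightarrow> P j x = (if j = k then x else \<zero>)"
    and out: "\<And>k x. \<lbrakk>k \<notin> S; x \<in> carrier G\<rbrakk> \<Longrightarrow> P k x = \<zero>"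
    and sum: "\<And>x. x \<in> carrier G \<Longrightarrow> (\<Oplus>k\<in>S. P k x) = x"
    and x: "x \<in> carrier G"
  shows "\<exists>!c. (\<forall>k. c k \<in> C k) \<and> finite {k. c k \<noteq> \<zero>} \<and> x = (\<Oplus>k\<in>{k. c k \<noteq> \<zero>}. c k)"
proof (rule ex1I [of _ "\<lambda>k. P k x"])
  have cl: "P k y \<in> carrier G" if "y \<in> carrier G" for k y using mem sub that by blast
  have sub': "{k. P k x \<noteq> \<zero>} \<subseteq> S" using out x by blast
  have "(\<Oplus>k\<in>{k. P k x \<noteq> \<zero>}. P k x) = (\<Oplus>k\<in>S. P k x)"
    using fin sub' cl x by (intro add.finprod_mono_neutral_cong_left) auto
  then show "(\<forall>k. P k x \<in> C k) \<and> finite {k. P k x \<noteq> \<zero>} \<and> x = (\<Oplus>k\<in>{k. P k x \<noteq> \<zero>}. P k x)"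
    using mem x sum finite_subset [OF sub' fin] by simp
  fix c assume c: "(\<forall>k. c k \<in> C k) \<and> finite {k. c k \<noteq> \<zero>} \<and> x = (\<Oplus>k\<in>{k. c k \<noteq> \<zero>}. c k)"
  have cc: "c k \<in> carrier G" for k using c sub by blast
  have zero: "P k \<zero> = \<zero>" for k
    using add [of \<zero> \<zero> k] cl by simp
  have P_sum: "P k (\<Oplus>j\<in>T. c j) = (\<Oplus>j\<in>T. P k (c j))" if "finite T" for k T
    using that by (induction T rule: finite_induct) (use cc cl zero add in \<open>simp_all add: Pi_def\<close>)
  show "c = (\<lambda>k. P k x)"
  proof
    fix k
    \<comment> \<open>Inserting k guarantees a summand at k even if c k is zero.\<close>
    let ?T = "insert k {k. c k \<noteq> \<zero>}"
    have T: "finite ?T" using c by simp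
    have "x = (\<Oplus>j\<in>{k. c k \<noteq> \<zero>}. c j)" using c by simp
    also have "\<dots> = (\<Oplus>j\<in>?T. c j)"
      using T cc by (intro add.finprod_mono_neutral_cong_left) auto
    finally have "P k x = (\<Oplus>j\<in>?T. P k (c j))" using P_sum [OF T] by simp
    also have "\<dots> = (\<Oplus>j\<in>?T. if k = j then c j else \<zero>)"
      using hom c cc by (intro finsum_cong') auto
    also have "\<dots> = c k"
      using add.finprod_singleton [of k ?T c] T cc by simp
    finally show "c k = P k x" by simp
  qed
qed

section \<open>Homogeneous parts of derivations\<close>

context three_graded_lie begin

text \<open>The degree \<open>k\<close> part of \<open>d\<close> is \<open>\<Sum>\<^sub>j \<pi>\<^sub>k\<^sub>+\<^sub>j d \<pi>\<^sub>j\<close>. Only \<open>-2 \<le> k \<le> 2\<close> contribute, so every derivation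
  on a graded ideal is a graded one.\<close>

definition degree_part :: "int \<Rightarrow> 'c set \<Rightarrow> ('c \<Rightarrow> 'c) \<Rightarrow> 'c \<Rightarrow> 'c" where
  "degree_part k I d = (\<lambda>x\<in>I.
     comp (k - 1) (d (comp (-1) x)) \<oplus> comp k (d (comp 0 x)) \<oplus> comp (k + 1) (d (comp 1 x)))"

lemma graded_idealD:
  assumes "graded_ideal R L G I"
  shows "lie_ideal R L I" "\<And>x k. x \<in> I \<Longrightarrow> comp k x \<in> I"
  using assms by (auto simp: graded_ideal_def)

lemma degree_part_homogeneous:
  assumes I: "graded_ideal R L G I" and d: "d \<in> derivations R L I" and x: "x \<in> I" "x \<in> G j"
  shows "degree_part k I d x = comp (k + j) (d x)"
proof -
  have I': "lie_ideal R L I" using graded_idealD [OF I] by blast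
  have d0: "d \<zero> = \<zero>" using derivation_zero [OF d] lie_idealD(2) [OF I'] by simp
  have dx: "d x \<in> carrier L" using derivationD(1) [OF d] x by simp
  show ?thesis
  proof (cases "j \<in> {-1, 0, 1}")
    case True
    then have "j = -1 \<or> j = 0 \<or> j = 1" by auto
    then show ?thesis
      using x d0 dx by (elim disjE) (simp_all add: degree_part_def component_homogeneous [OF x(2)])
  next
    case False
    then have "x = \<zero>" using G_outside x by blast
    then show ?thesis using x d0 by (simp add: degree_part_def)
  qed
qed

text \<open>By additivity the Leibniz rule need only be checked for x and y homogeneous of degrees i
  and j. There it is the component of degree k + i + j of the Leibniz rule for d.\<close>

lemma degree_part_derivation:
  assumes I: "graded_ideal R L G I" and d: "d \<in> derivations R L I"
  shows "degree_part k I d \<in> derivations R L I"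
proof -
  have I': "lie_ideal R L I" and c: "\<And>x k. x \<in> I \<Longrightarrow> comp k x \<in> I"
    using graded_idealD [OF I] by auto
  note ID = lie_idealD [OF I'] and dD = derivationD [OF d]
  let ?D = "degree_part k I d"
  have cl: "?D x \<in> carrier L" if "x \<in> I" for x
    using that c dD(1) by (simp add: degree_part_def)
  have add: "?D (x \<oplus> y) = ?D x \<oplus> ?D y" if "x \<in> I" "y \<in> I" for x y
    using that c ID(3,4) dD(1,2) by (simp add: degree_part_def component_add M.a_ac)
  have smult: "?D (a \<odot> x) = a \<odot> ?D x" if "a \<in> carrier R" "x \<in> I" for a x
    using that c ID(3,6) dD(1,3) by (simp add: degree_part_def component_smult smult_r_distr)
  have br: "?D \<^bold>[x, y\<^bold>] = \<^bold>[?D x, y\<^bold>] \<oplus> \<^bold>[x, ?D y\<^bold>]" if x: "x \<in> I" and y: "y \<in> I" for x y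
    using I x
  proof (induction rule: graded_ideal_induct)
    case (homogeneous x i)
    show ?case
      using I y
    proof (induction rule: graded_ideal_induct)
      case (homogeneous y j)
      note x = \<open>x \<in> I\<close> \<open>x \<in> G i\<close> and y = homogeneous
      have cs: "x \<in> carrier L" "y \<in> carrier L" "d x \<in> carrier L" "d y \<in> carrier L"
        using x y ID dD by auto
      have xy: "\<^bold>[x, y\<^bold>] \<in> I" "\<^bold>[x, y\<^bold>] \<in> G (i + j)"
        using ID(8) x y cs bracket_degree by auto
      have "?D \<^bold>[x, y\<^bold>] = comp (k + i + j) (\<^bold>[d x, y\<^bold>] \<oplus> \<^bold>[x, d y\<^bold>])"
        using degree_part_homogeneous [OF I d xy] x y dD(4) by (simp add: add.assoc)
      also have "\<dots> = comp (k + i + j) \<^bold>[d x, y\<^bold>] \<oplus> comp (k + j + i) \<^bold>[x, d y\<^bold>]"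
        using cs by (simp add: component_add ac_simps)
      also have "\<dots> = \<^bold>[?D x, y\<^bold>] \<oplus> \<^bold>[x, ?D y\<^bold>]"
        using component_bracket_left [OF cs(3) y(2)] component_bracket_right [OF x(2) cs(4)]
          degree_part_homogeneous [OF I d x] degree_part_homogeneous [OF I d y] by simp
      finally show ?case .
    next
      case (add y z)
      have "?D \<^bold>[x, y \<oplus> z\<^bold>] = ?D \<^bold>[x, y\<^bold>] \<oplus> ?D \<^bold>[x, z\<^bold>]"
        using homogeneous add.hyps ID(3,8) \<open>\<And>x y. \<lbrakk>x \<in> I; y \<in> I\<rbrakk> \<Longrightarrow> ?D (x \<oplus> y) = ?D x \<oplus> ?D y\<close>
        by (simp add: bracket_add_right)
      then show ?case
        using homogeneous add ID(3) cl \<open>\<And>x y. \<lbrakk>x \<in> I; y \<in> I\<rbrakk> \<Longrightarrow> ?D (x \<oplus> y) = ?D x \<oplus> ?D y\<close>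
        by (simp add: bracket_add_right M.a_ac)
    qed
  next
    case (add x z)
    have "?D \<^bold>[x \<oplus> z, y\<^bold>] = ?D \<^bold>[x, y\<^bold>] \<oplus> ?D \<^bold>[z, y\<^bold>]"
      using y add.hyps ID(3,8) \<open>\<And>x y. \<lbrakk>x \<in> I; y \<in> I\<rbrakk> \<Longrightarrow> ?D (x \<oplus> y) = ?D x \<oplus> ?D y\<close>
      by (simp add: bracket_add_left)
    then show ?case
      using y add ID(3) cl \<open>\<And>x y. \<lbrakk>x \<in> I; y \<in> I\<rbrakk> \<Longrightarrow> ?D (x \<oplus> y) = ?D x \<oplus> ?D y\<close>
      by (simp add: bracket_add_left M.a_ac)
  qed
  have "?D \<in> I \<rightarrow>\<^sub>E carrier L"
    using cl by (auto simp: degree_part_def)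
  then show ?thesis
    using add smult br by (simp add: derivations_def)
qed

lemma degree_part_degree:
  assumes I: "graded_ideal R L G I" and d: "d \<in> derivations R L I"
  shows "degree_part k I d \<in> derivations_of_degree R L G k I"
  using degree_part_derivation [OF I d] degree_part_homogeneous [OF I d] derivationD(1) [OF d]
    component_mem
  by (auto simp: derivations_of_degree_def add.commute)

lemma derivation_eqI:
  assumes I: "graded_ideal R L G I" and d: "d \<in> derivations R L I" and m: "m \<in> derivations R L I"
    and eq: "\<And>x j. \<lbrakk>x \<in> I; x \<in> G j\<rbrakk> \<Longrightarrow> d x = m x"
  shows "d = m"
proof (rule extensionalityI)
  show "d \<in> extensional I" "m \<in> extensional I"
    using d m by (auto simp: derivations_def PiE_def)
  fix x assume "x \<in> I"
  with I show "d x = m x"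
    by (induction rule: graded_ideal_induct) (use eq derivationD(2) [OF d] derivationD(2) [OF m] in auto)
qed

lemma degree_part_of_degree:
  assumes I: "graded_ideal R L G I" and d: "d \<in> derivations_of_degree R L G k I"
  shows "degree_part j I d = (if j = k then d else (\<lambda>x\<in>I. \<zero>))"
proof -
  have d': "d \<in> derivations R L I" and deg: "\<And>i x. \<lbrakk>x \<in> I; x \<in> G i\<rbrakk> \<Longrightarrow> d x \<in> G (i + k)"
    using d by (auto simp: derivations_of_degree_def)
  have hom: "degree_part j I d x = (if j = k then d x else \<zero>)" if "x \<in> I" "x \<in> G i" for x i
    using degree_part_homogeneous [OF I d' that] component_homogeneous [OF deg [OF that]] by auto
  note D = degree_part_derivation [OF I d']
  have Z: "(\<lambda>x\<in>I. \<zero>) \<in> derivations R L I"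
    using derivation_const_zero graded_idealD(1) [OF I] by blast
  show ?thesis
  proof (cases "j = k")
    case True
    then show ?thesis using derivation_eqI [OF I D d'] hom by simp
  next
    case False
    then show ?thesis using derivation_eqI [OF I D Z] hom by simp
  qed
qed

lemma degree_part_outside:
  assumes I: "graded_ideal R L G I" and d: "d \<in> derivations R L I" and k: "k \<notin> {-2..2}"
  shows "degree_part k I d = (\<lambda>x\<in>I. \<zero>)"
  using graded_idealD(2) [OF I] derivationD(1) [OF d] k
  by (auto simp: degree_part_def component_outside intro!: restrict_ext)

lemma degree_part_sum:
  assumes I: "graded_ideal R L G I" and d: "d \<in> derivations R L I" and x: "x \<in> I"
  shows "(\<Oplus>k\<in>{-2..2}. degree_part k I d x) = d x"
  using I x
proof (induction rule: graded_ideal_induct)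
  case (homogeneous x j)
  have dx: "d x \<in> carrier L" using derivationD(1) [OF d] homogeneous by simp
  have S: "{-2..2} = {-2, -1, 0, 1, 2::int}" by auto
  have "(\<Oplus>k\<in>{-2..2}. comp (k + j) (d x)) = d x"
  proof (cases "j \<in> {-1, 0, 1}")
    case True
    then have "j = -1 \<or> j = 0 \<or> j = 1" by auto
    then show ?thesis
      using component_sum_three [OF dx, of 1] dx unfolding S
      by (elim disjE) (simp_all add: M.finsum_insert component_outside M.a_ac)
  next
    case False
    then have "x = \<zero>" using G_outside homogeneous by blast
    then have "d x = \<zero>"
      using derivation_zero [OF d] homogeneous by simp
    then show ?thesis by simp
  qed
  then show ?case
    using degree_part_homogeneous [OF I d homogeneous] by simp
next
  case (add x y)
  have "degree_part k I d z \<in> carrier L" if "z \<in> I" for k z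
    using derivationD(1) [OF degree_part_derivation [OF I d]] that by blast
  then show ?case
    using add derivationD(2) [OF d] derivationD(2) [OF degree_part_derivation [OF I d]]
    by (simp add: M.finsum_addf Pi_def)
qed

lemma graded_derivations_eq:
  assumes I: "graded_ideal R L G I"
  shows "graded_derivations R L G I = derivations R L I"
proof -
  have "d \<in> graded_derivations R L G I" if d: "d \<in> derivations R L I" for d
    unfolding graded_derivations_def using d degree_part_degree [OF I d] degree_part_sum [OF I d]
    by (auto intro!: exI [of _ "{-2..2}"] exI [of _ "\<lambda>k. degree_part k I d"])
  then show ?thesis by (auto simp: graded_derivations_def)
qed

end

section \<open>Essential and graded essential ideals\<close>

context semiprime_three_graded_lie begin

lemma essential_ideal_nonzero:
  assumes "essential_ideal R L I" "lie_ideal R L J" "J \<noteq> {\<zero>}"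
  obtains x where "x \<in> I" "x \<in> J" "x \<noteq> \<zero>"
  using assms lie_idealD(2) unfolding essential_ideal_def by blast

lemma essential_idealI:
  assumes "lie_ideal R L I"
    "\<And>J. \<lbrakk>lie_ideal R L J; J \<noteq> {\<zero>}\<rbrakk> \<Longrightarrow> \<exists>x\<in>I \<inter> J. x \<noteq> \<zero>"
  shows "essential_ideal R L I"
  using assms unfolding essential_ideal_def by blast

text \<open>A nonzero ideal J that is not graded is met through its graded core, which is nonzero
  because J contains a nonzero homogeneous element.\<close>

lemma graded_essential_ideal_iff:
  "graded_essential_ideal R L G I \<longleftrightarrow> graded_ideal R L G I \<and> essential_ideal R L I"
proof
  assume I: "graded_essential_ideal R L G I"
  then have gr: "graded_ideal R L G I" by (simp add: graded_essential_ideal_def)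
  have "essential_ideal R L I"
  proof (rule essential_idealI)
    show I': "lie_ideal R L I" using graded_idealD(1) [OF gr] .
    fix J assume J: "lie_ideal R L J" "J \<noteq> {\<zero>}"
    then obtain k x where x: "x \<in> J" "x \<in> G k" "x \<noteq> \<zero>" by (rule nonzero_ideal_homogeneous)
    then have "graded_core J \<noteq> {\<zero>}" using homogeneous_in_graded_core [OF J(1)] by blast
    then have "I \<inter> graded_core J \<noteq> {\<zero>}"
      using I graded_ideal_graded_core [OF J(1)] by (simp add: graded_essential_ideal_def)
    moreover have "\<zero> \<in> I \<inter> graded_core J"
      using lie_idealD(2) [OF I'] lie_idealD(2) [OF graded_idealD(1) [OF graded_ideal_graded_core [OF J(1)]]]
      by simp
    ultimately show "\<exists>x\<in>I \<inter> J. x \<noteq> \<zero>"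
      using graded_core_subset [OF J(1)] by blast
  qed
  with gr show "graded_ideal R L G I \<and> essential_ideal R L I" by simp
next
  assume "graded_ideal R L G I \<and> essential_ideal R L I"
  then show "graded_essential_ideal R L G I"
    by (auto simp: graded_essential_ideal_def essential_ideal_def graded_ideal_def)
qed

lemma essential_ideal_carrier: "essential_ideal R L (carrier L)"
proof (rule essential_idealI [OF lie_ideal_carrier])
  fix J assume J: "lie_ideal R L J" "J \<noteq> {\<zero>}"
  then show "\<exists>x\<in>carrier L \<inter> J. x \<noteq> \<zero>"
    using lie_idealD(1,2) [OF J(1)] by blast
qed

lemma essential_ideal_inter:
  assumes I: "essential_ideal R L I" and J: "essential_ideal R L J"
  shows "essential_ideal R L (I \<inter> J)"
proof (rule essential_idealI)
  have I': "lie_ideal R L I" and J': "lie_ideal R L J"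
    using I J by (auto simp: essential_ideal_def)
  then show "lie_ideal R L (I \<inter> J)" by (rule lie_ideal_inter)
  fix K assume K: "lie_ideal R L K" "K \<noteq> {\<zero>}"
  then have "J \<inter> K \<noteq> {\<zero>}" using J by (simp add: essential_ideal_def)
  then obtain x where "x \<in> I" "x \<in> J \<inter> K" "x \<noteq> \<zero>"
    using essential_ideal_nonzero [OF I lie_ideal_inter [OF J' K(1)]] by blast
  then show "\<exists>x\<in>I \<inter> J \<inter> K. x \<noteq> \<zero>" by blast
qed

text \<open>Semiprimeness is applied to the nonzero ideal formed by I and K together, their
  intersection: its square is nonzero and lies both in [I, I] and in K.\<close>

lemma essential_ideal_bracket_span:
  assumes I: "essential_ideal R L I"
  shows "essential_ideal R L (bracket_span R L I I)"
proof (rule essential_idealI)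
  have I': "lie_ideal R L I" using I by (auto simp: essential_ideal_def)
  then show "lie_ideal R L (bracket_span R L I I)" by (intro lie_ideal_bracket_span)
  fix K assume K: "lie_ideal R L K" "K \<noteq> {\<zero>}"
  have IK: "lie_ideal R L (I \<inter> K)" using lie_ideal_inter I' K by blast
  let ?S = "bracket_span R L (I \<inter> K) (I \<inter> K)"
  have "I \<inter> K \<noteq> {\<zero>}" using I K by (simp add: essential_ideal_def)
  then have "?S \<noteq> {\<zero>}" using semiprime IK by (simp add: semiprime_def)
  moreover have "\<zero> \<in> ?S" using lie_idealD(2) lie_ideal_bracket_span IK by blast
  moreover have "?S \<subseteq> bracket_span R L I I" by (rule bracket_span_mono) auto
  moreover have "?S \<subseteq> K" using bracket_span_subset [OF IK] by blast
  ultimately show "\<exists>x\<in>bracket_span R L I I \<inter> K. x \<noteq> \<zero>" by blast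
qed

lemma graded_essential_graded_core:
  assumes I: "essential_ideal R L I"
  shows "graded_essential_ideal R L G (graded_core I)"
proof -
  have I': "lie_ideal R L I" using I by (simp add: essential_ideal_def)
  note gr = graded_ideal_graded_core [OF I']
  have "essential_ideal R L (graded_core I)"
  proof (rule essential_idealI)
    show "lie_ideal R L (graded_core I)" using graded_idealD(1) [OF gr] .
    fix J assume J: "lie_ideal R L J" "J \<noteq> {\<zero>}"
    then have "I \<inter> J \<noteq> {\<zero>}" using I by (simp add: essential_ideal_def)
    then obtain k x where x: "x \<in> I \<inter> J" "x \<in> G k" "x \<noteq> \<zero>"
      using nonzero_ideal_homogeneous [OF lie_ideal_inter [OF I' J(1)]] by blast
    then show "\<exists>x\<in>graded_core I \<inter> J. x \<noteq> \<zero>"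
      using homogeneous_in_graded_core [OF I'] by blast
  qed
  then show ?thesis using gr by (simp add: graded_essential_ideal_iff)
qed

text \<open>The annihilator of K is an ideal whose intersection with K is abelian, hence zero by
  semiprimeness, and K is essential. This yields injectivity of the embedding of L.\<close>

lemma essential_annihilator:
  assumes K: "essential_ideal R L K" and v: "v \<in> carrier L" and z: "\<And>y. y \<in> K \<Longrightarrow> \<^bold>[v, y\<^bold>] = \<zero>"
  shows "v = \<zero>"
proof -
  have K': "lie_ideal R L K" using K by (simp add: essential_ideal_def)
  note KD = lie_idealD [OF K']
  let ?A = "{v \<in> carrier L. \<forall>y\<in>K. \<^bold>[v, y\<^bold>] = \<zero>}"
  have A: "lie_ideal R L ?A"
  proof (rule lie_idealI)
    show "\<^bold>[x, v\<^bold>] \<in> ?A" if x: "x \<in> carrier L" and v: "v \<in> ?A" for x v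
    proof -
      have "\<^bold>[\<^bold>[x, v\<^bold>], y\<^bold>] = \<zero>" if y: "y \<in> K" for y
        using leibniz_left [of x v y] x v y KD(3,7,8) bracket_eq_zero_commute [of v "\<^bold>[x, y\<^bold>]"]
          bracket_eq_zero_commute [of "\<^bold>[x, y\<^bold>]" v] by simp
      then show ?thesis using x v by simp
    qed
  qed (use KD in \<open>auto simp: bracket_add_left bracket_smult_left\<close>)
  have "K \<inter> ?A = {\<zero>}"
    by (rule semiprime_abelian_ideal [OF semiprime lie_ideal_inter [OF K' A]]) auto
  then have "?A = {\<zero>}" using K A by (auto simp: essential_ideal_def)
  then show ?thesis using v z by blast
qed

end


section \<open>The grading of the maximal algebra of quotients\<close>

text \<open>The two claims share one induction, since adding a further class requires the partial
  sum to be a derivation.\<close>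

lemma (in lie_ideal_filter) finsum_cls:
  assumes I: "I \<in> E" and e: "\<And>k. k \<in> S \<Longrightarrow> e k \<in> Der I" and S: "finite S"
  shows "(\<Oplus>\<^bsub>Q\<^esub>k\<in>S. cls I (e k)) = cls I (\<lambda>x\<in>I. \<Oplus>k\<in>S. e k x)"
    and "(\<lambda>x\<in>I. \<Oplus>k\<in>S. e k x) \<in> Der I"
proof -
  interpret Q: abelian_group Q by (rule abelian_group_Q)
  have "(\<Oplus>\<^bsub>Q\<^esub>k\<in>S. cls I (e k)) = cls I (\<lambda>x\<in>I. \<Oplus>k\<in>S. e k x) \<and> (\<lambda>x\<in>I. \<Oplus>k\<in>S. e k x) \<in> Der I"
    using S e
  proof (induction S rule: finite_induct)
    case empty
    show ?case
      unfolding Q.finsum_empty M.finsum_empty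
      using zero_Q_on [OF I] derivation_const_zero [OF ideal [OF I]] by blast
  next
    case (insert j S)
    let ?s = "\<lambda>x\<in>I. \<Oplus>k\<in>S. e k x"
    have IH: "(\<Oplus>\<^bsub>Q\<^esub>k\<in>S. cls I (e k)) = cls I ?s" "?s \<in> Der I"
      using insert.IH insert.prems by blast+
    have ec: "e k x \<in> carrier L" if "k \<in> insert j S" "x \<in> I" for k x
      using insert.prems derivationD(1) that by blast+
    have eq: "(\<lambda>x\<in>I. e j x \<oplus> ?s x) = (\<lambda>x\<in>I. \<Oplus>k\<in>insert j S. e k x)"
      using insert.hyps ec by (intro restrict_ext) (simp add: Pi_def)
    have "(\<Oplus>\<^bsub>Q\<^esub>k\<in>insert j S. cls I (e k)) = cls I (e j) \<oplus>\<^bsub>Q\<^esub> cls I ?s"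
      using insert cls_closed [OF I] IH by (simp add: Pi_def)
    also have "\<dots> = cls I (\<lambda>x\<in>I. \<Oplus>k\<in>insert j S. e k x)"
      using add_cls_same [OF I _ IH(2), of "e j"] insert.prems unfolding eq by blast
    finally have "(\<Oplus>\<^bsub>Q\<^esub>k\<in>insert j S. cls I (e k)) = cls I (\<lambda>x\<in>I. \<Oplus>k\<in>insert j S. e k x)" .
    moreover have "(\<lambda>x\<in>I. \<Oplus>k\<in>insert j S. e k x) \<in> Der I"
      using derivation_add [OF _ IH(2) ideal [OF I], of "e j"] insert.prems unfolding eq by blast
    ultimately show ?case by blast
  qed
  then show "(\<Oplus>\<^bsub>Q\<^esub>k\<in>S. cls I (e k)) = cls I (\<lambda>x\<in>I. \<Oplus>k\<in>S. e k x)"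
    "(\<lambda>x\<in>I. \<Oplus>k\<in>S. e k x) \<in> Der I" by auto
qed

sublocale semiprime_three_graded_lie \<subseteq> ess: lie_ideal_filter R L "{I. essential_ideal R L I}"
  by unfold_locales
    (use essential_ideal_carrier essential_ideal_inter essential_ideal_bracket_span in
      \<open>auto simp: essential_ideal_def\<close>)

text \<open>This instance admits all derivations on graded essential ideals;
  \<open>partial_derivations_graded\<close> below identifies it with the limit of the graded
  ones.\<close>

sublocale semiprime_three_graded_lie \<subseteq> gr: lie_ideal_filter R L "{I. graded_essential_ideal R L G I}"
proof
  have "graded_ideal R L G (I \<inter> J)" if "graded_ideal R L G I" "graded_ideal R L G J" for I J
    using that lie_ideal_inter by (auto simp: graded_ideal_def)
  then show "I \<inter> J \<in> {I. graded_essential_ideal R L G I}"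
    if "I \<in> {I. graded_essential_ideal R L G I}" "J \<in> {I. graded_essential_ideal R L G I}" for I J
    using that essential_ideal_inter by (simp add: graded_essential_ideal_iff)
  show "carrier L \<in> {I. graded_essential_ideal R L G I}"
    using lie_ideal_carrier essential_ideal_carrier
    by (simp add: graded_essential_ideal_iff graded_ideal_def)
qed (use essential_ideal_bracket_span graded_ideal_bracket_span in
    \<open>auto simp: graded_essential_ideal_iff essential_ideal_def\<close>)

context semiprime_three_graded_lie begin

abbreviation GE :: "'c set \<Rightarrow> bool" where "GE \<equiv> graded_essential_ideal R L G"
abbreviation Der :: "'c set \<Rightarrow> ('c \<Rightarrow> 'c) set" where "Der \<equiv> derivations R L"
abbreviation Der_deg :: "int \<Rightarrow> 'c set \<Rightarrow> ('c \<Rightarrow> 'c) set" where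
  "Der_deg \<equiv> derivations_of_degree R L G"

lemma GE_D: "GE I \<Longrightarrow> essential_ideal R L I" "GE I \<Longrightarrow> graded_ideal R L G I" "GE I \<Longrightarrow> lie_ideal R L I"
  by (auto simp: graded_essential_ideal_iff graded_ideal_def)

lemma Q_m_eq: "Q_m R L = ess.Q"
  by (simp add: Q_m_def ess.Q_def)

lemma partial_derivations_graded:
  "partial_derivations {I. GE I} (graded_derivations R L G) = partial_derivations {I. GE I} Der"
  using graded_derivations_eq GE_D(2) by (auto simp: partial_derivations_def)

lemma limit_rel_graded: "limit_rel {I. GE I} (graded_derivations R L G) = limit_rel {I. GE I} Der"
  by (simp add: limit_rel_def partial_derivations_graded)

lemma limit_class_graded: "limit_class {I. GE I} (graded_derivations R L G) = gr.cls"
  by (simp add: limit_class_def fun_eq_iff limit_rel_graded)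

lemma Q_gr_m_eq: "Q_gr_m R L G = gr.Q"
  by (simp add: Q_gr_m_def gr.Q_def limit_algebra_def partial_derivations_graded limit_rel_graded
      limit_class_graded)

section \<open>Comparison with the graded limit, and projections onto the degrees\<close>

definition to_graded :: "('c set \<times> ('c \<Rightarrow> 'c)) set \<Rightarrow> ('c set \<times> ('c \<Rightarrow> 'c)) set" where
  "to_graded X = {p \<in> X. GE (fst p)}"

text \<open>Maps that agree on an essential ideal agree on its graded core, which is graded
  essential. So the representatives kept by \<open>to_graded\<close> form one full class of the
  graded limit.\<close>

lemma to_graded_cls:
  assumes I: "GE I" and d: "d \<in> Der I"
  shows "to_graded (ess.cls I d) = gr.cls I d"
proof -
  have "(J, m) \<in> to_graded (ess.cls I d) \<longleftrightarrow> (J, m) \<in> gr.cls I d" for J m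
  proof
    assume "(J, m) \<in> to_graded (ess.cls I d)"
    then obtain K where "GE J" "m \<in> Der J" "essential_ideal R L K" "K \<subseteq> I \<inter> J" "\<forall>x\<in>K. d x = m x"
      using I d GE_D by (auto simp: to_graded_def ess.mem_cls_iff)
    then show "(J, m) \<in> gr.cls I d"
      using I d graded_essential_graded_core [of K] graded_core_subset [of K]
      by (subst gr.mem_cls_iff) (auto simp: essential_ideal_def intro!: exI [of _ "graded_core K"])
  next
    assume "(J, m) \<in> gr.cls I d"
    then show "(J, m) \<in> to_graded (ess.cls I d)"
      using I d GE_D by (auto simp: to_graded_def ess.mem_cls_iff gr.mem_cls_iff)
  qed
  then show ?thesis by auto
qed

lemma ess_cls_eq_iff:
  assumes "GE I" "d \<in> Der I" "GE J" "m \<in> Der J"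
  shows "ess.cls I d = ess.cls J m \<longleftrightarrow> (\<exists>K. GE K \<and> K \<subseteq> I \<inter> J \<and> (\<forall>x\<in>K. d x = m x))"
proof
  assume "ess.cls I d = ess.cls J m"
  then obtain K where "essential_ideal R L K" "K \<subseteq> I \<inter> J" "\<forall>x\<in>K. d x = m x"
    using assms GE_D by (auto simp: ess.cls_eq_iff)
  then show "\<exists>K. GE K \<and> K \<subseteq> I \<inter> J \<and> (\<forall>x\<in>K. d x = m x)"
    using graded_essential_graded_core [of K] graded_core_subset [of K]
    by (intro exI [of _ "graded_core K"]) (auto simp: essential_ideal_def)
qed (use assms GE_D in \<open>auto simp: ess.cls_eq_iff\<close>)

lemma ess_carrierE:
  assumes "X \<in> carrier ess.Q"
  obtains I d where "GE I" "d \<in> Der I" "X = ess.cls I d"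
proof -
  obtain I d where I: "essential_ideal R L I" and d: "d \<in> Der I" and X: "X = ess.cls I d"
    using assms by (auto simp: ess.carrier_Q)
  have I': "lie_ideal R L I" using I by (simp add: essential_ideal_def)
  note c = graded_essential_graded_core [OF I] graded_core_subset [OF I']
  show ?thesis
    using that [OF c(1) derivation_restrict [OF d GE_D(3) [OF c(1)] c(2)]]
      ess.cls_restrict [OF _ d _ c(2)] I X GE_D(1) [OF c(1)] by simp
qed

lemma ess_carrier2E:
  assumes "X \<in> carrier ess.Q" "Y \<in> carrier ess.Q"
  obtains I d m where "GE I" "d \<in> Der I" "m \<in> Der I" "X = ess.cls I d" "Y = ess.cls I m"
proof -
  obtain I d J m where *: "GE I" "d \<in> Der I" "X = ess.cls I d" "GE J" "m \<in> Der J" "Y = ess.cls J m"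
    using assms by (metis ess_carrierE)
  have K: "GE (I \<inter> J)" using gr.inter_mem * by simp
  show ?thesis
  proof (rule that [OF K])
    show "restrict d (I \<inter> J) \<in> Der (I \<inter> J)" "restrict m (I \<inter> J) \<in> Der (I \<inter> J)"
      using * GE_D(3) [OF K] derivation_restrict by auto
    show "X = ess.cls (I \<inter> J) (restrict d (I \<inter> J))" "Y = ess.cls (I \<inter> J) (restrict m (I \<inter> J))"
      using ess.cls_restrict [OF _ *(2) _ Int_lower1, of J] ess.cls_restrict [OF _ *(5) _ Int_lower2, of I]
        * K GE_D(1) by auto
  qed
qed

lemma Der_deg_restrict:
  assumes "d \<in> Der_deg k I" "lie_ideal R L J" "J \<subseteq> I"
  shows "restrict d J \<in> Der_deg k J"
  using assms derivation_restrict [of d I J] by (auto simp: derivations_of_degree_def)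

lemma Der_degD:
  assumes "d \<in> Der_deg k I"
  shows "d \<in> Der I" "\<And>x j. \<lbrakk>x \<in> I; x \<in> G j\<rbrakk> \<Longrightarrow> d x \<in> G (j + k)"
  using assms by (auto simp: derivations_of_degree_def)

text \<open>This is the grading of the graded limit, carried back along
  \<open>to_graded\<close>.\<close>

definition H :: "int \<Rightarrow> ('c set \<times> ('c \<Rightarrow> 'c)) set set" where
  "H k = {ess.cls I d | I d. GE I \<and> d \<in> Der_deg k I}"

lemma H_2E:
  assumes "X \<in> H k" "Y \<in> H l"
  obtains I d m where "GE I" "d \<in> Der_deg k I" "m \<in> Der_deg l I" "X = ess.cls I d" "Y = ess.cls I m"
proof -
  obtain I d J m where *: "GE I" "d \<in> Der_deg k I" "X = ess.cls I d" "GE J" "m \<in> Der_deg l J" "Y = ess.cls J m"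
    using assms by (auto simp: H_def)
  have K: "GE (I \<inter> J)" using gr.inter_mem * by simp
  show ?thesis
  proof (rule that [OF K])
    show "restrict d (I \<inter> J) \<in> Der_deg k (I \<inter> J)" "restrict m (I \<inter> J) \<in> Der_deg l (I \<inter> J)"
      using * GE_D(3) [OF K] Der_deg_restrict by auto
    show "X = ess.cls (I \<inter> J) (restrict d (I \<inter> J))" "Y = ess.cls (I \<inter> J) (restrict m (I \<inter> J))"
      using ess.cls_restrict [OF _ Der_degD(1) [OF *(2)] _ Int_lower1, of J]
        ess.cls_restrict [OF _ Der_degD(1) [OF *(5)] _ Int_lower2, of I] * K GE_D(1) by auto
  qed
qed

lemma H_subset: "H k \<subseteq> carrier ess.Q"
  using GE_D(1) Der_degD(1) by (auto simp: H_def intro!: ess.cls_closed)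

text \<open>The chosen representative must live on a graded ideal, because only there do the
  components of an argument stay in the domain of the map. Independence of the choice is
  \<open>proj_cls\<close>.\<close>

definition proj :: "int \<Rightarrow> ('c set \<times> ('c \<Rightarrow> 'c)) set \<Rightarrow> ('c set \<times> ('c \<Rightarrow> 'c)) set" where
  "proj k X = (let p = (SOME p. GE (fst p) \<and> snd p \<in> Der (fst p) \<and> X = ess.cls (fst p) (snd p))
    in ess.cls (fst p) (degree_part k (fst p) (snd p)))"

lemma proj_cls:
  assumes I: "GE I" and d: "d \<in> Der I"
  shows "proj k (ess.cls I d) = ess.cls I (degree_part k I d)"
proof -
  define p where "p = (SOME p. GE (fst p) \<and> snd p \<in> Der (fst p) \<and> ess.cls I d = ess.cls (fst p) (snd p))"
  have "\<exists>p. GE (fst p) \<and> snd p \<in> Der (fst p) \<and> ess.cls I d = ess.cls (fst p) (snd p)"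
    using I d by (intro exI [of _ "(I, d)"]) simp
  from someI_ex [OF this] have p: "GE (fst p)" "snd p \<in> Der (fst p)" "ess.cls I d = ess.cls (fst p) (snd p)"
    unfolding p_def by blast+
  then obtain K where K: "GE K" "K \<subseteq> I \<inter> fst p" "\<forall>x\<in>K. d x = snd p x"
    using I d by (auto simp: ess_cls_eq_iff)
  \<comment> \<open>K is graded, so the components of x lie in K as well, where the two
    representatives agree.\<close>
  have "\<forall>x\<in>K. degree_part k (fst p) (snd p) x = degree_part k I d x"
    using K graded_idealD(2) [OF GE_D(2) [OF K(1)]] by (auto simp: degree_part_def)
  then have "ess.cls (fst p) (degree_part k (fst p) (snd p)) = ess.cls I (degree_part k I d)"
    using p I d K degree_part_derivation [OF GE_D(2)]
    by (subst ess_cls_eq_iff) (auto intro!: exI [of _ K])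
  then show ?thesis by (simp add: proj_def p_def)
qed

lemma graded_lie_algebra_Q: "graded_lie_algebra R ess.Q H"
proof -
  interpret Q: lie_algebra R ess.Q by (rule ess.lie_algebra_Q)
  have mem: "proj k X \<in> H k" if mem_Q: "X \<in> carrier ess.Q" for k X
  proof -
    obtain I d where I: "GE I" and d: "d \<in> Der I" and X: "X = ess.cls I d"
      using mem_Q by (rule ess_carrierE)
    show ?thesis
      unfolding H_def X proj_cls [OF I d] using I degree_part_degree [OF GE_D(2) [OF I] d] by blast
  qed
  have add: "proj k (X \<oplus>\<^bsub>ess.Q\<^esub> Y) = proj k X \<oplus>\<^bsub>ess.Q\<^esub> proj k Y"
    if mem_Q: "X \<in> carrier ess.Q" "Y \<in> carrier ess.Q" for k X Y
  proof -
    obtain I d m where I: "GE I" and d: "d \<in> Der I" and m: "m \<in> Der I"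
      and eq: "X = ess.cls I d" "Y = ess.cls I m"
      using mem_Q by (rule ess_carrier2E)
    note I' = GE_D [OF I] and s = derivation_add [OF d m GE_D(3) [OF I]]
    have "degree_part k I (\<lambda>x\<in>I. d x \<oplus> m x) = (\<lambda>x\<in>I. degree_part k I d x \<oplus> degree_part k I m x)"
      using graded_idealD(2) [OF I'(2)] derivationD(1) [OF d] derivationD(1) [OF m]
      unfolding degree_part_def by (intro restrict_ext) (simp add: component_add M.a_ac)
    then show ?thesis
      using I I' d m s degree_part_derivation [OF I'(2)]
      by (simp add: eq ess.add_cls_same proj_cls)
  qed
  have hom: "proj j X = (if j = k then X else \<zero>\<^bsub>ess.Q\<^esub>)" if "X \<in> H k" for j k X
  proof -
    obtain I d where I: "GE I" and d: "d \<in> Der_deg k I" and X: "X = ess.cls I d"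
      using \<open>X \<in> H k\<close> by (auto simp: H_def)
    show ?thesis
      using I GE_D [OF I] Der_degD(1) [OF d] degree_part_of_degree [OF _ d, of j]
      by (simp add: X proj_cls ess.zero_Q_on)
  qed
  have out: "proj k X = \<zero>\<^bsub>ess.Q\<^esub>" if k: "k \<notin> {-2..2}" and mem_Q: "X \<in> carrier ess.Q" for k X
  proof -
    obtain I d where I: "GE I" and d: "d \<in> Der I" and X: "X = ess.cls I d"
      using mem_Q by (rule ess_carrierE)
    show ?thesis
      using I GE_D [OF I] d degree_part_outside [OF _ d k]
      by (simp add: X proj_cls ess.zero_Q_on)
  qed
  have sum: "(\<Oplus>\<^bsub>ess.Q\<^esub>k\<in>{-2..2}. proj k X) = X" if mem_Q: "X \<in> carrier ess.Q" for X
  proof -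
    obtain I d where I: "GE I" and d: "d \<in> Der I" and X: "X = ess.cls I d"
      using mem_Q by (rule ess_carrierE)
    have "(\<Oplus>\<^bsub>ess.Q\<^esub>k\<in>{-2..2}. proj k X) = ess.cls I (\<lambda>x\<in>I. \<Oplus>k\<in>{-2..2}. degree_part k I d x)"
      using ess.finsum_cls(1) [of I "{-2..2}" "\<lambda>k. degree_part k I d"] GE_D [OF I]
        degree_part_derivation [OF _ d] by (simp add: X proj_cls [OF I d])
    also have "(\<lambda>x\<in>I. \<Oplus>k\<in>{-2..2}. degree_part k I d x) = restrict d I"
      using degree_part_sum [OF GE_D(2) [OF I] d] by (intro restrict_ext) simp
    also have "restrict d I = d"
      using d by (auto simp: derivations_def extensional_restrict PiE_def)
    finally show ?thesis by (simp add: X)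
  qed
  show ?thesis
  proof (intro graded_lie_algebra.intro graded_lie_algebra_axioms.intro ess.lie_algebra_Q)
    interpret lQ: lie R ess.Q by unfold_locales
    show "submodule (H k) R ess.Q" for k
    proof (rule lQ.submoduleI_smult [OF H_subset])
      show "\<zero>\<^bsub>ess.Q\<^esub> \<in> H k"
      proof -
        have "(\<lambda>x\<in>carrier L. \<zero>) \<in> Der_deg k (carrier L)"
          using derivation_const_zero [OF lie_ideal_carrier] by (auto simp: derivations_of_degree_def)
        then show ?thesis using gr.carrier_mem by (auto simp: H_def ess.zero_Q)
      qed
      fix X Y assume "X \<in> H k" "Y \<in> H k"
      then obtain I d m where I: "GE I" and d: "d \<in> Der_deg k I" and m: "m \<in> Der_deg k I"
        and eq: "X = ess.cls I d" "Y = ess.cls I m"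
        by (rule H_2E)
      note dD = Der_degD [OF d] and mD = Der_degD [OF m]
      have "(\<lambda>x\<in>I. d x \<oplus> m x) \<in> Der_deg k I"
        using derivation_add [OF dD(1) mD(1) GE_D(3) [OF I]] dD(2) mD(2)
          submoduleE(5) [OF component_submodule] by (simp add: derivations_of_degree_def)
      then show "X \<oplus>\<^bsub>ess.Q\<^esub> Y \<in> H k"
        using I GE_D(1) [OF I] dD(1) mD(1) by (auto simp: eq ess.add_cls_same H_def)
    next
      fix a X assume a: "a \<in> carrier R" and "X \<in> H k"
      then obtain I d where I: "GE I" and d: "d \<in> Der_deg k I" and X: "X = ess.cls I d"
        by (auto simp: H_def)
      note dD = Der_degD [OF d]
      have "(\<lambda>x\<in>I. a \<odot> d x) \<in> Der_deg k I"
        using derivation_smult [OF dD(1) a GE_D(3) [OF I]] dD(2) a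
          submoduleE(4) [OF component_submodule] by (simp add: derivations_of_degree_def)
      then show "a \<odot>\<^bsub>ess.Q\<^esub> X \<in> H k"
        using I GE_D(1) [OF I] dD(1) a by (auto simp: X ess.smult_cls H_def)
    qed
    show "\<exists>!c. homogeneous_decomposition ess.Q H X c" if "X \<in> carrier ess.Q" for X
      unfolding homogeneous_decomposition_def
      by (rule Q.M.direct_sum_of_projections [of "{-2..2}" H proj])
        (use H_subset mem add hom out sum that in auto)
    show "\<^bold>[X, Y\<^bold>]\<^bsub>ess.Q\<^esub> \<in> H (i + j)" if mem_H: "X \<in> H i" "Y \<in> H j" for X Y i j
    proof -
      obtain I d m where I: "GE I" and d: "d \<in> Der_deg i I" and m: "m \<in> Der_deg j I"
        and eq: "X = ess.cls I d" "Y = ess.cls I m"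
        using mem_H by (rule H_2E)
      let ?J = "bracket_span R L I I"
      note dD = Der_degD [OF d] and mD = Der_degD [OF m] and I' = GE_D [OF I]
      have J: "GE ?J" using gr.span_mem I by simp
      have I_ess: "I \<in> {I. essential_ideal R L I}" using I' by simp
      note br = ess.bracket_cls_same [OF I_ess dD(1) mD(1)]
      have into: "d x \<in> I" "m x \<in> I" "x \<in> I" if "x \<in> ?J" for x
        using derivation_bracket_span [OF _ I'(3) order_refl that] dD(1) mD(1)
          bracket_span_subset [OF I'(3)] that by auto
      have "d (m x) \<ominus> m (d x) \<in> G (k + (i + j))" if x: "x \<in> ?J" and xk: "x \<in> G k" for x k
      proof (rule submodule_diff [OF component_submodule])
        show "d (m x) \<in> G (k + (i + j))"
          using dD(2) [OF into(2) [OF x] mD(2) [OF into(3) [OF x] xk]] by (simp add: ac_simps)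
        show "m (d x) \<in> G (k + (i + j))"
          using mD(2) [OF into(1) [OF x] dD(2) [OF into(3) [OF x] xk]] by (simp add: ac_simps)
      qed
      then have "(\<lambda>x\<in>?J. d (m x) \<ominus> m (d x)) \<in> Der_deg (i + j) ?J"
        using br(2) by (simp add: derivations_of_degree_def)
      then show ?thesis using J unfolding eq br(1) by (auto simp: H_def)
    qed
  qed
qed

lemma to_graded_iso: "to_graded \<in> graded_lie_isos R ess.Q H gr.Q (Q_gr_m_grading R L G)"
proof -
  have img: "to_graded (ess.cls I d) = gr.cls I d" if "GE I" "d \<in> Der I" for I d
    using to_graded_cls that .
  have "inj_on to_graded (carrier ess.Q)"
  proof (rule inj_onI)
    fix X Y assume "X \<in> carrier ess.Q" "Y \<in> carrier ess.Q" and e: "to_graded X = to_graded Y"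
    then obtain I d m where I: "GE I" and d: "d \<in> Der I" and m: "m \<in> Der I"
      and eq: "X = ess.cls I d" "Y = ess.cls I m"
      by (auto elim: ess_carrier2E)
    then have "gr.cls I d = gr.cls I m" using e img by simp
    then show "X = Y" using I d m by (simp add: eq ess_cls_eq_iff gr.cls_eq_iff)
  qed
  moreover have "to_graded ` carrier ess.Q = carrier gr.Q"
  proof
    show "to_graded ` carrier ess.Q \<subseteq> carrier gr.Q"
      by (auto elim!: ess_carrierE simp: img intro!: gr.cls_closed)
    show "carrier gr.Q \<subseteq> to_graded ` carrier ess.Q"
    proof
      fix Y assume "Y \<in> carrier gr.Q"
      then obtain I d where I: "GE I" and d: "d \<in> Der I" and Y: "Y = gr.cls I d"
        by (auto simp: gr.carrier_Q)
      show "Y \<in> to_graded ` carrier ess.Q"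
        unfolding Y img [OF I d, symmetric] using ess.cls_closed d GE_D(1) [OF I] by simp
    qed
  qed
  moreover have "to_graded (X \<oplus>\<^bsub>ess.Q\<^esub> Y) = to_graded X \<oplus>\<^bsub>gr.Q\<^esub> to_graded Y \<and>
      to_graded \<^bold>[X, Y\<^bold>]\<^bsub>ess.Q\<^esub> = \<^bold>[to_graded X, to_graded Y\<^bold>]\<^bsub>gr.Q\<^esub>"
    if mem_Q: "X \<in> carrier ess.Q" "Y \<in> carrier ess.Q" for X Y
  proof -
    obtain I d m where I: "GE I" and d: "d \<in> Der I" and m: "m \<in> Der I"
      and eq: "X = ess.cls I d" "Y = ess.cls I m"
      using mem_Q by (rule ess_carrier2E)
    have I1: "I \<in> {I. essential_ideal R L I}" and I2: "I \<in> {I. GE I}" using GE_D I by auto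
    have J: "GE (bracket_span R L I I)" using gr.span_mem I by simp
    show ?thesis
      using img I J d m derivation_add [OF d m GE_D(3) [OF I]]
        ess.add_cls_same [OF I1 d m] gr.add_cls_same [OF I2 d m]
        ess.bracket_cls_same [OF I1 d m] gr.bracket_cls_same [OF I2 d m]
      by (simp add: eq)
  qed
  moreover have "to_graded (a \<odot>\<^bsub>ess.Q\<^esub> X) = a \<odot>\<^bsub>gr.Q\<^esub> to_graded X"
    if a: "a \<in> carrier R" and mem_Q: "X \<in> carrier ess.Q" for a X
  proof -
    obtain I d where I: "GE I" and d: "d \<in> Der I" and X: "X = ess.cls I d"
      using mem_Q by (rule ess_carrierE)
    show ?thesis
      using img I d a derivation_smult [OF d a GE_D(3) [OF I]] GE_D(1) [OF I]
      by (simp add: X ess.smult_cls gr.smult_cls)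
  qed
  moreover have "to_graded ` H k = Q_gr_m_grading R L G k" for k
  proof -
    have grading: "Q_gr_m_grading R L G k = {gr.cls I d | I d. GE I \<and> d \<in> Der_deg k I}"
      by (simp add: Q_gr_m_grading_def limit_class_graded)
    show ?thesis
      unfolding grading
    proof (intro equalityI subsetI)
      fix Y assume "Y \<in> to_graded ` H k"
      then obtain I d where I: "GE I" and d: "d \<in> Der_deg k I" and Y: "Y = to_graded (ess.cls I d)"
        by (auto simp: H_def)
      then show "Y \<in> {gr.cls I d | I d. GE I \<and> d \<in> Der_deg k I}"
        using img [OF I Der_degD(1) [OF d]] by blast
    next
      fix Y assume "Y \<in> {gr.cls I d | I d. GE I \<and> d \<in> Der_deg k I}"
      then obtain I d where I: "GE I" and d: "d \<in> Der_deg k I" and Y: "Y = gr.cls I d"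
        by blast
      have "ess.cls I d \<in> H k" using I d by (auto simp: H_def)
      then show "Y \<in> to_graded ` H k"
        using img [OF I Der_degD(1) [OF d]] Y by blast
    qed
  qed
  ultimately show ?thesis
    by (simp add: graded_lie_isos_def lie_isos_def bij_betw_def)
qed

lemma to_graded_embedding:
  assumes "x \<in> carrier L"
  shows "to_graded (Q_m_embedding R L x) = Q_gr_m_embedding R L G x"
  using to_graded_cls [OF _ derivation_ad [OF assms]] gr.carrier_mem
  by (simp add: Q_m_embedding_def Q_gr_m_embedding_def limit_embedding_def limit_class_graded)

section \<open>The 3-grading and strong nondegeneracy of the quotient algebra\<close>

lemma ess_cls_eq_zero:
  assumes nondeg: "strongly_nondegenerate L"
    and tf2: "torsion_free 2 L" and tf3: "torsion_free 3 L"
    and I: "essential_ideal R L I" and d: "d \<in> Der I"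
    and J: "essential_ideal R L J" "J \<subseteq> I"
    and dJ: "\<And>x. x \<in> J \<Longrightarrow> d x \<in> I" and dd: "\<And>x. x \<in> J \<Longrightarrow> d (d x) = \<zero>"
  shows "ess.cls I d = \<zero>\<^bsub>ess.Q\<^esub>"
proof -
  have I': "lie_ideal R L I" and J': "lie_ideal R L J" using I J by (auto simp: essential_ideal_def)
  \<comment> \<open>On [J, J] the values of d lie in J, as \<open>square_zero_derivation\<close>
    demands. Vanishing on this essential ideal is all that the class being zero requires.\<close>
  let ?K = "bracket_span R L J J"
  have K: "essential_ideal R L ?K" using essential_ideal_bracket_span J by blast
  have KJ: "?K \<subseteq> J" using bracket_span_subset [OF J'] .
  have "d x = \<zero>" if "x \<in> ?K" for x
    using square_zero_derivation [OF nondeg tf2 tf3 I' J' J(2) d dJ dd, of x]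
      derivation_bracket_span [OF d J' J(2) that] KJ that by auto
  then show ?thesis
    using I d J(2) K KJ derivation_const_zero [OF I']
    by (subst ess.zero_Q_on [of I]) (auto simp: ess.cls_eq_iff intro!: exI [of _ ?K])
qed

lemma three_graded_Q:
  assumes nondeg: "strongly_nondegenerate L"
    and tf2: "torsion_free 2 L" and tf3: "torsion_free 3 L"
  shows "three_graded ess.Q H"
  unfolding three_graded_def
proof (intro allI impI equalityI subsetI)
  fix k :: int and X assume k: "k \<notin> {-1, 0, 1}" and "X \<in> H k"
  then obtain I d where I: "GE I" and d: "d \<in> Der_deg k I" and X: "X = ess.cls I d"
    by (auto simp: H_def)
  note dD = Der_degD [OF d] and I' = GE_D [OF I]
  define J where "J = bracket_span R L I I"
  have J: "GE J" using gr.span_mem I by (simp add: J_def)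
  have JI: "J \<subseteq> I" using bracket_span_subset [OF I'(3)] by (simp add: J_def)
  have dJ: "d x \<in> I" if "x \<in> J" for x
    using derivation_bracket_span [OF dD(1) I'(3) order_refl] that by (simp add: J_def)
  have "d (d x) = \<zero>" if "x \<in> J" for x
    using GE_D(2) [OF J] that
  proof (induction rule: graded_ideal_induct)
    case (homogeneous x j)
    have "d (d x) \<in> G (j + k + k)"
      using dD(2) [OF dJ dD(2)] homogeneous JI by blast
    moreover have "d (d x) = \<zero>" if "j \<notin> {-1, 0, 1}"
    proof -
      have "x = \<zero>" using G_outside that homogeneous by blast
      moreover have "d \<zero> = \<zero>" using derivation_zero [OF dD(1)] lie_idealD(2) [OF I'(3)] by blast
      ultimately show ?thesis by simp
    qed
    \<comment> \<open>For j in {-1, 0, 1} and k of absolute value at least 2, the degree j + k + k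
      has absolute value at least 3; for any other j already x is zero.\<close>
    ultimately show ?case
      using G_outside [of "j + k + k"] k by fastforce
  next
    case (add x y)
    then show ?case
      using derivationD(2) [OF dD(1)] dJ JI by (simp add: subset_iff)
  qed
  then show "X \<in> {\<zero>\<^bsub>ess.Q\<^esub>}"
    using ess_cls_eq_zero [OF nondeg tf2 tf3 I'(1) dD(1) GE_D(1) [OF J] JI dJ] X by simp
next
  fix k :: int and X assume "X \<in> {\<zero>\<^bsub>ess.Q\<^esub>}"
  interpret Q: graded_lie_algebra R ess.Q H by (rule graded_lie_algebra_Q)
  show "X \<in> H k"
    using \<open>X \<in> {\<zero>\<^bsub>ess.Q\<^esub>}\<close> subgroup.one_closed [OF submodule.axioms(1) [OF Q.component_submodule]] by simp
qed

text \<open>On [I, I] the commutator of d with ad x is ad (d x), by the Leibniz rule. Thus a class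
  acts on the copy of I inside the quotient algebra as its representative does, which pulls
  identities back to L.\<close>

lemma bracket_embedding:
  assumes I: "essential_ideal R L I" and d: "d \<in> Der I" and x: "x \<in> I"
  shows "\<^bold>[ess.cls I d, Q_m_embedding R L x\<^bold>]\<^bsub>ess.Q\<^esub> = Q_m_embedding R L (d x)"
proof -
  have I': "lie_ideal R L I" using I by (simp add: essential_ideal_def)
  note ID = lie_idealD [OF I'] and dD = derivationD [OF d]
  have xc: "x \<in> carrier L" and dx: "d x \<in> carrier L" using ID x dD by auto
  let ?J = "bracket_span R L I I" and ?ad = "\<lambda>x. \<lambda>y\<in>carrier L. \<^bold>[x, y\<^bold>]"
  have J: "essential_ideal R L ?J" using essential_ideal_bracket_span I by blast
  have JI: "y \<in> I" if "y \<in> ?J" for y using bracket_span_subset [OF I'] that by blast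
  have r: "restrict (?ad x) I \<in> Der I"
    using derivation_restrict [OF derivation_ad [OF xc] I' ID(1)] .
  have emb: "Q_m_embedding R L x = ess.cls I (restrict (?ad x) I)"
    using ess.cls_restrict [OF ess.carrier_mem derivation_ad [OF xc], of I] I ID(1)
    by (simp add: Q_m_embedding_def limit_embedding_def)
  have emb_dx: "Q_m_embedding R L (d x) = ess.cls ?J (restrict (?ad (d x)) ?J)"
    using ess.cls_restrict [OF ess.carrier_mem derivation_ad [OF dx], of ?J] J ID(1) JI
    by (auto simp: Q_m_embedding_def limit_embedding_def)
  have "(\<lambda>y\<in>?J. d (restrict (?ad x) I y) \<ominus> restrict (?ad x) I (d y)) = restrict (?ad (d x)) ?J"
  proof (rule restrict_ext)
    fix y assume y: "y \<in> ?J"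
    have yI: "y \<in> I" and dy: "d y \<in> I"
      using JI y derivation_bracket_span [OF d I' order_refl y] by auto
    have yc: "y \<in> carrier L" "d y \<in> carrier L" using yI dy ID by auto
    have "d \<^bold>[x, y\<^bold>] \<ominus> \<^bold>[x, d y\<^bold>] = \<^bold>[d x, y\<^bold>] \<oplus> (\<^bold>[x, d y\<^bold>] \<ominus> \<^bold>[x, d y\<^bold>])"
      using dD(4) [OF x yI] xc dx yc by (simp add: M.minus_eq M.a_assoc)
    then show "d (restrict (?ad x) I y) \<ominus> restrict (?ad x) I (d y) = ?ad (d x) y"
      using yI dy yc xc dx by (simp add: M.minus_eq M.r_neg)
  qed
  then show ?thesis
    using ess.bracket_cls_same(1) [OF _ d r] I by (simp add: emb emb_dx)
qed

lemma embedding_eq_zero: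
  assumes v: "v \<in> carrier L" and z: "Q_m_embedding R L v = \<zero>\<^bsub>ess.Q\<^esub>"
  shows "v = \<zero>"
proof -
  have "\<exists>K\<in>{I. essential_ideal R L I}. K \<subseteq> carrier L \<inter> carrier L \<and>
      (\<forall>y\<in>K. (\<lambda>y\<in>carrier L. \<^bold>[v, y\<^bold>]) y = (\<lambda>y\<in>carrier L. \<zero>) y)"
    using z derivation_ad [OF v] derivation_const_zero [OF lie_ideal_carrier] ess.carrier_mem
      ess.cls_eq_iff [OF ess.carrier_mem derivation_ad [OF v] ess.carrier_mem]
    by (simp add: Q_m_embedding_def limit_embedding_def ess.zero_Q)
  then obtain K where K: "essential_ideal R L K" "K \<subseteq> carrier L"
    and "\<forall>y\<in>K. (\<lambda>y\<in>carrier L. \<^bold>[v, y\<^bold>]) y = (\<lambda>y\<in>carrier L. \<zero>) y"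
    by auto
  then have "\<^bold>[v, y\<^bold>] = \<zero>" if "y \<in> K" for y
    using that subsetD [OF K(2) that] by auto
  then show ?thesis using essential_annihilator [OF K(1) v] by blast
qed

lemma strongly_nondegenerate_Q:
  assumes nondeg: "strongly_nondegenerate L"
    and tf2: "torsion_free 2 L" and tf3: "torsion_free 3 L"
  shows "strongly_nondegenerate ess.Q"
  unfolding strongly_nondegenerate_def
proof (intro ballI impI)
  fix X assume "X \<in> carrier ess.Q"
    and sq: "\<forall>Y\<in>carrier ess.Q. \<^bold>[X, \<^bold>[X, Y\<^bold>]\<^bsub>ess.Q\<^esub>\<^bold>]\<^bsub>ess.Q\<^esub> = \<zero>\<^bsub>ess.Q\<^esub>"
  then obtain I d where I: "essential_ideal R L I" and d: "d \<in> Der I" and X: "X = ess.cls I d"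
    by (auto simp: ess.carrier_Q)
  have I': "lie_ideal R L I" using I by (simp add: essential_ideal_def)
  let ?J = "bracket_span R L I I"
  have J: "essential_ideal R L ?J" and JI: "?J \<subseteq> I"
    using essential_ideal_bracket_span [OF I] bracket_span_subset [OF I'] by auto
  have dJ: "d x \<in> I" if "x \<in> ?J" for x
    using derivation_bracket_span [OF d I' order_refl that] .
  \<comment> \<open>It is enough to test the hypothesis on embedded elements of [I, I]: there the
    double bracket with X is the image of d (d x), and the embedding is injective.\<close>
  have "d (d x) = \<zero>" if x: "x \<in> ?J" for x
  proof -
    have xI: "x \<in> I" and xc: "x \<in> carrier L" using x JI lie_idealD(3) [OF I'] by auto
    have "Q_m_embedding R L x \<in> carrier ess.Q"
      using ess.cls_closed [OF ess.carrier_mem derivation_ad [OF xc]]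
      by (simp add: Q_m_embedding_def limit_embedding_def)
    then have "Q_m_embedding R L (d (d x)) = \<zero>\<^bsub>ess.Q\<^esub>"
      using bspec [OF sq, of "Q_m_embedding R L x"] bracket_embedding [OF I d xI]
        bracket_embedding [OF I d dJ [OF x]] by (simp add: X)
    then show ?thesis
      using embedding_eq_zero derivationD(1) [OF d dJ [OF x]] by blast
  qed
  then show "X = \<zero>\<^bsub>ess.Q\<^esub>"
    using ess_cls_eq_zero [OF nondeg tf2 tf3 I d J JI dJ] X by simp
qed

end

text \<open>Both parts share one existential statement, so that the 3-grading in the second part
  refers to the very grading H that the isomorphism transports.\<close>

theorem theorem3p2:
  fixes R :: "('a, 'r) ring_scheme" and L :: "('a, 'b, 'm) lie_alg_scheme"
    and G :: "int \<Rightarrow> 'b set"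
  assumes "graded_lie_algebra R L G"
    and "three_graded L G"
    and "semiprime R L"
  shows "\<exists>H f.
    graded_lie_algebra R (Q_m R L) H \<and>
    f \<in> graded_lie_isos R (Q_m R L) H (Q_gr_m R L G) (Q_gr_m_grading R L G) \<and>
    (\<forall>x\<in>carrier L. f (Q_m_embedding R L x) = Q_gr_m_embedding R L G x) \<and>
    (strongly_nondegenerate L \<and> torsion_free 2 L \<and> torsion_free 3 L \<longrightarrow>
      three_graded (Q_m R L) H \<and> strongly_nondegenerate (Q_m R L))"
proof -
  interpret graded_lie_algebra R L G by fact
  interpret semiprime_three_graded_lie R L G
    by unfold_locales (use assms in auto)
  show ?thesis
    unfolding Q_m_eq Q_gr_m_eq
    using graded_lie_algebra_Q to_graded_iso to_graded_embedding three_graded_Q strongly_nondegenerate_Q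
    by blast
qed

end
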